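(* Let $\varepsilon\in(0,1)$ and $R\in(0,2\operatorname{diam}(\Omega))$ be such that $\frac hR<\frac\varepsilon4$. Let $B_R$ and $B_{(1+\varepsilon)R}$ be two concentric boxes and $\mathbf E_h\in\mathcal H_{c,h}(B_{(1+\varepsilon)R}\cap\Omega)$. Then there exists a constant $C$ depending only on $\kappa$, $\Omega$, and the $\gamma$-shape regularity of the quasi-uniform triangulation $\mathcal T_h$ such that $$\|\nabla\times\mathbf E_h\|_{\mathbf L^2(B_R\cap\Omega)}\le C\,\frac{1+\varepsilon}{\varepsilon}\,|||\mathbf E_h|||_{c,h,(1+\varepsilon)R}.$$
   Context: $\Omega\subset\mathbb R^3$ is a bounded simply connected polyhedral Lipschitz domain with boundary $\Gamma$ and outward unit normal $\mathbf n$. All function spaces are complex; $\mathbf L^2=(L^2)^3$. For open $\omega$, $\mathbf H(\operatorname{curl},\omega)=\{\mathbf U\in\mathbf L^2(\omega):\nabla\times\mathbf U\in\mathbf L^2(\omega)\}$; $\mathbf H_0(\operatorname{curl},\Omega)$ is the subspace of $\mathbf H(\operatorname{curl},\Omega)$ with $\mathbf n\times\mathbf U=0$ on $\Gamma$. $\kappa=\omega^2(\varepsilon_d+i\sigma_c/\omega)$ is a constant ($\varepsilon_d>0$, $\sigma_c\ge0$, frequency $\omega$), assumed not to be an eigenvalue of $\nabla\times\nabla\times$ on $\mathbf H_0(\operatorname{curl},\Omega)$ (in particular $\kappa\neq0$), and $a(\mathbf U,\mathbf V)=\langle\nabla\times\mathbf U,\nabla\times\mathbf V\rangle_{\mathbf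 L^2}-\kappa\langle\mathbf U,\mathbf V\rangle_{\mathbf L^2}$. $\mathcal T_h$ is a quasi-uniform triangulation of $\Omega$ into open tetrahedra without hanging nodes, $h=\max_{T}\operatorname{diam}(T)$; there are fixed constants $\gamma,\gamma'>0$ with $\operatorname{diam}(T)\le\gamma|T|^{1/3}$ and $h\le\gamma'\operatorname{diam}(T)$ for all $T\in\mathcal T_h$. "Depending on the $\gamma$-shape regularity of the quasi-uniform triangulation" means depending on $\gamma,\gamma'$ only. $\mathcal N_0(T)=\{\mathbf x\mapsto\mathbf a+\mathbf b\times\mathbf x:\mathbf a,\mathbf b\in\mathbb C^3\}$; $\mathbf X_{h,0}(\mathcal T_h,\Omega)=\{\mathbf U_h\in\mathbf H_0(\operatorname{curl},\Omega):\mathbf U_h|_T\in\mathcal N_0(T)\ \forall T\in\mathcal T_h\}$. A *box* is an axis-parallel cube $B_R\subset\mathbb R^3$ (subscript = side length); concentric boxes have the same barycenter. For a bounded open set $B\subset\mathbb R^3$, $\mathcal H_{c,h}(B\cap\Omega)$ is the set of $\mathbf U_h\in\mathbf H(\operatorname{curl},B\cap\Omega)$ for which there is $\widetilde{\mathbf U}_h\in\mathbf X_{h,0}(\mathcal T_h,\Omega)$ with $\mathbf U_h=\widetilde{\mathbf U}_h|_{B\cap\Omega}$, and $a(\mathbf U_h,\Psi_h)=0$ (integrals over $B\cap\Omega$) for all $\Psi_h\in\mathbf X_{h,0}(\mathcal T_h,\Omega)$ with $\operatorname{supp}\Psi_h\subset\overline{B\cap\Omega}$. The weighted norm attached to a box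 $B_R$ is $$|||\mathbf U|||^2_{c,h,R}=\frac{h^2}{R^2}\|\nabla\times\mathbf U\|^2_{\mathbf L^2(B_R\cap\Omega)}+\frac1{R^2}\|\mathbf U\|^2_{\mathbf L^2(B_R\cap\Omega)} ;$$ $|||\cdot|||_{c,h,(1+\varepsilon)R}$ is the same with $R$ replaced by $(1+\varepsilon)R$ and the box $B_{(1+\varepsilon)R}$. *)

theory Defs
  imports "HOL-Analysis.Analysis"
begin

type_synonym vfield = "real^3 \<Rightarrow> complex^3"

subsection \<open>Smooth fields and the classical curl\<close>

definition partial_deriv :: "3 \<Rightarrow> (real^3 \<Rightarrow> 'b::real_normed_vector) \<Rightarrow> real^3 \<Rightarrow> 'b" where
  "partial_deriv i f x = frechet_derivative f (at x) (axis i 1)"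

primrec Ck_field :: "nat \<Rightarrow> (real^3 \<Rightarrow> 'b::real_normed_vector) \<Rightarrow> bool" where
  "Ck_field 0 f \<longleftrightarrow> continuous_on UNIV f"
| "Ck_field (Suc k) f \<longleftrightarrow> (\<forall>x. f differentiable (at x)) \<and> (\<forall>i. Ck_field k (partial_deriv i f))"

definition smooth_field :: "(real^3 \<Rightarrow> 'b::real_normed_vector) \<Rightarrow> bool" where
  "smooth_field f \<longleftrightarrow> (\<forall>k. Ck_field k f)"

definition test_field :: "(real^3) set \<Rightarrow> vfield \<Rightarrow> bool" where
  "test_field \<omega> \<phi> \<longleftrightarrow> smooth_field \<phi> \<and>
     compact (closure {x. \<phi> x \<noteq> 0}) \<and> closure {x. \<phi> x \<noteq> 0} \<subseteq> \<omega>"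

definition classical_curl :: "vfield \<Rightarrow> vfield" where
  "classical_curl \<phi> x = vector
     [partial_deriv 2 \<phi> x $ 3 - partial_deriv 3 \<phi> x $ 2,
      partial_deriv 3 \<phi> x $ 1 - partial_deriv 1 \<phi> x $ 3,
      partial_deriv 1 \<phi> x $ 2 - partial_deriv 2 \<phi> x $ 1]"

subsection \<open>Complex vector-valued \<open>L\<^sup>2\<close> and \<open>H(curl)\<close>\<close>

text \<open>Elements of these spaces are represented by functions on all of \<open>\<real>\<^sup>3\<close>. Only the values
  almost everywhere on \<open>\<omega>\<close> matter.\<close>

definition L2_field :: "(real^3) set \<Rightarrow> vfield set" where
  "L2_field \<omega> = {f. f \<in> borel_measurable (lebesgue_on \<omega>) \<and>
                    integrable (lebesgue_on \<omega>) (\<lambda>x. (norm (f x))\<^sup>2)}"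

definition L2_inner :: "(real^3) set \<Rightarrow> vfield \<Rightarrow> vfield \<Rightarrow> complex" where
  "L2_inner \<omega> f g = integral\<^sup>L (lebesgue_on \<omega>) (\<lambda>x. \<Sum>i\<in>UNIV. f x $ i * cnj (g x $ i))"

definition L2_norm :: "(real^3) set \<Rightarrow> vfield \<Rightarrow> real" where
  "L2_norm \<omega> f = sqrt (integral\<^sup>L (lebesgue_on \<omega>) (\<lambda>x. (norm (f x))\<^sup>2))"

definition has_weak_curl :: "(real^3) set \<Rightarrow> vfield \<Rightarrow> vfield \<Rightarrow> bool" where
  "has_weak_curl \<omega> U G \<longleftrightarrow>
     (\<forall>\<phi>. test_field \<omega> \<phi> \<longrightarrow> L2_inner \<omega> G \<phi> = L2_inner \<omega> U (classical_curl \<phi>))"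

definition Hcurl :: "(real^3) set \<Rightarrow> vfield set" where
  "Hcurl \<omega> = {U \<in> L2_field \<omega>. \<exists>G \<in> L2_field \<omega>. has_weak_curl \<omega> U G}"

text \<open>For \<open>U \<in> Hcurl \<omega>\<close> and open \<open>\<omega>\<close> the choice below is unique up to null sets.\<close>

definition curl :: "(real^3) set \<Rightarrow> vfield \<Rightarrow> vfield" where
  "curl \<omega> U = (SOME G. G \<in> L2_field \<omega> \<and> has_weak_curl \<omega> U G)"

text \<open>The tangential trace \<open>n \<times> U\<close> of \<open>U \<in> Hcurl \<Omega>\<close> is the boundary functional defined by Green's
  formula \<open>\<integral>\<^sub>\<Gamma> (n \<times> U) \<cdot> cnj V = \<integral>\<^sub>\<Omega> (curl U) \<cdot> cnj V - U \<cdot> cnj (curl V)\<close>; for a bounded Lipschitz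
  domain it is determined by the fields \<open>V\<close> that are smooth up to the boundary.\<close>

definition tangential_trace :: "(real^3) set \<Rightarrow> vfield \<Rightarrow> vfield \<Rightarrow> complex" where
  "tangential_trace \<Omega> U V = L2_inner \<Omega> (curl \<Omega> U) V - L2_inner \<Omega> U (classical_curl V)"

definition Hcurl0 :: "(real^3) set \<Rightarrow> vfield set" where
  "Hcurl0 \<Omega> = {U \<in> Hcurl \<Omega>. \<forall>V. smooth_field V \<longrightarrow> tangential_trace \<Omega> U V = 0}"

definition curlcurl_eigenvalue :: "(real^3) set \<Rightarrow> complex \<Rightarrow> bool" where
  "curlcurl_eigenvalue \<Omega> \<kappa> \<longleftrightarrow>
     (\<exists>U \<in> Hcurl0 \<Omega>. L2_norm \<Omega> U \<noteq> 0 \<and> curl \<Omega> U \<in> Hcurl \<Omega> \<and>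
        (AE x in lebesgue_on \<Omega>. curl \<Omega> (curl \<Omega> U) x = \<kappa> *s U x))"

definition maxwell_form :: "complex \<Rightarrow> (real^3) set \<Rightarrow> vfield \<Rightarrow> vfield \<Rightarrow> complex" where
  "maxwell_form \<kappa> \<omega> U V = L2_inner \<omega> (curl \<omega> U) (curl \<omega> V) - \<kappa> * L2_inner \<omega> U V"

subsection \<open>Domains\<close>

text \<open>Near each boundary point, in suitable orthonormal coordinates, the domain is the subgraph of a
  Lipschitz function of two variables.\<close>

definition lipschitz_domain :: "(real^3) set \<Rightarrow> bool" where
  "lipschitz_domain \<Omega> \<longleftrightarrow> open \<Omega> \<and> connected \<Omega> \<and> \<Omega> \<noteq> {} \<and>
     (\<forall>p \<in> frontier \<Omega>. \<exists>r>0. \<exists>(Q :: real^3 \<Rightarrow> real^3) (g :: real^2 \<Rightarrow> real) L.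
        orthogonal_transformation Q \<and> L-lipschitz_on UNIV g \<and>
        \<Omega> \<inter> ball p r = {x \<in> ball p r. Q x $ 3 < g (vector [Q x $ 1, Q x $ 2])})"

definition polyhedral :: "(real^3) set \<Rightarrow> bool" where
  "polyhedral \<Omega> \<longleftrightarrow>
     (\<exists>F. finite F \<and> (\<forall>P \<in> F. polytope P \<and> aff_dim P = 2) \<and> frontier \<Omega> = \<Union>F)"

subsection \<open>Meshes and lowest-order Nedelec elements\<close>

text \<open>Mesh elements are open tetrahedra. The library notion \<^const>\<open>triangulation\<close>, applied to the closed
  tetrahedra, makes the mesh finite and free of hanging nodes (intersections are common faces).\<close>

definition tet_mesh :: "(real^3) set \<Rightarrow> (real^3) set set \<Rightarrow> bool" where
  "tet_mesh \<Omega> \<T> \<longleftrightarrow> (\<forall>T \<in> \<T>. \<exists>S. 3 simplex S \<and> T = interior S) \<and>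
     triangulation (closure ` \<T>) \<and> \<Union>(closure ` \<T>) = closure \<Omega>"

definition mesh_size :: "(real^3) set set \<Rightarrow> real" where
  "mesh_size \<T> = Max (diameter ` \<T>)"

definition quasi_uniform :: "real \<Rightarrow> real \<Rightarrow> (real^3) set set \<Rightarrow> bool" where
  "quasi_uniform \<gamma> \<gamma>' \<T> \<longleftrightarrow>
     (\<forall>T \<in> \<T>. diameter T \<le> \<gamma> * root 3 (measure lebesgue T) \<and> mesh_size \<T> \<le> \<gamma>' * diameter T)"

definition ccross :: "complex^3 \<Rightarrow> complex^3 \<Rightarrow> complex^3" where
  "ccross a b = vector [a$2 * b$3 - a$3 * b$2, a$3 * b$1 - a$1 * b$3, a$1 * b$2 - a$2 * b$1]"

definition nedelec0 :: "vfield set" where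
  "nedelec0 = {(\<lambda>x. a + ccross b (\<chi> i. complex_of_real (x $ i))) | a b. True}"

definition Xh0 :: "(real^3) set set \<Rightarrow> (real^3) set \<Rightarrow> vfield set" where
  "Xh0 \<T> \<Omega> = {U \<in> Hcurl0 \<Omega>. \<forall>T \<in> \<T>. \<exists>N \<in> nedelec0. AE x in lebesgue_on T. U x = N x}"

subsection \<open>Discrete local solutions and the weighted norm\<close>

definition cube :: "real^3 \<Rightarrow> real \<Rightarrow> (real^3) set" where
  "cube c R = {x. \<forall>i. \<bar>x $ i - c $ i\<bar> < R / 2}"

text \<open>Support of an almost-everywhere class on \<open>\<Omega>\<close>: the points having no neighbourhood on which the
  field vanishes almost everywhere.\<close>

definition ess_support :: "(real^3) set \<Rightarrow> vfield \<Rightarrow> (real^3) set" where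
  "ess_support \<Omega> f = {x. \<forall>r>0. \<not> (AE y in lebesgue_on (\<Omega> \<inter> ball x r). f y = 0)}"

definition Hch :: "complex \<Rightarrow> (real^3) set set \<Rightarrow> (real^3) set \<Rightarrow> (real^3) set \<Rightarrow> vfield set" where
  "Hch \<kappa> \<T> \<Omega> B = {U \<in> Hcurl (B \<inter> \<Omega>).
     (\<exists>W \<in> Xh0 \<T> \<Omega>. AE x in lebesgue_on (B \<inter> \<Omega>). U x = W x) \<and>
     (\<forall>\<Psi> \<in> Xh0 \<T> \<Omega>. ess_support \<Omega> \<Psi> \<subseteq> closure (B \<inter> \<Omega>) \<longrightarrow> maxwell_form \<kappa> (B \<inter> \<Omega>) U \<Psi> = 0)}"

definition weighted_norm :: "(real^3) set \<Rightarrow> real^3 \<Rightarrow> real \<Rightarrow> real \<Rightarrow> vfield \<Rightarrow> real" where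
  "weighted_norm \<Omega> c h R U = sqrt
     (h\<^sup>2 / R\<^sup>2 * (L2_norm (cube c R \<inter> \<Omega>) (curl (cube c R \<inter> \<Omega>) U))\<^sup>2 +
      1 / R\<^sup>2 * (L2_norm (cube c R \<inter> \<Omega>) U)\<^sup>2)"

end

theory Submission
  imports Defs
begin

text \<open>Let \<open>\<eta>\<close> be a Lipschitz cutoff in the maximum norm that is \<open>1\<close> on \<open>B\<^sub>R\<close>. Instead of
  interpolating \<open>\<eta>\<^sup>2 E\<close>, the test field \<open>\<Psi>\<close> is obtained from \<open>E\<close> by multiplying each edge degree of
  freedom by the value of \<open>\<eta>\<^sup>2\<close> at the midpoint of that edge. A field is conforming iff, on every facet,
  a linear relation between the edge degrees of freedom of the adjacent elements holds edge by edge (Green's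
  formula on each tetrahedron, localised by bump functions), so \<open>\<Psi>\<close> inherits conformity from \<open>E\<close>. On an
  element with reference value \<open>\<eta>\<^sub>T\<close>, the weights differ from \<open>\<eta>\<^sub>T\<^sup>2\<close> by at most \<open>\<delta> (2 \<eta>\<^sub>T + \<delta>)\<close>
  with \<open>\<delta> = 4 h / (\<epsilon> R)\<close>. Hence by an inverse estimate \<open>curl \<Psi> - \<eta>\<^sub>T\<^sup>2 curl E\<close> is bounded by
  \<open>(\<epsilon> R)\<^sup>-\<^sup>1 (2 \<eta>\<^sub>T + \<delta>)\<close> times \<open>E\<close> in \<open>L\<^sup>2(T)\<close>, and testing with \<open>\<Psi>\<close> and absorbing
  \<open>\<Sum> \<eta>\<^sub>T\<^sup>2 \<parallel>curl E\<parallel>\<^sup>2\<close> gives the claim.\<close>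

section \<open>Smooth bump functions\<close>

text \<open>The tangential trace exists only as a functional on smooth fields, so conformity cannot
  be read off pointwise and has to be recovered from Green's formula summed over the mesh. What
  comes out for each facet is a homogeneous linear relation between the values of one fixed edge in
  all adjacent elements. Such a relation survives if these values are multiplied by a common number;
  this is why the weights may depend on the edge but not on the element. Boundary facets and
  interior facets need no distinction. The constants come from the geometry. With L = \<epsilon> R
  the two boxes are L/2 apart in the maximum norm. The cutoff decays over the first L/4, hence has
  slope 4/L; the bound h < L/4 keeps every element that touches its support inside the larger box.
  Squaring the cutoff leaves a factor 2 \<eta>_T in the commutator, which Young's inequality
  absorbs. The remainder \<delta> carries a factor h next to the curl, and this produces the weight
  h^2 of the curl in the norm. The term with \<kappa> is compared with 1/L^2 through L \<le> 2
  diam(\<Omega>).\<close>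

lemma smooth_fieldI:
  assumes "\<And>f. f \<in> S \<Longrightarrow> (\<forall>x. f differentiable (at x)) \<and> (\<forall>i. partial_deriv i f \<in> S)"
    and "f \<in> S"
  shows "smooth_field f"
proof -
  have "f \<in> S \<Longrightarrow> Ck_field k f" for k f
  proof (induction k arbitrary: f)
    case 0
    then show ?case
      using assms(1)
      by (auto intro!: continuous_at_imp_continuous_on differentiable_imp_continuous_within)
  next
    case (Suc k)
    then show ?case using assms(1) by auto
  qed
  then show ?thesis using assms(2) by (auto simp: smooth_field_def)
qed

lemma smooth_field_differentiable: "smooth_field f \<Longrightarrow> f differentiable (at x)"
  unfolding smooth_field_def by (metis Ck_field.simps(2))

lemma smooth_field_continuous_partial:
  assumes "smooth_field f" shows "continuous_on UNIV (partial_deriv i f)"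
proof -
  have "Ck_field (Suc 0) f" using assms unfolding smooth_field_def by blast
  then show ?thesis by simp
qed

lemma smooth_field_continuous: "smooth_field f \<Longrightarrow> continuous_on UNIV f"
  unfolding smooth_field_def by (metis Ck_field.simps(1))

text \<open>With \<open>q t = (t - a) (b - t)\<close>, the functions \<open>(p / q\<^sup>n) exp (- s / q)\<close> on \<open>(a, b)\<close>, extended by \<open>0\<close>,
  form a class that is closed under differentiation.\<close>

definition bump1 :: "real \<Rightarrow> real \<Rightarrow> real \<Rightarrow> real poly \<Rightarrow> nat \<Rightarrow> real \<Rightarrow> real" where
  "bump1 a b s p n t = (if a < t \<and> t < b
     then poly p t / ((t - a) * (b - t)) ^ n * exp (- s / ((t - a) * (b - t))) else 0)"

text \<open>At a point \<open>t\<close> outside the open interval the function is bounded by a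
  multiple of \<open>(y - t)\<^sup>2\<close>: the exponential beats every power of the quadratic
  \<open>q\<close>, and \<open>q\<close> itself vanishes linearly at the endpoint lying between
  \<open>t\<close> and the interval.\<close>

lemma bump1_has_derivative_boundary:
  assumes s: "s > 0" and t: "\<not> (a < t \<and> t < b)"
  shows "(bump1 a b s p n has_real_derivative 0) (at t)"
proof -
  have "compact (poly p ` {a..b})"
    by (intro compact_continuous_image continuous_intros) auto
  then have "bounded (poly p ` {a..b})" by (rule compact_imp_bounded)
  then obtain M where M: "\<And>y. y \<in> {a..b} \<Longrightarrow> \<bar>poly p y\<bar> \<le> M"
    unfolding bounded_iff by (metis imageI real_norm_def)
  define K where "K = \<bar>M\<bar> * (fact (n + 2) / s ^ (n + 2)) * (b - a)\<^sup>2"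
  have bound: "\<bar>bump1 a b s p n y\<bar> \<le> \<bar>K\<bar> * (y - t)\<^sup>2" for y
  proof (cases "a < y \<and> y < b")
    case False
    then show ?thesis by (auto simp: bump1_def)
  next
    case True
    define q where "q = (y - a) * (b - y)"
    have q: "q > 0" using True by (simp add: q_def)
    have qle: "q \<le> \<bar>y - t\<bar> * (b - a)"
    proof (cases "t \<le> a")
      case True
      then show ?thesis unfolding q_def using \<open>a < y \<and> y < b\<close> by (intro mult_mono) auto
    next
      case False
      then have "t \<ge> b" using t by auto
      then have "(b - y) * (y - a) \<le> \<bar>y - t\<bar> * (b - a)" using \<open>a < y \<and> y < b\<close> by (intro mult_mono) auto
      then show ?thesis by (simp add: q_def mult.commute)
    qed
    \<comment> \<open>One term of the exponential series suffices. Of its \<open>n + 2\<close>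
      powers, \<open>n\<close> cancel the denominator \<open>q ^ n\<close> and two are left for the
      quadratic bound.\<close>
    have "(s / q) ^ (n + 2) / fact (n + 2) \<le> (\<Sum>k\<le>n+2. (s / q) ^ k / fact k)"
      by (rule member_le_sum) (use s q in auto)
    also have "\<dots> \<le> exp (s / q)"
    proof -
      have "summable (\<lambda>k. (s / q) ^ k / fact k)"
        using summable_exp[of "s / q"] by (simp add: field_simps)
      then have "(\<Sum>k\<in>{..n+2}. (s / q) ^ k / fact k) \<le> (\<Sum>k. (s / q) ^ k / fact k)"
        by (intro sum_le_suminf) (use s q in auto)
      also have "\<dots> = exp (s / q)" by (simp add: exp_def field_simps)
      finally show ?thesis .
    qed
    finally have le_exp: "(s / q) ^ (n + 2) / fact (n + 2) \<le> exp (s / q)" .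
    have inv: "inverse E \<le> F * inverse X" if "X / F \<le> E" "X > 0" "F > 0" for E F X :: real
    proof -
      have "E > 0" using that by (smt (verit) divide_pos_pos)
      then show ?thesis using that by (simp add: field_simps)
    qed
    have "exp (- (s / q)) \<le> fact (n + 2) * inverse ((s / q) ^ (n + 2))"
      unfolding exp_minus using le_exp by (rule inv) (use s q in \<open>simp_all del: fact_Suc\<close>)
    also have "\<dots> = fact (n + 2) * (q / s) ^ (n + 2)"
      by (simp only: power_inverse[symmetric] inverse_divide)
    also have "\<dots> = fact (n + 2) / s ^ (n + 2) * q\<^sup>2 * q ^ n"
      unfolding power_divide power_add[of q n 2] by simp
    finally have e: "exp (- (s / q)) \<le> fact (n + 2) / s ^ (n + 2) * q\<^sup>2 * q ^ n" .
    have "\<bar>bump1 a b s p n y\<bar> = \<bar>poly p y\<bar> * (exp (- (s / q)) / q ^ n)"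
      using True q by (simp add: bump1_def q_def[symmetric] abs_mult)
    also have "\<dots> \<le> \<bar>M\<bar> * (fact (n + 2) / s ^ (n + 2) * q\<^sup>2)"
    proof (rule mult_mono)
      show "\<bar>poly p y\<bar> \<le> \<bar>M\<bar>" using M[of y] True by auto
      show "exp (- (s / q)) / q ^ n \<le> fact (n + 2) / s ^ (n + 2) * q\<^sup>2"
        using e q by (simp add: pos_divide_le_eq)
    qed (use q in auto)
    also have "\<dots> \<le> \<bar>M\<bar> * (fact (n + 2) / s ^ (n + 2) * (\<bar>y - t\<bar> * (b - a))\<^sup>2)"
      using s q qle by (intro mult_left_mono power_mono) auto
    also have "\<dots> = K * (y - t)\<^sup>2"
      by (simp add: K_def power_mult_distrib)
    also have "\<dots> \<le> \<bar>K\<bar> * (y - t)\<^sup>2" by (intro mult_right_mono) auto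
    finally show ?thesis .
  qed
  have "((\<lambda>y. (bump1 a b s p n y - bump1 a b s p n t) / (y - t)) \<longlongrightarrow> 0) (at t)"
  proof (rule Lim_null_comparison)
    show "((\<lambda>y. \<bar>K\<bar> * \<bar>y - t\<bar>) \<longlongrightarrow> 0) (at t)"
      by (auto intro!: tendsto_eq_intros)
    have z: "bump1 a b s p n t = 0" using t by (auto simp: bump1_def)
    show "\<forall>\<^sub>F y in at t. norm ((bump1 a b s p n y - bump1 a b s p n t) / (y - t)) \<le> \<bar>K\<bar> * \<bar>y - t\<bar>"
    proof (intro eventually_at_filter[THEN iffD2] always_eventually allI impI)
      fix y assume "y \<noteq> t"
      then have "\<bar>bump1 a b s p n y\<bar> / \<bar>y - t\<bar> \<le> \<bar>K\<bar> * (y - t)\<^sup>2 / \<bar>y - t\<bar>"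
        using bound[of y] by (intro divide_right_mono) auto
      also have "\<dots> = \<bar>K\<bar> * \<bar>y - t\<bar>"
        using \<open>y \<noteq> t\<close> by (simp add: field_simps power2_eq_square)
      finally show "norm ((bump1 a b s p n y - bump1 a b s p n t) / (y - t)) \<le> \<bar>K\<bar> * \<bar>y - t\<bar>"
        by (simp add: z abs_divide)
    qed
  qed
  then show ?thesis by (simp add: has_field_derivative_iff)
qed

text \<open>By the product rule the derivative is again a polynomial over a power of
  \<open>q\<close> times the same exponential, with the exponent raised by two. Outside the open
  interval both sides vanish.\<close>

lemma bump1_has_derivative:
  assumes s: "s > 0"
  shows "\<exists>p' n'. \<forall>t. (bump1 a b s p n has_real_derivative bump1 a b s p' n' t) (at t)"
proof -
  define q where "q = [:- (a * b), a + b, - 1:]"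
  have q: "poly q t = (t - a) * (b - t)" for t by (simp add: q_def algebra_simps)
  \<comment> \<open>The numerator over the common denominator \<open>q ^ (n + 2)\<close>. Its three
    terms come from differentiating \<open>p\<close>, the power \<open>1 / q ^ n\<close> and the
    exponential.\<close>
  define p' where "p' = pderiv p * q ^ 2 - smult (of_nat n) (p * pderiv q * q) + smult s (p * pderiv q)"
  have "(bump1 a b s p n has_real_derivative bump1 a b s p' (n + 2) t) (at t)" for t
  proof (cases "a < t \<and> t < b")
    case False
    then have "bump1 a b s p' (n + 2) t = 0" by (auto simp: bump1_def)
    then show ?thesis using bump1_has_derivative_boundary[OF s False] by simp
  next
    case True
    then have qt: "poly q t > 0" by (simp add: q)
    have key: "(P' * inverse Q ^ n + - of_nat n * q' * inverse Q ^ (n + 1) * P)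
        * e + e * (s * q' / Q\<^sup>2) * (P * inverse Q ^ n)
        = (P' * Q\<^sup>2 - of_nat n * (P * q' * Q) + s * (P * q')) / Q ^ (n + 2) * e"
      if "Q > 0" for P P' Q q' e :: real
      using that by (simp add: power2_eq_square power_add field_simps)
    have ex: "((\<lambda>x. exp (- s / poly q x)) has_real_derivative
        exp (- s / poly q t) * (s * poly (pderiv q) t / (poly q t)\<^sup>2)) (at t)"
      using qt by (auto intro!: derivative_eq_intros simp: power2_eq_square)
    have inv: "((\<lambda>x. inverse (poly q x) ^ n) has_real_derivative
        - of_nat n * poly (pderiv q) t * inverse (poly q t) ^ (n + 1)) (at t)"
    proof (cases n)
      case (Suc m)
      have "((\<lambda>x. inverse (poly q x) ^ n) has_real_derivative of_nat n *
          (- (inverse (poly q t) * poly (pderiv q) t * inverse (poly q t)) * inverse (poly q t) ^ (n - Suc 0))) (at t)"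
        using qt by (intro DERIV_power DERIV_inverse' poly_DERIV) auto
      then show ?thesis
        by (rule DERIV_cong) (simp add: Suc algebra_simps)
    qed auto
    have "((\<lambda>t. poly p t * inverse (poly q t) ^ n * exp (- s / poly q t)) has_real_derivative
        bump1 a b s p' (n + 2) t) (at t)"
    proof (rule DERIV_cong[OF DERIV_mult[OF DERIV_mult[OF poly_DERIV inv] ex]])
      show "(poly (pderiv p) t * inverse (poly q t) ^ n + - of_nat n * poly (pderiv q) t * inverse (poly q t) ^ (n + 1) * poly p t)
          * exp (- s / poly q t) + exp (- s / poly q t) * (s * poly (pderiv q) t / (poly q t)\<^sup>2)
          * (poly p t * inverse (poly q t) ^ n) = bump1 a b s p' (n + 2) t"
        using qt True key[of "poly q t"] by (simp add: bump1_def q[symmetric] p'_def)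
    qed
    then show ?thesis
    proof (rule DERIV_cong_ev[THEN iffD1, OF refl _ refl, rotated])
      have "\<forall>\<^sub>F x in nhds t. x \<in> {a<..<b}"
        using True by (intro eventually_nhds_in_open) auto
      then show "\<forall>\<^sub>F x in nhds t. poly p x * inverse (poly q x) ^ n * exp (- s / poly q x) = bump1 a b s p n x"
        by eventually_elim (auto simp: bump1_def q field_simps power_mult_distrib)
    qed
  qed
  then show ?thesis by blast
qed

text \<open>A partial derivative replaces only the factor that depends on its coordinate, so the
  products of three functions from \<open>D\<close> with a fixed vector form a class to which
  \<open>smooth_fieldI\<close> applies.\<close>

lemma smooth_field_product:
  assumes D: "\<And>h. h \<in> D \<Longrightarrow> \<exists>h'\<in>D. \<forall>t. (h has_real_derivative h' t) (at t)"
    and h: "h1 \<in> D" "h2 \<in> D" "h3 \<in> D"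
  shows "smooth_field (\<lambda>x::real^3. (h1 (x$1) * h2 (x$2) * h3 (x$3)) *\<^sub>R (v::'b::real_normed_vector))"
proof -
  define S where "S = {f. \<exists>h1\<in>D. \<exists>h2\<in>D. \<exists>h3\<in>D. f = (\<lambda>x::real^3. (h1 (x$1) * h2 (x$2) * h3 (x$3)) *\<^sub>R v)}"
  show ?thesis
  proof (rule smooth_fieldI[of S])
    show "(\<lambda>x. (h1 (x$1) * h2 (x$2) * h3 (x$3)) *\<^sub>R v) \<in> S"
      using h unfolding S_def by blast
  next
    fix f assume "f \<in> S"
    then obtain k1 k2 k3 where k: "k1 \<in> D" "k2 \<in> D" "k3 \<in> D"
      and f: "f = (\<lambda>x. (k1 (x$1) * k2 (x$2) * k3 (x$3)) *\<^sub>R v)" unfolding S_def by blast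
    obtain d1 d2 d3 where d: "d1 \<in> D" "d2 \<in> D" "d3 \<in> D"
      and d1: "\<And>t. (k1 has_real_derivative d1 t) (at t)"
      and d2: "\<And>t. (k2 has_real_derivative d2 t) (at t)"
      and d3: "\<And>t. (k3 has_real_derivative d3 t) (at t)"
      using D[OF k(1)] D[OF k(2)] D[OF k(3)] by metis
    have c: "((\<lambda>x. k (x$i)) has_derivative (\<lambda>y. y$i * d (x$i))) (at x)"
      if "\<And>t. (k has_real_derivative d t) (at t)" for k d :: "real \<Rightarrow> real" and i :: 3 and x :: "real^3"
      using that[of "x$i"] bounded_linear_imp_has_derivative[OF bounded_linear_vec_nth[of i], of "at x"]
        has_derivative_compose[of "\<lambda>x. x$i" "\<lambda>x. x$i" x UNIV k "\<lambda>y. y * d (x$i)"]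
      by (simp add: has_field_derivative_def mult_commute_abs)
    have fd: "(f has_derivative (\<lambda>y. (y$1 * d1 (x$1) * k2 (x$2) * k3 (x$3) + y$2 * k1 (x$1) * d2 (x$2) * k3 (x$3)
        + y$3 * k1 (x$1) * k2 (x$2) * d3 (x$3)) *\<^sub>R v)) (at x)" for x
      unfolding f
      by (rule has_derivative_eq_rhs[OF has_derivative_scaleR_left[OF
            has_derivative_mult[OF has_derivative_mult[OF c[OF d1] c[OF d2]] c[OF d3]]]])
        (simp add: fun_eq_iff algebra_simps)
    have "partial_deriv i f \<in> S" for i
    proof -
      have pd: "partial_deriv i f = (\<lambda>x. (axis i 1 $1 * d1 (x$1) * k2 (x$2) * k3 (x$3) + axis i 1 $2 * k1 (x$1) * d2 (x$2) * k3 (x$3)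
        + axis i 1 $3 * k1 (x$1) * k2 (x$2) * d3 (x$3)) *\<^sub>R v)"
        unfolding partial_deriv_def by (rule ext) (subst frechet_derivative_at[OF fd, symmetric], rule refl)
      have "i = 1 \<or> i = 2 \<or> i = 3" using exhaust_3 by blast
      then have "partial_deriv i f = (\<lambda>x. (d1 (x$1) * k2 (x$2) * k3 (x$3)) *\<^sub>R v) \<or>
        partial_deriv i f = (\<lambda>x. (k1 (x$1) * d2 (x$2) * k3 (x$3)) *\<^sub>R v) \<or>
        partial_deriv i f = (\<lambda>x. (k1 (x$1) * k2 (x$2) * d3 (x$3)) *\<^sub>R v)"
        unfolding pd by (auto simp: axis_def)
      then show ?thesis using k d unfolding S_def by blast
    qed
    then show "(\<forall>x. f differentiable at x) \<and> (\<forall>i. partial_deriv i f \<in> S)"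
      using fd differentiable_def by blast
  qed
qed

text \<open>The parameter \<open>s\<close> is kept free because the bumps tend to the indicator of
  the open box as \<open>s\<close> tends to zero, see \<open>bump_tendsto\<close>.\<close>

definition bump :: "real \<Rightarrow> real^3 \<Rightarrow> real^3 \<Rightarrow> real^3 \<Rightarrow> real" where
  "bump s a b x = bump1 (a$1) (b$1) s 1 0 (x$1) * bump1 (a$2) (b$2) s 1 0 (x$2) * bump1 (a$3) (b$3) s 1 0 (x$3)"

lemma smooth_field_bump:
  assumes "s > 0" shows "smooth_field (\<lambda>x. bump s a b x *\<^sub>R (v::'b::real_normed_vector))"
  unfolding bump_def
proof (rule smooth_field_product[of "{bump1 a b s p n | a b p n. True}"])
  fix h assume "h \<in> {bump1 a b s p n | a b p n. True}"
  then show "\<exists>h'\<in>{bump1 a b s p n | a b p n. True}. \<forall>t. (h has_real_derivative h' t) (at t)"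
    using bump1_has_derivative[OF assms] by blast
qed blast+

lemma bump1_bounds: "s \<ge> 0 \<Longrightarrow> 0 \<le> bump1 a b s 1 0 t" "s \<ge> 0 \<Longrightarrow> bump1 a b s 1 0 t \<le> 1"
  by (auto simp: bump1_def)

lemma mem_box_3: "x \<in> box a b \<longleftrightarrow> (a$1 < x$1 \<and> x$1 < b$1) \<and> (a$2 < x$2 \<and> x$2 < b$2) \<and> (a$3 < x$3 \<and> x$3 < b$3)"
  for x :: "real^3"
  by (auto simp: mem_box_cart forall_3)

lemma bump_bounds:
  assumes "s \<ge> 0" shows "0 \<le> bump s a b x" "bump s a b x \<le> 1"
proof -
  show "0 \<le> bump s a b x" using assms by (simp add: bump_def bump1_bounds)
  have "bump s a b x \<le> 1 * 1 * 1" unfolding bump_def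
    using assms by (intro mult_mono mult_nonneg_nonneg) (simp_all add: bump1_bounds)
  then show "bump s a b x \<le> 1" by simp
qed

lemma bump_outside: "x \<notin> box a b \<Longrightarrow> bump s a b x = 0"
  by (auto simp: bump_def mem_box_3 bump1_def)

lemma bump_pos: "x \<in> box a b \<Longrightarrow> bump s a b x > 0"
  by (auto simp: bump_def mem_box_3 bump1_def)

lemma bump_tendsto: "(\<lambda>n. bump (1 / Suc n) a b x) \<longlonglongrightarrow> indicator (box a b) x"
proof (cases "x \<in> box a b")
  case False
  then show ?thesis by (simp add: bump_outside)
next
  case True
  have *: "(\<lambda>n. bump1 a b (1 / Suc n) 1 0 t) \<longlonglongrightarrow> 1" if "a < t \<and> t < b" for a b t
  proof -
    have "(\<lambda>n. exp (- (1 / Suc n) / ((t - a) * (b - t)))) \<longlonglongrightarrow> exp (- 0 / ((t - a) * (b - t)))"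
      using that LIMSEQ_inverse_real_of_nat by (intro tendsto_intros) (auto simp: inverse_eq_divide)
    then show ?thesis using that by (simp add: bump1_def)
  qed
  have "(\<lambda>n. bump (1 / Suc n) a b x) \<longlonglongrightarrow> 1 * 1 * 1"
    unfolding bump_def using True unfolding mem_box_3 by (intro tendsto_mult *) auto
  then show ?thesis using True by simp
qed

lemma test_field_bump:
  assumes "s > 0" "cbox a b \<subseteq> \<omega>"
  shows "test_field \<omega> (\<lambda>x. bump s a b x *\<^sub>R v)"
proof -
  have "closure {x. bump s a b x *\<^sub>R v \<noteq> 0} \<subseteq> cbox a b"
    using bump_outside[of _ a b s] box_subset_cbox[of a b] by (intro closure_minimal) auto
  moreover from this have "compact (closure {x. bump s a b x *\<^sub>R v \<noteq> 0})"
    by (metis bounded_cbox bounded_subset closed_closure compact_eq_bounded_closed)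
  ultimately show ?thesis
    using assms smooth_field_bump unfolding test_field_def by blast
qed

section \<open>Uniqueness of weak curls\<close>

lemma continuous_bump:
  assumes "s > 0" shows "continuous_on UNIV (bump s a b)"
proof -
  have "continuous_on UNIV (\<lambda>x. bump s a b x *\<^sub>R (1::real))"
    by (rule smooth_field_continuous) (rule smooth_field_bump[OF assms])
  then show ?thesis by simp
qed

text \<open>The completion inherits the countable cover by sets of finite measure from
  \<open>lborel\<close>. This is the side condition of \<open>density_zero\<close> below.\<close>

lemma sigma_finite_lebesgue: "sigma_finite_measure (lebesgue :: 'a::euclidean_space measure)"
proof
  obtain A :: "'a set set" where A: "countable A" "A \<subseteq> sets lborel" "\<Union>A = space lborel"
    "\<forall>a\<in>A. emeasure lborel a \<noteq> \<infinity>"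
    using lborel.sigma_finite_countable by blast
  have s: "a \<in> sets lborel" if "a \<in> A" for a
    using A(2) that by (rule subsetD)
  have "A \<subseteq> sets lebesgue" by (rule subsetI, rule sets_completionI_sets, rule s)
  moreover have "\<forall>a\<in>A. emeasure lebesgue a \<noteq> \<infinity>"
  proof
    fix a assume "a \<in> A"
    then show "emeasure lebesgue a \<noteq> \<infinity>"
      using A(4) s[OF \<open>a \<in> A\<close>] by simp
  qed
  ultimately show "\<exists>A::'a set set. countable A \<and> A \<subseteq> sets lebesgue \<and> \<Union>A = space lebesgue \<and> (\<forall>a\<in>A. emeasure lebesgue a \<noteq> \<infinity>)"
    using A(1,3) by (intro exI[of _ A] conjI) simp_all
qed

text \<open>The fundamental lemma of the calculus of variations. Dominated convergence passes from
  bumps to indicators of boxes, a Dynkin argument from boxes to Borel sets, and a function whose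
  integral over every set vanishes is zero almost everywhere. Countably many closed boxes exhaust
  \<open>\<omega>\<close>.\<close>

lemma AE_zero_of_bumps:
  fixes g :: "real^3 \<Rightarrow> 'b::{second_countable_topology, banach}"
  assumes g: "integrable lebesgue g" and \<omega>: "open \<omega>"
    and z: "\<And>a b s. cbox a b \<subseteq> \<omega> \<Longrightarrow> s > 0 \<Longrightarrow> (\<integral>x. bump s a b x *\<^sub>R g x \<partial>lebesgue) = 0"
  shows "AE x in lebesgue. x \<in> \<omega> \<longrightarrow> g x = 0"
proof -
  note [measurable] = borel_measurable_integrable[OF g]
  have box: "(\<integral>x. indicator (box a b) x *\<^sub>R g x \<partial>lebesgue) = 0" if "cbox a b \<subseteq> \<omega>" for a b
  proof -
    have [measurable]: "bump s a b \<in> borel_measurable lebesgue" if "s > 0" for s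
      using borel_measurable_continuous_onI[OF continuous_bump[OF that]]
      by (intro measurable_completion) simp
    have "(\<lambda>n. \<integral>x. bump (1 / Suc n) a b x *\<^sub>R g x \<partial>lebesgue) \<longlonglongrightarrow> (\<integral>x. indicator (box a b) x *\<^sub>R g x \<partial>lebesgue)"
    proof (rule integral_dominated_convergence[where w = "\<lambda>x. norm (g x)"])
      show "AE x in lebesgue. (\<lambda>n. bump (1 / Suc n) a b x *\<^sub>R g x) \<longlonglongrightarrow> indicator (box a b) x *\<^sub>R g x"
        by (intro AE_I2 tendsto_scaleR bump_tendsto tendsto_const)
      show "AE x in lebesgue. norm (bump (1 / Suc n) a b x *\<^sub>R g x) \<le> norm (g x)" for n
        using bump_bounds[of "1 / Suc n" a b] by (intro AE_I2) (simp add: mult_left_le_one_le)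
    qed (use g in \<open>auto intro!: borel_measurable_scaleR borel_measurable_indicator borel_measurable_integrable[OF g]\<close>)
    moreover have "(\<lambda>n. \<integral>x. bump (1 / Suc n) a b x *\<^sub>R g x \<partial>lebesgue) = (\<lambda>n. 0)"
      using that by (intro ext z) auto
    ultimately show ?thesis by (simp add: LIMSEQ_const_iff)
  qed
  have AEbox: "AE x in lebesgue. x \<in> box a b \<longrightarrow> g x = 0" if sub: "cbox a b \<subseteq> \<omega>" for a b
  proof -
    \<comment> \<open>Cutting \<open>g\<close> off at one fixed box makes the integral over the
      whole space vanish, which the complement case of the Dynkin argument requires.\<close>
    define f where "f x = indicator (box a b) x *\<^sub>R g x" for x
    have f: "integrable lebesgue f" unfolding f_def
      by (intro integrable_mult_indicator g) auto
    have fA: "set_integrable lebesgue A f" if "A \<in> sets lebesgue" for A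
      unfolding set_integrable_def by (intro integrable_mult_indicator f that)
    have borel: "set_lebesgue_integral lebesgue A f = 0" if "A \<in> sets borel" for A
    proof -
      have "Int_stable (range (\<lambda>(a, b). box a b :: (real^3) set))"
        by (auto simp: Int_stable_def box_Int_box)
      moreover have "range (\<lambda>(a, b). box a b :: (real^3) set) \<subseteq> Pow UNIV" by simp
      moreover have "A \<in> sigma_sets UNIV (range (\<lambda>(a, b). box a b))" using that by (simp add: borel_eq_box)
      ultimately show ?thesis
      proof (induction rule: sigma_sets_induct_disjoint)
        case (basic A)
        then obtain c d where A: "A = box c d" by auto
        obtain c' d' where cd: "box c d \<inter> box a b = box c' d'" using box_Int_box by blast
        show ?case
        proof (cases "box c' d' = {}")
          case True
          then have "(\<lambda>x. indicator A x *\<^sub>R f x) = (\<lambda>x. 0)"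
            using cd A by (intro ext) (auto simp: f_def indicator_def)
          then show ?thesis by (simp add: set_lebesgue_integral_def)
        next
          case False
          \<comment> \<open>The available identity needs the closed box inside
            \<open>\<omega>\<close>; taking closures transfers the inclusion, provided that the open
            box is nonempty.\<close>
          have sub': "box c' d' \<subseteq> box a b" using cd by blast
          then have "box a b \<noteq> {}" using False by blast
          then have "cbox c' d' \<subseteq> cbox a b"
            using closure_mono[OF sub'] closure_box[OF False] closure_box[of a b] by simp
          then have "(\<integral>x. indicator (box c' d') x *\<^sub>R g x \<partial>lebesgue) = 0"
            using sub by (intro box) auto
          moreover have "indicator (box c' d') x *\<^sub>R g x = indicator A x *\<^sub>R f x" for x
            unfolding cd[symmetric] A f_def by (auto simp: indicator_def)
          ultimately show ?thesis by (simp add: set_lebesgue_integral_def)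
        qed
      next
        case empty
        show ?case by (simp add: set_lebesgue_integral_def)
      next
        case (compl A)
        then have A: "A \<in> sets lebesgue" by (simp add: borel_eq_box)
        have "set_lebesgue_integral lebesgue (A \<union> (UNIV - A)) f
            = set_lebesgue_integral lebesgue A f + set_lebesgue_integral lebesgue (UNIV - A) f"
          using A by (intro set_integral_Un fA) auto
        moreover have "set_lebesgue_integral lebesgue (A \<union> (UNIV - A)) f = 0"
          using box[OF sub] by (simp add: set_lebesgue_integral_def f_def)
        ultimately show ?case using compl by simp
      next
        case (union A)
        have "A i \<in> sets borel" for i
          using union(2)[THEN subsetD, OF rangeI[of A i]] by (simp add: borel_eq_box)
        then have A: "A i \<in> sets lebesgue" for i by simp
        have "set_lebesgue_integral lebesgue (\<Union>i. A i) f = (\<Sum>i. set_lebesgue_integral lebesgue (A i) f)"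
          using union(1) A by (intro lebesgue_integral_countable_add fA) (auto simp: disjoint_family_on_def)
        then show ?case using union by simp
      qed
    qed
    have "AE x in lebesgue. f x = 0"
    proof (rule sigma_finite_measure.density_zero[OF _ f])
      show "sigma_finite_measure (lebesgue :: (real^3) measure)"
        by (rule sigma_finite_lebesgue)
    next
      fix A :: "(real^3) set" assume A: "A \<in> sets lebesgue"
      then obtain S N N' where SN: "A = S \<union> N" "N \<subseteq> N'" "N' \<in> null_sets lborel" "S \<in> sets lborel"
        by (rule sets_completionE)
      have N': "N' \<in> null_sets lebesgue" using SN(3) by (rule null_sets_completionI)
      have S: "S \<in> sets lebesgue" using SN(4) by simp
      \<comment> \<open>A Lebesgue set differs from a Borel set by a null set, so the Borel case
        decides.\<close>
      have "set_lebesgue_integral lebesgue A f = set_lebesgue_integral lebesgue S f"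
        unfolding set_lebesgue_integral_def
      proof (rule integral_cong_AE)
        show "AE x in lebesgue. indicator A x *\<^sub>R f x = indicator S x *\<^sub>R f x"
          using AE_not_in[OF N'] by eventually_elim (use SN in \<open>auto simp: indicator_def\<close>)
      qed (use A S borel_measurable_integrable[OF f] in \<open>auto intro!: borel_measurable_scaleR\<close>)
      then show "set_lebesgue_integral lebesgue A f = 0" using borel SN(4) by simp
    qed
    then show ?thesis by eventually_elim (auto simp: f_def)
  qed
  obtain \<D> where D: "countable \<D>" "\<D> \<subseteq> Pow \<omega>" "\<And>X. X \<in> \<D> \<Longrightarrow> \<exists>a b. X = cbox a b" "\<Union>\<D> = \<omega>"
    using open_countable_Union_open_cbox[OF \<omega>] by blast
  have "AE x in lebesgue. \<forall>X\<in>\<D>. x \<in> X \<longrightarrow> g x = 0"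
  proof (rule AE_ball_countable[THEN iffD2, OF D(1)], rule ballI)
    fix X assume X: "X \<in> \<D>"
    then obtain a b where ab: "X = cbox a b" using D(3) by blast
    have "cbox a b - box a b \<in> null_sets lebesgue"
      using negligible_frontier_interval by (simp add: negligible_iff_null_sets)
    then have "AE x in lebesgue. x \<notin> cbox a b - box a b" by (rule AE_not_in)
    moreover have "AE x in lebesgue. x \<in> box a b \<longrightarrow> g x = 0" using X D(2) ab by (intro AEbox) auto
    ultimately show "AE x in lebesgue. x \<in> X \<longrightarrow> g x = 0" by eventually_elim (auto simp: ab)
  qed
  then show ?thesis by eventually_elim (use D(4) in blast)
qed

section \<open>Pairings of L2 fields and uniqueness by testing\<close>

lemma borel_measurable_nth: "f \<in> borel_measurable M \<Longrightarrow> (\<lambda>x. f x $ i) \<in> borel_measurable M"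
  for f :: "'a \<Rightarrow> 'b::{real_normed_vector,second_countable_topology}^3"
  by (rule measurable_compose[of f M borel])
    (auto intro!: borel_measurable_continuous_onI continuous_intros)

lemma norm_square_vec: "(norm (v :: complex^3))\<^sup>2 = (\<Sum>i\<in>UNIV. (norm (v $ i))\<^sup>2)"
  by (simp add: norm_vec_def L2_set_def sum_nonneg)

lemma L2_inner_integrable:
  assumes "f \<in> L2_field \<omega>" "g \<in> L2_field \<omega>"
  shows "integrable (lebesgue_on \<omega>) (\<lambda>x. \<Sum>i\<in>UNIV. f x $ i * cnj (g x $ i))"
proof (rule Bochner_Integration.integrable_sum)
  fix i :: 3
  have m: "(\<lambda>x. f x $ i) \<in> borel_measurable (lebesgue_on \<omega>)" "(\<lambda>x. g x $ i) \<in> borel_measurable (lebesgue_on \<omega>)"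
    using assms by (auto simp: L2_field_def intro!: borel_measurable_nth)
  show "integrable (lebesgue_on \<omega>) (\<lambda>x. f x $ i * cnj (g x $ i))"
  proof (rule Bochner_Integration.integrable_bound)
    show "integrable (lebesgue_on \<omega>) (\<lambda>x. (norm (f x))\<^sup>2 + (norm (g x))\<^sup>2)"
      using assms by (auto simp: L2_field_def)
    show "(\<lambda>x. f x $ i * cnj (g x $ i)) \<in> borel_measurable (lebesgue_on \<omega>)"
      using m by (intro borel_measurable_times measurable_compose[OF m(2), of cnj] borel_measurable_continuous_onI continuous_intros) auto
    show "AE x in lebesgue_on \<omega>. norm (f x $ i * cnj (g x $ i)) \<le> norm ((norm (f x))\<^sup>2 + (norm (g x))\<^sup>2)"
    proof (intro AE_I2)
      fix x
      have "norm (f x $ i * cnj (g x $ i)) = norm (f x $ i) * norm (g x $ i)" by (simp add: norm_mult)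
      also have "\<dots> \<le> norm (f x) * norm (g x)"
        by (intro mult_mono Finite_Cartesian_Product.norm_nth_le) auto
      also have "\<dots> \<le> (norm (f x))\<^sup>2 + (norm (g x))\<^sup>2"
      proof -
        have "0 \<le> norm (f x) * norm (g x)" by simp
        then show ?thesis using sum_squares_bound[of "norm (f x)" "norm (g x)"] by linarith
      qed
      finally show "norm (f x $ i * cnj (g x $ i)) \<le> norm ((norm (f x))\<^sup>2 + (norm (g x))\<^sup>2)" by simp
    qed
  qed
qed

lemma bounded_measurable_L2_field:
  assumes "\<omega> \<in> sets lebesgue" "bounded \<omega>" "f \<in> borel_measurable (lebesgue_on \<omega>)" "\<And>x. x \<in> \<omega> \<Longrightarrow> norm (f x) \<le> B"
  shows "f \<in> L2_field \<omega>"
proof -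
  have fm: "emeasure (lebesgue_on \<omega>) (space (lebesgue_on \<omega>)) < \<infinity>"
    using fmeasurableD2[OF bounded_set_imp_lmeasurable[OF assms(2,1)]] assms(1)
    by (simp add: emeasure_restrict_space less_top del: emeasure_completion)
  interpret finite_measure "lebesgue_on \<omega>" using fm by (intro finite_measureI) auto
  have "integrable (lebesgue_on \<omega>) (\<lambda>x. (norm (f x))\<^sup>2)"
  proof (rule integrable_const_bound[where B = "B\<^sup>2"])
    show "AE x in lebesgue_on \<omega>. norm ((norm (f x))\<^sup>2) \<le> B\<^sup>2"
      using assms(4) by (intro AE_I2) (auto simp: power_mono)
  qed (use assms(3) in measurable)
  then show ?thesis using assms(3) by (simp add: L2_field_def)
qed

lemma continuous_L2_field:
  assumes "\<omega> \<in> sets lebesgue" "bounded \<omega>" "continuous_on UNIV f"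
  shows "f \<in> L2_field \<omega>"
proof -
  have "compact (f ` closure \<omega>)"
    using assms by (intro compact_continuous_image) (auto intro: continuous_on_subset)
  then have "bounded (f ` closure \<omega>)" by (rule compact_imp_bounded)
  then obtain B where "\<And>x. x \<in> \<omega> \<Longrightarrow> norm (f x) \<le> B"
    unfolding bounded_iff using closure_subset by (metis imageI subsetD)
  moreover have "f \<in> borel_measurable (lebesgue_on \<omega>)"
    using borel_measurable_continuous_onI[OF assms(3)]
    by (intro measurable_restrict_space1 measurable_completion) auto
  ultimately show ?thesis using assms bounded_measurable_L2_field by blast
qed

text \<open>Pairing with a constant unit field, which is square integrable because
  \<open>\<omega>\<close> is bounded, extracts one component as an integrable function.\<close>

lemma L2_field_integrable_nth:
  assumes "\<omega> \<in> sets lebesgue" "bounded \<omega>" "f \<in> L2_field \<omega>"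
  shows "integrable (lebesgue_on \<omega>) (\<lambda>x. f x $ i)"
proof -
  have "(\<lambda>x. axis i (1::complex)) \<in> L2_field \<omega>" using assms by (intro continuous_L2_field) auto
  from L2_inner_integrable[OF assms(3) this] show ?thesis
    by (simp add: axis_def if_distrib[of cnj] if_distrib[of "\<lambda>x. _ * x"] cong: if_cong)
qed

lemma smooth_test_L2_field:
  assumes "\<omega> \<in> sets lebesgue" "bounded \<omega>" "smooth_field \<phi>"
  shows "\<phi> \<in> L2_field \<omega>"
  using assms by (intro continuous_L2_field smooth_field_continuous)

text \<open>A scalar bump times a unit vector isolates one component of the difference, which
  reduces the claim to the scalar statement. Applied to two weak curls it shows that they agree
  almost everywhere.\<close>

lemma L2_field_AE_unique:
  assumes \<omega>: "open \<omega>" "bounded \<omega>" and G: "G \<in> L2_field \<omega>" "G' \<in> L2_field \<omega>"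
    and eq: "\<And>\<phi>. test_field \<omega> \<phi> \<Longrightarrow> L2_inner \<omega> G \<phi> = L2_inner \<omega> G' \<phi>"
  shows "AE x in lebesgue_on \<omega>. G x = G' x"
proof -
  have \<omega>': "\<omega> \<in> sets lebesgue" using \<omega> by (simp add: borel_open)
  have comp: "AE x in lebesgue. x \<in> \<omega> \<longrightarrow> G x $ i = G' x $ i" for i
  proof -
    define h where "h x = G x $ i - G' x $ i" for x
    have h: "integrable (lebesgue_on \<omega>) h" unfolding h_def
      using \<omega>' \<omega> G by (intro Bochner_Integration.integrable_diff L2_field_integrable_nth) auto
    have "AE x in lebesgue. x \<in> \<omega> \<longrightarrow> indicator \<omega> x *\<^sub>R h x = 0"
    proof (rule AE_zero_of_bumps[OF _ \<omega>(1)])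
      show "integrable lebesgue (\<lambda>x. indicator \<omega> x *\<^sub>R h x)"
        using h integrable_restrict_space[of \<omega> lebesgue h] \<omega>' by (simp add: set_integrable_def)
      fix a b and s :: real assume ab: "cbox a b \<subseteq> \<omega>" and s: "s > 0"
      define \<phi> where "\<phi> = (\<lambda>x. bump s a b x *\<^sub>R axis i (1::complex))"
      have \<phi>: "test_field \<omega> \<phi>" unfolding \<phi>_def using test_field_bump[OF s ab] .
      then have \<phi>2: "\<phi> \<in> L2_field \<omega>" using \<omega> \<omega>' by (auto simp: test_field_def intro: smooth_test_L2_field)
      have e: "(\<Sum>j\<in>UNIV. F x $ j * cnj (\<phi> x $ j)) = bump s a b x *\<^sub>R F x $ i" for F x
      proof -
        have "F x $ j * cnj (\<phi> x $ j) = (if j = i then bump s a b x *\<^sub>R F x $ i else 0)" for j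
          by (simp add: \<phi>_def axis_def)
        then show ?thesis by simp
      qed
      have "(\<integral>x. bump s a b x *\<^sub>R h x \<partial>lebesgue_on \<omega>) = L2_inner \<omega> G \<phi> - L2_inner \<omega> G' \<phi>"
        using Bochner_Integration.integral_diff[OF L2_inner_integrable[OF G(1) \<phi>2] L2_inner_integrable[OF G(2) \<phi>2]]
        unfolding L2_inner_def e h_def by (simp add: scaleR_diff_right)
      also have "\<dots> = 0" using eq[OF \<phi>] by simp
      finally have "(\<integral>x. indicator \<omega> x *\<^sub>R (bump s a b x *\<^sub>R h x) \<partial>lebesgue) = 0"
        using integral_restrict_space[of \<omega> lebesgue "\<lambda>x. bump s a b x *\<^sub>R h x"] \<omega>'
        by (simp add: set_lebesgue_integral_def)
      then show "(\<integral>x. bump s a b x *\<^sub>R (indicator \<omega> x *\<^sub>R h x) \<partial>lebesgue) = 0"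
        by (simp add: mult.commute)
    qed
    then show ?thesis by eventually_elim (auto simp: h_def)
  qed
  have "AE x in lebesgue. \<forall>i\<in>UNIV. x \<in> \<omega> \<longrightarrow> G x $ i = G' x $ i"
    using comp by (intro AE_finite_allI) auto
  then have "AE x in lebesgue. x \<in> \<omega> \<longrightarrow> G x = G' x"
    by eventually_elim (auto simp: vec_eq_iff)
  then show ?thesis using \<omega>' by (simp add: AE_restrict_space_iff)
qed

section \<open>Integrals over triangles and tetrahedra\<close>

lemma Basis_real3: "(Basis :: (real^3) set) = {axis 1 1, axis 2 1, axis 3 1}"
  by (auto simp: Basis_vec_def) (metis exhaust_3)

lemma prod_Basis_real3: "(\<Prod>b\<in>Basis. (x :: real^3) \<bullet> b) = x$1 * x$2 * x$3"
  by (simp add: Basis_real3 axis_eq_axis inner_axis)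

lemma emeasure_lborel_Times:
  assumes "A \<in> sets borel" "B \<in> sets borel"
  shows "emeasure (lborel :: ('a::euclidean_space \<times> 'b::euclidean_space) measure) (A \<times> B) = emeasure lborel A * emeasure lborel B"
  unfolding lborel_prod[symmetric] using assms by (intro lborel.emeasure_pair_measure_Times) auto

lemma continuous_vector3: "continuous_on UNIV (\<lambda>(r, s, t). vector [r, s, t] :: real^3)"
proof -
  have "(\<lambda>(r, s, t). vector [r, s, t] :: real^3) = (\<lambda>x. fst x *\<^sub>R axis 1 1 + fst (snd x) *\<^sub>R axis 2 1 + snd (snd x) *\<^sub>R axis 3 1)"
    by (auto simp: fun_eq_iff vec_eq_iff forall_3 axis_def)
  then show ?thesis by (simp only:) (intro continuous_intros)
qed

text \<open>Lebesgue measure on vectors is transported from iterated pairs, because Fubini's theorem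
  is stated for product types.\<close>

lemma lborel_vector3:
  "(lborel :: (real^3) measure) = distr lborel borel (\<lambda>(r, s, t). vector [r, s, t])"
proof (rule lborel_eqI)
  have meas: "(\<lambda>(r, s, t). vector [r, s, t] :: real^3) \<in> borel_measurable lborel"
    using borel_measurable_continuous_onI[OF continuous_vector3] by simp
  fix l u :: "real^3" assume "\<And>b. b \<in> Basis \<Longrightarrow> l \<bullet> b \<le> u \<bullet> b"
  from this[of "axis 1 1"] this[of "axis 2 1"] this[of "axis 3 1"]
  have le: "l$1 \<le> u$1" "l$2 \<le> u$2" "l$3 \<le> u$3" by (auto simp: Basis_real3 inner_axis)
  have pre: "(\<lambda>(r, s, t). vector [r, s, t] :: real^3) -` box l u
      = {l$1<..<u$1} \<times> {l$2<..<u$2} \<times> {l$3<..<u$3}"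
    by (auto simp: mem_box_3)
  have "emeasure (distr lborel borel (\<lambda>(r, s, t). vector [r, s, t])) (box l u)
      = emeasure lborel ({l$1<..<u$1} \<times> {l$2<..<u$2} \<times> {l$3<..<u$3})"
    by (subst emeasure_distr[OF meas]) (simp_all add: pre)
  also have "\<dots> = ennreal (u$1 - l$1) * (ennreal (u$2 - l$2) * ennreal (u$3 - l$3))"
    using le by (simp add: emeasure_lborel_Times borel_Times)
  also have "\<dots> = (\<Prod>b\<in>Basis. (u - l) \<bullet> b)"
    using le by (simp add: prod_Basis_real3 ennreal_mult mult.assoc)
  finally show "emeasure (distr lborel borel (\<lambda>(r, s, t). vector [r, s, t])) (box l u)
     = ennreal (\<Prod>b\<in>Basis. (u - l) \<bullet> b)" .
qed simp

text \<open>Lebesgue measure is determined by its values on boxes. The preimage of a box is open,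
  and bounded as the image of the box under the inverse map, so \<open>measure_linear_image\<close>
  applies to it and supplies the factor \<open>\<bar>det A\<bar>\<close>.\<close>

lemma lborel_affine_image:
  fixes A :: "real^3^3" and p :: "real^3"
  assumes "det A \<noteq> 0"
  shows "(lborel :: (real^3) measure) = density (distr lborel borel (\<lambda>x. p + A *v x)) (\<lambda>_. ennreal \<bar>det A\<bar>)"
proof (rule lborel_eqI)
  have cont: "continuous_on UNIV (\<lambda>x. p + A *v x)"
    by (intro continuous_intros linear_continuous_on linear_conv_bounded_linear[THEN iffD1]) simp
  then have meas: "(\<lambda>x. p + A *v x) \<in> borel_measurable lborel"
    by (simp add: borel_measurable_continuous_onI)
  fix l u :: "real^3" assume "\<And>b. b \<in> Basis \<Longrightarrow> l \<bullet> b \<le> u \<bullet> b"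
  from this[of "axis 1 1"] this[of "axis 2 1"] this[of "axis 3 1"]
  have le: "l$1 \<le> u$1" "l$2 \<le> u$2" "l$3 \<le> u$3" by (auto simp: Basis_real3 inner_axis)
  define S where "S = (\<lambda>x. p + A *v x) -` box l u"
  have bij: "\<exists>x. A *v x = y" "A *v x = A *v x' \<Longrightarrow> x = x'" for x x' y
    using assms invertible_det_nz[of A] matrix_left_invertible_injective[of A] matrix_right_invertible_surjective[of A]
    by (metis invertible_def surj_def, metis invertible_def injD)
  have im: "(\<lambda>x. p + A *v x) ` S = box l u"
    unfolding S_def using bij(1)[of "_ - p"] by (auto simp: image_iff) (metis add_diff_cancel_left' diff_add_cancel add.commute)
  have "open S" unfolding S_def using cont by (intro open_vimage) auto
  have "bounded S"
  proof -
    obtain B where B: "A ** B = mat 1" "B ** A = mat 1"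
      using assms invertible_det_nz[of A] by (auto simp: invertible_def)
    have S_eq: "S = (\<lambda>y. B *v (y - p)) ` box l u"
      unfolding im[symmetric] image_image by (simp add: matrix_vector_mul_assoc B)
    have "continuous_on UNIV (\<lambda>y. B *v y - B *v p)"
      by (intro continuous_intros linear_continuous_on linear_conv_bounded_linear[THEN iffD1]) simp
    then have "compact ((\<lambda>y. B *v y - B *v p) ` cbox l u)"
      by (rule compact_continuous_image[OF continuous_on_subset[OF _ subset_UNIV] compact_cbox])
    then have "bounded ((\<lambda>y. B *v (y - p)) ` cbox l u)"
      by (simp add: compact_imp_bounded matrix_vector_mult_diff_distrib)
    then show ?thesis unfolding S_eq
      by (rule bounded_subset) (intro image_mono box_subset_cbox)
  qed
  with \<open>open S\<close> have S: "S \<in> lmeasurable" by (intro bounded_set_imp_lmeasurable) (simp_all add: borel_open)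
  have "measure lebesgue (box l u) = measure lebesgue ((\<lambda>x. p + x) ` ((*v) A ` S))"
    by (simp add: im[symmetric] image_image)
  also have "\<dots> = \<bar>det A\<bar> * measure lebesgue S"
    using measure_linear_image[of "(*v) A" S] S by (simp add: measure_translation)
  finally have m: "measure lebesgue (box l u) = \<bar>det A\<bar> * measure lebesgue S" .
  have "emeasure (density (distr lborel borel (\<lambda>x. p + A *v x)) (\<lambda>_. ennreal \<bar>det A\<bar>)) (box l u)
     = ennreal \<bar>det A\<bar> * emeasure lborel S"
    using meas by (simp add: emeasure_density nn_integral_cmult_indicator emeasure_distr S_def)
  also have "emeasure lborel S = ennreal (measure lebesgue S)"
    using emeasure_bounded_finite[OF \<open>bounded S\<close>] \<open>open S\<close>
    by (simp add: emeasure_eq_ennreal_measure measure_completion borel_open less_top)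
  also have "ennreal \<bar>det A\<bar> * ennreal (measure lebesgue S) = ennreal (measure lebesgue (box l u))"
    by (simp add: m ennreal_mult)
  also have "measure lebesgue (box l u) = (\<Prod>b\<in>Basis. (u - l) \<bullet> b)"
    using le by (simp add: measure_lborel_box_eq Basis_real3 inner_axis)
  finally show "emeasure (density (distr lborel borel (\<lambda>x. p + A *v x)) (\<lambda>_. ennreal \<bar>det A\<bar>)) (box l u)
     = ennreal (\<Prod>b\<in>Basis. (u - l) \<bullet> b)" .
qed simp

text \<open>The determinant of the three vectors. It occurs both as a Jacobian and as the
  normalising factor of the barycentric gradients.\<close>

definition triple :: "real^3 \<Rightarrow> real^3 \<Rightarrow> real^3 \<Rightarrow> real" where
  "triple a b c = a \<bullet> cross3 b c"

lemma integral_parametrized: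
  fixes f :: "real^3 \<Rightarrow> 'b::{banach, second_countable_topology}"
  assumes D: "triple a b c \<noteq> 0" and f: "f \<in> borel_measurable borel"
  shows "(\<integral>x. f x \<partial>lborel) = \<bar>triple a b c\<bar> *\<^sub>R (\<integral>(r, s, t). f (p + r *\<^sub>R a + s *\<^sub>R b + t *\<^sub>R c) \<partial>lborel)"
proof -
  define A :: "real^3^3" where "A = transpose (vector [a, b, c])"
  have det: "det A = triple a b c" unfolding A_def triple_def det_transpose dot_cross_det ..
  have A: "A *v vector [r, s, t] = r *\<^sub>R a + s *\<^sub>R b + t *\<^sub>R c" for r s t
    unfolding A_def by (simp add: vec_eq_iff forall_3 matrix_vector_mult_def transpose_def sum_3 mult.commute)
  have meas: "(\<lambda>x. p + A *v x) \<in> borel_measurable borel"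
    by (intro borel_measurable_continuous_onI continuous_intros linear_continuous_on linear_conv_bounded_linear[THEN iffD1]) simp
  have meas3: "(\<lambda>(r, s, t). vector [r, s, t] :: real^3) \<in> borel_measurable borel"
    by (rule borel_measurable_continuous_onI[OF continuous_vector3])
  have "(\<integral>x. f x \<partial>lborel) = (\<integral>x. f x \<partial>density (distr lborel borel (\<lambda>x. p + A *v x)) (\<lambda>_. ennreal \<bar>det A\<bar>))"
    using lborel_affine_image[of A p] D det by simp
  also have "\<dots> = \<bar>det A\<bar> *\<^sub>R (\<integral>x. f (p + A *v x) \<partial>lborel)"
    using f meas by (simp add: integral_density integral_distr)
  also have "(\<integral>x. f (p + A *v x) \<partial>lborel) = (\<integral>x. f (p + A *v x) \<partial>distr lborel borel (\<lambda>(r, s, t). vector [r, s, t]))"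
    using lborel_vector3 by simp
  also have "\<dots> = (\<integral>y. f (p + A *v (\<lambda>(r, s, t). vector [r, s, t]) y) \<partial>lborel)"
    using meas3 measurable_compose[OF meas f] by (intro integral_distr) auto
  also have "\<dots> = (\<integral>(r, s, t). f (p + r *\<^sub>R a + s *\<^sub>R b + t *\<^sub>R c) \<partial>lborel)"
    by (intro Bochner_Integration.integral_cong refl) (auto simp: A add.assoc)
  finally show ?thesis using det by simp
qed

lemma integrable_bounded_continuous:
  fixes g :: "'a::euclidean_space \<Rightarrow> 'b::{banach, second_countable_topology}"
  assumes "continuous_on UNIV g" "bounded A" "A \<in> sets borel"
  shows "integrable lborel (\<lambda>x. indicator A x *\<^sub>R g x)"
proof -
  have "integrable lborel (\<lambda>x. indicator (closure A) x *\<^sub>R g x)"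
    using assms(2) continuous_on_subset[OF assms(1) subset_UNIV]
    by (intro borel_integrable_compact) simp_all
  then have "integrable lborel (\<lambda>x. indicator A x *\<^sub>R (indicator (closure A) x *\<^sub>R g x))"
    by (rule integrable_mult_indicator[rotated]) (simp add: assms(3))
  moreover have "indicator A x *\<^sub>R (indicator (closure A) x *\<^sub>R g x) = indicator A x *\<^sub>R g x" for x
    using closure_subset[of A] by (auto simp: indicator_def)
  ultimately show ?thesis by (simp only:)
qed

section \<open>Normalised integrals over triangles\<close>

definition ref_tri :: "(real \<times> real) set" where
  "ref_tri = {(s, t). 0 < s \<and> 0 < t \<and> s + t < 1}"

text \<open>Integration takes place in the parameter plane, so that no surface measure and no area
  element are involved.\<close>

definition tri_int :: "real^3 \<Rightarrow> real^3 \<Rightarrow> real^3 \<Rightarrow> (real^3 \<Rightarrow> 'b::{banach, second_countable_topology}) \<Rightarrow> 'b" where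
  "tri_int q0 q1 q2 f =
     (\<integral>x. indicator ref_tri x *\<^sub>R f (q0 + fst x *\<^sub>R (q1 - q0) + snd x *\<^sub>R (q2 - q0)) \<partial>lborel)"

lemma open_ref_tri: "open ref_tri"
proof -
  have eq: "ref_tri = {x. 0 < fst x} \<inter> {x. 0 < snd x} \<inter> {x. fst x + snd x < 1}"
    by (auto simp: ref_tri_def)
  show ?thesis unfolding eq by (intro open_Int open_Collect_less continuous_intros)
qed

lemma bounded_ref_tri: "bounded ref_tri"
proof (rule bounded_subset[of "cbox (0, 0) (1, 1)"])
  show "ref_tri \<subseteq> cbox (0, 0) (1, 1)" by (auto simp: ref_tri_def cbox_Pair_eq)
qed simp

lemma tri_int_integrable:
  assumes "continuous_on UNIV (f :: real^3 \<Rightarrow> 'b::{banach, second_countable_topology})"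
  shows "integrable lborel (\<lambda>x. indicator ref_tri x *\<^sub>R f (q0 + fst x *\<^sub>R (q1 - q0) + snd x *\<^sub>R (q2 - q0)))"
  using open_ref_tri bounded_ref_tri
  by (intro integrable_bounded_continuous continuous_on_compose2[OF assms] continuous_intros) auto

lemma tri_int_swap:
  assumes "continuous_on UNIV f"
  shows "tri_int q0 q2 q1 f = tri_int q0 q1 q2 f"
proof -
  let ?h = "\<lambda>x. indicator ref_tri x *\<^sub>R f (q0 + fst x *\<^sub>R (q1 - q0) + snd x *\<^sub>R (q2 - q0))"
  have "(\<integral>(s, t). ?h (t, s) \<partial>(lborel \<Otimes>\<^sub>M lborel)) = integral\<^sup>L (lborel \<Otimes>\<^sub>M lborel) ?h"
    using borel_measurable_integrable[OF tri_int_integrable[OF assms, of q0 q1 q2]]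
    by (intro lborel_pair.integral_product_swap) (simp add: lborel_prod)
  moreover have "(\<lambda>(s, t). ?h (t, s)) = (\<lambda>x. indicator ref_tri x *\<^sub>R f (q0 + fst x *\<^sub>R (q2 - q0) + snd x *\<^sub>R (q1 - q0)))"
  proof (rule ext, clarify)
    fix s t :: real
    have "q0 + t *\<^sub>R (q1 - q0) + s *\<^sub>R (q2 - q0) = q0 + s *\<^sub>R (q2 - q0) + t *\<^sub>R (q1 - q0)" by simp
    moreover have "indicator ref_tri (t, s) = (indicator ref_tri (s, t) :: real)" by (auto simp: ref_tri_def indicator_def)
    ultimately show "?h (t, s) = indicator ref_tri (s, t) *\<^sub>R f (q0 + fst (s, t) *\<^sub>R (q2 - q0) + snd (s, t) *\<^sub>R (q1 - q0))"
      by (simp only: fst_conv snd_conv)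
  qed
  ultimately show ?thesis unfolding tri_int_def lborel_prod by (simp only:)
qed

text \<open>For fixed \<open>t\<close> the substitution of \<open>1 - t - s\<close> for
  \<open>s\<close> maps the section of the reference triangle to itself and exchanges the roles of
  \<open>q0\<close> and \<open>q1\<close>.\<close>

lemma tri_int_reflect:
  assumes f: "continuous_on UNIV f"
  shows "tri_int q1 q0 q2 f = tri_int q0 q1 q2 f"
proof -
  have fub: "tri_int q0 q1 q2 f = (\<integral>t. \<integral>s. indicator ref_tri (s, t) *\<^sub>R f (q0 + s *\<^sub>R (q1 - q0) + t *\<^sub>R (q2 - q0)) \<partial>lborel \<partial>lborel)" for q0 q1 q2
  proof -
    define h where "h s t = indicator ref_tri (s, t) *\<^sub>R f (q0 + s *\<^sub>R (q1 - q0) + t *\<^sub>R (q2 - q0))" for s t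
    have h: "case_prod h = (\<lambda>x. indicator ref_tri x *\<^sub>R f (q0 + fst x *\<^sub>R (q1 - q0) + snd x *\<^sub>R (q2 - q0)))"
      by (auto simp: fun_eq_iff h_def)
    have "(\<integral>t. \<integral>s. h s t \<partial>lborel \<partial>lborel) = integral\<^sup>L (lborel \<Otimes>\<^sub>M lborel) (case_prod h)"
      by (rule lborel_pair.integral_snd, subst lborel_prod, subst h) (rule tri_int_integrable[OF f])
    then show ?thesis by (simp only: tri_int_def lborel_prod h) (simp only: h_def)
  qed
  have "(\<integral>s. indicator ref_tri (s, t) *\<^sub>R f (q1 + s *\<^sub>R (q0 - q1) + t *\<^sub>R (q2 - q1)) \<partial>lborel)
      = (\<integral>s. indicator ref_tri (s, t) *\<^sub>R f (q0 + s *\<^sub>R (q1 - q0) + t *\<^sub>R (q2 - q0)) \<partial>lborel)" for t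
    by (subst lborel_integral_real_affine[where c = "-1" and t = "1 - t"])
      (auto simp: ref_tri_def indicator_def algebra_simps intro!: Bochner_Integration.integral_cong)
  then show ?thesis by (simp add: fub)
qed

text \<open>For continuous \<open>f\<close> the value does not depend on the chosen order of the vertices. It is normalised by
  the reference triangle, so it is the surface integral divided by twice the area of the face.\<close>

definition face_int :: "(real^3) set \<Rightarrow> (real^3 \<Rightarrow> 'b::{banach, second_countable_topology}) \<Rightarrow> 'b" where
  "face_int F f = (SOME r. \<exists>q0 q1 q2. F = {q0, q1, q2} \<and> card F = 3 \<and> r = tri_int q0 q1 q2 f)"

text \<open>The two transpositions in \<open>tri_int_swap\<close> and \<open>tri_int_reflect\<close>
  generate all permutations of the three vertices, so the choice in the definition of
  \<open>face_int\<close> is harmless.\<close>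

lemma face_int_eq:
  assumes F: "F = {q0, q1, q2}" "card F = 3" and f: "continuous_on UNIV f"
  shows "face_int F f = tri_int q0 q1 q2 f"
proof -
  have perm: "tri_int a b c f = tri_int q0 q1 q2 f" if "F = {a, b, c}" for a b c
  proof -
    have "card {q0, q1, q2} = 3" "card {a, b, c} = 3" using F that by simp_all
    then have d: "q0 \<noteq> q1" "q0 \<noteq> q2" "q1 \<noteq> q2" "a \<noteq> b" "a \<noteq> c" "b \<noteq> c"
      by (auto simp: card_insert_if split: if_splits)
    have "{a, b, c} = {q0, q1, q2}" using F that by simp
    then have "a \<in> {q0, q1, q2}" "b \<in> {q0, q1, q2}" "c \<in> {q0, q1, q2}" by blast+
    then have "(a = q0 \<and> b = q1 \<and> c = q2) \<or> (a = q0 \<and> b = q2 \<and> c = q1) \<or> (a = q1 \<and> b = q0 \<and> c = q2) \<or>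
        (a = q1 \<and> b = q2 \<and> c = q0) \<or> (a = q2 \<and> b = q0 \<and> c = q1) \<or> (a = q2 \<and> b = q1 \<and> c = q0)"
      using d by auto
    then show ?thesis
      using tri_int_swap[OF f] tri_int_reflect[OF f] by metis
  qed
  show ?thesis unfolding face_int_def
  proof (rule someI2)
    show "\<exists>a b c. F = {a, b, c} \<and> card F = 3 \<and> tri_int q0 q1 q2 f = tri_int a b c f" using F by blast
  qed (use perm in auto)
qed

section \<open>Barycentric coordinates\<close>

text \<open>Bilinear, without conjugation: edge values then depend linearly on the field. The
  conjugate that the L2 pairing puts on the test field is carried separately by
  \<open>vcnj\<close>.\<close>

definition rdot :: "real^3 \<Rightarrow> complex^3 \<Rightarrow> complex" where
  "rdot v w = (\<Sum>i\<in>UNIV. v $ i *\<^sub>R w $ i)"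

definition vcnj :: "complex^3 \<Rightarrow> complex^3" where
  "vcnj v = (\<chi> i. cnj (v $ i))"

definition cvec :: "real^3 \<Rightarrow> complex^3" where
  "cvec x = (\<chi> i. complex_of_real (x $ i))"

lemma rdot_3: "rdot v w = v$1 *\<^sub>R w$1 + v$2 *\<^sub>R w$2 + v$3 *\<^sub>R w$3"
  by (simp add: rdot_def sum_3)

lemma linear_vcnj: "linear vcnj"
  by (rule linearI) (simp_all add: vcnj_def vec_eq_iff)

lemma linear_cvec: "linear cvec"
  by (rule linearI) (simp_all add: cvec_def vec_eq_iff flip: scaleR_conv_of_real)

lemma linear_rdot_right: "linear (rdot v)"
  by (rule linearI) (simp_all add: rdot_3 algebra_simps)

lemma linear_rdot_left: "linear (\<lambda>v. rdot v w)"
  by (rule linearI) (simp_all add: rdot_3 algebra_simps)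

lemma ccross_nth: "ccross a b $ 1 = a$2 * b$3 - a$3 * b$2" "ccross a b $ 2 = a$3 * b$1 - a$1 * b$3"
   "ccross a b $ 3 = a$1 * b$2 - a$2 * b$1"
  by (simp_all add: ccross_def)

lemma bilinear_ccross: "bilinear ccross"
  unfolding bilinear_def
  by (intro conjI allI linearI; simp add: vec_eq_iff forall_3 ccross_nth algebra_simps)

lemma bounded_bilinear_ccross: "bounded_bilinear ccross"
  using bilinear_ccross by (simp add: bilinear_conv_bounded_bilinear)

lemma continuous_on_ccross:
  "continuous_on S f \<Longrightarrow> continuous_on S h \<Longrightarrow> continuous_on S (\<lambda>x. ccross (f x) (h x))"
  by (rule bounded_bilinear.continuous_on[OF bounded_bilinear_ccross])

lemma continuous_on_linear_fun:
  fixes f :: "'a::euclidean_space \<Rightarrow> 'b::euclidean_space"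
  assumes "linear f" "continuous_on S h" shows "continuous_on S (\<lambda>x. f (h x))"
  using assms linear_conv_bounded_linear bounded_linear.continuous_on by blast

lemma cross3_nth: "cross3 a b $ 1 = a$2 * b$3 - a$3 * b$2" "cross3 a b $ 2 = a$3 * b$1 - a$1 * b$3"
   "cross3 a b $ 3 = a$1 * b$2 - a$2 * b$1"
  by (simp_all add: cross3_def)

lemma inner_3: "(x :: real^3) \<bullet> y = x$1 * y$1 + x$2 * y$2 + x$3 * y$3"
  by (simp add: inner_vec_def sum_3)

section \<open>Reciprocal bases and nondegeneracy\<close>

lemma triple_expand_cross:
  "triple a b c *\<^sub>R v = (v \<bullet> a) *\<^sub>R cross3 b c + (v \<bullet> b) *\<^sub>R cross3 c a + (v \<bullet> c) *\<^sub>R cross3 a b"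
  by (simp add: vec_eq_iff forall_3 triple_def inner_3 cross3_nth algebra_simps)

lemma triple_expand:
  "triple a b c *\<^sub>R v = (v \<bullet> cross3 b c) *\<^sub>R a + (v \<bullet> cross3 c a) *\<^sub>R b + (v \<bullet> cross3 a b) *\<^sub>R c"
  by (simp add: vec_eq_iff forall_3 triple_def inner_3 cross3_nth algebra_simps)

lemma triple_cyclic: "triple b c a = triple a b c"
  by (simp add: triple_def inner_3 cross3_nth algebra_simps)

lemma inner_cross3_zero: "a \<bullet> cross3 a b = 0" "b \<bullet> cross3 a b = 0"
  by (simp_all add: inner_3 cross3_nth algebra_simps)

text \<open>Vectors with a biorthogonal system are independent. If the determinant vanished,
  expanding \<open>z\<close> would give \<open>cross3 a b = 0\<close>; crossing this with
  \<open>x\<close> leaves \<open>b = 0\<close>, against the pairing with \<open>y\<close>. In use,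
  the biorthogonal vectors are barycentric gradients.\<close>

lemma triple_nonzero_of_dual:
  assumes "x \<bullet> a = 1" "x \<bullet> b = 0" "x \<bullet> c = 0" "y \<bullet> a = 0" "y \<bullet> b = 1" "y \<bullet> c = 0"
    "z \<bullet> a = 0" "z \<bullet> b = 0" "z \<bullet> c = 1"
  shows "triple a b c \<noteq> 0"
proof
  assume "triple a b c = 0"
  then have "cross3 a b = 0" using triple_expand_cross[of a b c z] assms by simp
  moreover have "cross3 (cross3 a b) x = (a \<bullet> x) *\<^sub>R b - (b \<bullet> x) *\<^sub>R a"
    by (simp add: vec_eq_iff forall_3 inner_3 cross3_nth algebra_simps)
  ultimately have "b = 0" using assms by (simp add: inner_commute)
  then show False using assms by simp
qed

lemma card_4_iff:
  "card P = 4 \<longleftrightarrow> (\<exists>a b c d. P = {a, b, c, d} \<and> a \<noteq> b \<and> a \<noteq> c \<and> a \<noteq> d \<and> b \<noteq> c \<and> b \<noteq> d \<and> c \<noteq> d)"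
proof
  assume "card P = 4"
  then have "card P = Suc 3" by simp
  then obtain a Q where Q: "P = insert a Q" "a \<notin> Q" "card Q = 3" unfolding card_Suc_eq by blast
  then obtain b c d where "Q = {b, c, d}" "b \<noteq> c" "b \<noteq> d" "c \<noteq> d" unfolding card_3_iff by blast
  with Q show "\<exists>a b c d. P = {a, b, c, d} \<and> a \<noteq> b \<and> a \<noteq> c \<and> a \<noteq> d \<and> b \<noteq> c \<and> b \<noteq> d \<and> c \<noteq> d" by blast
qed auto

text \<open>If the determinant vanished, the normal \<open>n\<close> of two edge vectors would be
  orthogonal to all three and hence to the whole space they span. Then \<open>n = 0\<close> and the
  two edge vectors are parallel, contradicting independence.\<close>

lemma affine_independent_triple_nonzero:
  assumes indep: "\<not> affine_dependent {p, a, b, c :: real^3}"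
    and d: "p \<noteq> a" "p \<noteq> b" "p \<noteq> c" "a \<noteq> b" "a \<noteq> c" "b \<noteq> c"
  shows "triple (a - p) (b - p) (c - p) \<noteq> 0"
proof
  assume z: "triple (a - p) (b - p) (c - p) = 0"
  have img: "(\<lambda>x. - p + x) ` ({p, a, b, c} - {p}) = {a - p, b - p, c - p}" using d by auto
  have ind: "independent {a - p, b - p, c - p}"
    using indep affine_dependent_iff_dependent2[of p "{p, a, b, c}"] unfolding img by auto
  have "card {a - p, b - p, c - p} = 3" using d by auto
  then have "UNIV \<subseteq> span {a - p, b - p, c - p}"
    using card_ge_dim_independent[of "{a - p, b - p, c - p}" UNIV] ind by simp
  then have sp: "v \<in> span {a - p, b - p, c - p}" for v by blast
  define n where "n = cross3 (b - p) (c - p)"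
  have "orthogonal n n"
  proof (rule orthogonal_to_span[OF sp])
    fix y assume "y \<in> {a - p, b - p, c - p}"
    then show "orthogonal n y"
      using z by (auto simp: orthogonal_def n_def triple_def inner_commute[of "cross3 _ _"] inner_cross3_zero)
  qed
  then have "cross3 (b - p) (c - p) = 0" by (simp add: n_def orthogonal_def)
  then have "collinear {0, b - p, c - p}" by (simp add: cross_eq_0)
  then consider "b - p = 0" | "c - p = 0" | k where "c - p = k *\<^sub>R (b - p)"
    unfolding collinear_lemma by blast
  then show False
  proof cases
    case 3
    then have "c - p \<in> span ({a - p, b - p, c - p} - {c - p})"
    proof -
      have "b - p \<in> {a - p, b - p, c - p} - {c - p}" using d by simp
      from span_scale[OF span_base[OF this], of k] show ?thesis unfolding 3 .
    qed
    then show False using ind unfolding dependent_def by blast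
  qed (use d in auto)
qed

text \<open>The barycentric coordinate of the vertex \<open>p\<close> is \<open>x \<mapsto> g p \<bullet> x + \<beta> p\<close>.\<close>

locale tetrahedron =
  fixes P :: "(real^3) set" and g :: "real^3 \<Rightarrow> real^3" and \<beta> :: "real^3 \<Rightarrow> real"
  assumes card_P: "card P = 4" and indep: "\<not> affine_dependent P"
    and delta: "\<And>p q. p \<in> P \<Longrightarrow> q \<in> P \<Longrightarrow> g p \<bullet> q + \<beta> p = (if p = q then 1 else 0)"
    and sum_g: "(\<Sum>p\<in>P. g p) = 0" and sum_\<beta>: "(\<Sum>p\<in>P. \<beta> p) = 1"
    and repr_g: "\<And>v. (\<Sum>p\<in>P. (g p \<bullet> v) *\<^sub>R p) = v" and repr_\<beta>: "(\<Sum>p\<in>P. \<beta> p *\<^sub>R p) = 0"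

lemma tetrahedron_exists:
  assumes "card P = 4" and indep: "\<not> affine_dependent P"
  shows "\<exists>g \<beta>. tetrahedron P g \<beta>"
proof -
  obtain p a b c where P: "P = {p, a, b, c}" and d: "p \<noteq> a" "p \<noteq> b" "p \<noteq> c" "a \<noteq> b" "a \<noteq> c" "b \<noteq> c"
    using assms(1) card_4_iff by metis
  define D where "D = triple (a - p) (b - p) (c - p)"
  have D: "D \<noteq> 0" unfolding D_def using affine_independent_triple_nonzero indep P d by metis
  \<comment> \<open>The gradients at \<open>a\<close>, \<open>b\<close>, \<open>c\<close> form the
    basis reciprocal to the edge vectors from \<open>p\<close>; the gradient at \<open>p\<close> is
    minus their sum, because the coordinates add up to one.\<close>
  define ga where "ga = (1 / D) *\<^sub>R cross3 (b - p) (c - p)"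
  define gb where "gb = (1 / D) *\<^sub>R cross3 (c - p) (a - p)"
  define gc where "gc = (1 / D) *\<^sub>R cross3 (a - p) (b - p)"
  define g where "g q = (if q = a then ga else if q = b then gb else if q = c then gc else - (ga + gb + gc))" for q
  define \<beta> where "\<beta> q = (if q = p then 1 else 0) - g q \<bullet> p" for q
  have g: "g a = ga" "g b = gb" "g c = gc" "g p = - (ga + gb + gc)" using d by (auto simp: g_def)
  have S: "sum f P = f p + f a + f b + f c" for f :: "real^3 \<Rightarrow> 'x::comm_monoid_add"
    using d by (simp add: P add.assoc)
  have r: "(ga \<bullet> v) *\<^sub>R (a - p) + (gb \<bullet> v) *\<^sub>R (b - p) + (gc \<bullet> v) *\<^sub>R (c - p) = v" for v
  proof -
    have "(ga \<bullet> v) *\<^sub>R (a - p) + (gb \<bullet> v) *\<^sub>R (b - p) + (gc \<bullet> v) *\<^sub>R (c - p) = (1 / D) *\<^sub>R (D *\<^sub>R v)"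
      unfolding D_def triple_expand by (simp add: ga_def gb_def gc_def D_def inner_commute scaleR_add_right)
    then show ?thesis using D by simp
  qed
  have dual: "ga \<bullet> (a - p) = 1" "ga \<bullet> (b - p) = 0" "ga \<bullet> (c - p) = 0"
    "gb \<bullet> (a - p) = 0" "gb \<bullet> (b - p) = 1" "gb \<bullet> (c - p) = 0"
    "gc \<bullet> (a - p) = 0" "gc \<bullet> (b - p) = 0" "gc \<bullet> (c - p) = 1"
    using D triple_cyclic[of "a - p" "b - p" "c - p"] triple_cyclic[of "b - p" "c - p" "a - p"]
      inner_cross3_zero
    by (simp_all add: ga_def gb_def gc_def D_def triple_def inner_commute)
  have "tetrahedron P g \<beta>"
  proof
    show "card P = 4" "\<not> affine_dependent P" by fact+
    fix x y assume "x \<in> P" "y \<in> P"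
    then have x: "x = p \<or> x = a \<or> x = b \<or> x = c" and y: "y = p \<or> y = a \<or> y = b \<or> y = c" by (auto simp: P)
    have e: "g x \<bullet> y + \<beta> x = g x \<bullet> (y - p) + (if x = p then 1 else 0)" by (simp add: \<beta>_def inner_diff_right)
    show "g x \<bullet> y + \<beta> x = (if x = y then 1 else 0)"
      unfolding e using x y d g dual
      by (elim disjE) (simp_all add: inner_add_left inner_minus_left inner_diff_left)
  next
    show "(\<Sum>q\<in>P. g q) = 0" by (simp add: S g)
    have "(\<Sum>q\<in>P. \<beta> q) = 1 - (g p + g a + g b + g c) \<bullet> p"
      using d by (simp add: S \<beta>_def inner_add_left)
    then show "(\<Sum>q\<in>P. \<beta> q) = 1" by (simp add: g)
    show rg: "(\<Sum>q\<in>P. (g q \<bullet> v) *\<^sub>R q) = v" for v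
      using r[of v] by (simp add: S g algebra_simps inner_add_left)
    show "(\<Sum>q\<in>P. \<beta> q *\<^sub>R q) = 0"
      using rg[of p] d by (simp add: S \<beta>_def algebra_simps)
  qed
  then show ?thesis by blast
qed

context tetrahedron
begin

definition lam :: "real^3 \<Rightarrow> real^3 \<Rightarrow> real" where
  "lam p x = g p \<bullet> x + \<beta> p"

definition T :: "(real^3) set" where
  "T = {x. \<forall>p\<in>P. 0 < lam p x}"

lemma finite_P: "finite P"
  using card_P by (metis card.infinite zero_neq_numeral)

lemma lam_vertex: "p \<in> P \<Longrightarrow> q \<in> P \<Longrightarrow> lam p q = (if p = q then 1 else 0)"
  unfolding lam_def by (rule delta)

lemma sum_lam: "(\<Sum>p\<in>P. lam p x) = 1"
  by (simp add: lam_def sum.distrib sum_\<beta> sum_g inner_sum_left[symmetric])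

lemma lam_repr: "(\<Sum>p\<in>P. lam p x *\<^sub>R p) = x"
  by (simp add: lam_def scaleR_add_left sum.distrib repr_g repr_\<beta>)

lemma lam_add: "lam p (x + v) = lam p x + g p \<bullet> v"
  by (simp add: lam_def inner_add_right)

lemma g_diff: "p \<in> P \<Longrightarrow> q \<in> P \<Longrightarrow> r \<in> P \<Longrightarrow> g p \<bullet> (q - r) = (if p = q then 1 else 0) - (if p = r then 1 else 0)"
  using delta[of p q] delta[of p r] by (simp add: inner_diff_right split: if_splits)

lemma lam_combination:
  assumes "p \<in> P" "sum u P = 1"
  shows "lam p (\<Sum>q\<in>P. u q *\<^sub>R q) = u p"
proof -
  have "lam p (\<Sum>q\<in>P. u q *\<^sub>R q) = (\<Sum>q\<in>P. u q * (g p \<bullet> q)) + \<beta> p * sum u P"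
    by (simp add: lam_def inner_sum_right assms)
  also have "\<dots> = (\<Sum>q\<in>P. u q * lam p q)"
    by (simp add: lam_def sum_distrib_left distrib_left sum.distrib mult.commute)
  also have "\<dots> = (\<Sum>q\<in>P. if p = q then u q else 0)"
    using assms by (intro sum.cong) (auto simp: lam_vertex)
  also have "\<dots> = u p" using assms finite_P by simp
  finally show ?thesis .
qed

lemma interior_convex_hull_eq: "interior (convex hull P) = T"
proof -
  have "interior (convex hull P) = {y. \<exists>u. (\<forall>x\<in>P. 0 < u x) \<and> sum u P = 1 \<and> (\<Sum>x\<in>P. u x *\<^sub>R x) = y}"
    using interior_convex_hull_explicit_minimal[OF indep] card_P by simp
  also have "\<dots> = T"
  proof (intro equalityI subsetI)
    fix y assume "y \<in> {y. \<exists>u. (\<forall>x\<in>P. 0 < u x) \<and> sum u P = 1 \<and> (\<Sum>x\<in>P. u x *\<^sub>R x) = y}"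
    then obtain u where "\<forall>x\<in>P. 0 < u x" "sum u P = 1" "(\<Sum>x\<in>P. u x *\<^sub>R x) = y" by blast
    then show "y \<in> T" using lam_combination[of _ u] by (auto simp: T_def)
  next
    fix y assume "y \<in> T"
    then show "y \<in> {y. \<exists>u. (\<forall>x\<in>P. 0 < u x) \<and> sum u P = 1 \<and> (\<Sum>x\<in>P. u x *\<^sub>R x) = y}"
      using sum_lam[of y] lam_repr[of y] by (auto simp: T_def intro!: exI[of _ "\<lambda>p. lam p y"])
  qed
  finally show ?thesis .
qed

lemma convex_hull_eq: "convex hull P = {x. \<forall>p\<in>P. 0 \<le> lam p x}"
proof -
  have "convex hull P = {y. \<exists>u. (\<forall>x\<in>P. 0 \<le> u x) \<and> sum u P = 1 \<and> (\<Sum>x\<in>P. u x *\<^sub>R x) = y}"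
    using convex_hull_finite[OF finite_P] by simp
  also have "\<dots> = {x. \<forall>p\<in>P. 0 \<le> lam p x}"
  proof (intro equalityI subsetI)
    fix y assume "y \<in> {y. \<exists>u. (\<forall>x\<in>P. 0 \<le> u x) \<and> sum u P = 1 \<and> (\<Sum>x\<in>P. u x *\<^sub>R x) = y}"
    then obtain u where "\<forall>x\<in>P. 0 \<le> u x" "sum u P = 1" "(\<Sum>x\<in>P. u x *\<^sub>R x) = y" by blast
    then show "y \<in> {x. \<forall>p\<in>P. 0 \<le> lam p x}" using lam_combination[of _ u] by auto
  next
    fix y assume "y \<in> {x. \<forall>p\<in>P. 0 \<le> lam p x}"
    then show "y \<in> {y. \<exists>u. (\<forall>x\<in>P. 0 \<le> u x) \<and> sum u P = 1 \<and> (\<Sum>x\<in>P. u x *\<^sub>R x) = y}"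
      using sum_lam[of y] lam_repr[of y] by (auto intro!: exI[of _ "\<lambda>p. lam p y"])
  qed
  finally show ?thesis .
qed

lemma open_T: "open T"
  unfolding interior_convex_hull_eq[symmetric] by (rule open_interior)

lemma T_subset: "T \<subseteq> convex hull P"
  unfolding interior_convex_hull_eq[symmetric] by (rule interior_subset)

lemma compact_hull: "compact (convex hull P)"
  using finite_P by (rule finite_imp_compact_convex_hull)

lemma bounded_T: "bounded T"
  using compact_hull T_subset by (metis bounded_subset compact_imp_bounded)

lemma barycenter_in_T: "(\<Sum>p\<in>P. (1/4) *\<^sub>R p) \<in> T"
  unfolding T_def mem_Collect_eq
proof (rule ballI)
  fix p assume "p \<in> P"
  then show "0 < lam p (\<Sum>p\<in>P. (1/4) *\<^sub>R p)"
    using card_P by (subst lam_combination) simp_all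
qed

lemma closure_T: "closure T = convex hull P"
  unfolding interior_convex_hull_eq[symmetric]
  using convex_closure_interior[of "convex hull P"] barycenter_in_T interior_convex_hull_eq
    compact_imp_closed[OF compact_hull] by auto

lemma measure_T_pos: "measure lborel T > 0"
proof -
  have "\<not> negligible T" using open_not_negligible[OF open_T] barycenter_in_T by blast
  moreover have "T \<in> lmeasurable" using open_T bounded_T by (intro bounded_set_imp_lmeasurable) (simp_all add: borel_open)
  ultimately have "measure lebesgue T > 0" by (simp add: negligible_iff_measure0 zero_less_measure_iff)
  then show ?thesis using open_T by (simp add: measure_completion borel_open)
qed

lemma vertex_facts:
  assumes "p \<in> P" "q \<in> P" "p \<noteq> q"
  obtains k l where "P = {p, q, k, l}" "k \<noteq> l" "k \<noteq> p" "k \<noteq> q" "l \<noteq> p" "l \<noteq> q"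
proof -
  have "card (P - {p, q}) = 2" using assms card_P finite_P by (simp add: card_Diff_subset)
  then obtain k l where kl: "P - {p, q} = {k, l}" "k \<noteq> l" by (auto simp: card_2_iff)
  then have "P = {p, q, k, l}" using assms by blast
  moreover have "k \<noteq> p" "k \<noteq> q" "l \<noteq> p" "l \<noteq> q" using kl by blast+
  ultimately show ?thesis using kl that by blast
qed

lemma facet_vertices:
  assumes "p \<in> P"
  obtains q0 q1 q2 where "P = {p, q0, q1, q2}" "P - {p} = {q0, q1, q2}" "card (P - {p}) = 3"
    "q0 \<noteq> q1" "q0 \<noteq> q2" "q1 \<noteq> q2" "p \<noteq> q0" "p \<noteq> q1" "p \<noteq> q2"
proof -
  have c: "card (P - {p}) = 3" using assms card_P by simp
  then obtain q0 q1 q2 where q: "P - {p} = {q0, q1, q2}" "q0 \<noteq> q1" "q0 \<noteq> q2" "q1 \<noteq> q2" unfolding card_3_iff by blast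
  then have "P = {p, q0, q1, q2}" "p \<noteq> q0" "p \<noteq> q1" "p \<noteq> q2" using assms by blast+
  then show ?thesis using that q c by blast
qed

end

section \<open>Green's formula on a tetrahedron\<close>

lemma tri_int_linear_sum:
  assumes "finite I" "\<And>i. i \<in> I \<Longrightarrow> continuous_on UNIV (f i)"
  shows "tri_int q0 q1 q2 (\<lambda>x. \<Sum>i\<in>I. f i x) = (\<Sum>i\<in>I. tri_int q0 q1 q2 (f i))"
  unfolding tri_int_def scaleR_sum_right
  using assms by (intro Bochner_Integration.integral_sum tri_int_integrable)

text \<open>Parameter domain for slicing a tetrahedron parallel to one edge from \<open>p\<close> to
  \<open>q\<close>. The coordinate \<open>m\<close> runs along the edge from the facet opposite
  \<open>q\<close> (at \<open>m = 0\<close>) to the facet opposite \<open>p\<close> (at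
  \<open>m = s\<close>), and the other two range over \<open>ref_tri\<close>.\<close>

definition ref_tet :: "(real \<times> real \<times> real) set" where
  "ref_tet = {(m, l, s). 0 < m \<and> m < s \<and> 0 < l \<and> l + s < 1}"

lemma open_ref_tet: "open ref_tet"
proof -
  have eq: "ref_tet = {x. 0 < fst x} \<inter> {x. fst x < snd (snd x)} \<inter> {x. 0 < fst (snd x)} \<inter> {x. fst (snd x) + snd (snd x) < 1}"
    by (auto simp: ref_tet_def)
  show ?thesis unfolding eq by (intro open_Int open_Collect_less continuous_intros)
qed

lemma bounded_ref_tet: "bounded ref_tet"
proof (rule bounded_subset[of "cbox (0, 0, 0) (1, 1, 1)"])
  show "ref_tet \<subseteq> cbox (0, 0, 0) (1, 1, 1)" by (auto simp: ref_tet_def cbox_Pair_eq)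
qed simp

lemma integral_derivative_segment:
  fixes F :: "real \<Rightarrow> complex"
  assumes s: "0 < s" and F: "\<And>m. (F has_vector_derivative F' m) (at m)" and F': "continuous_on UNIV F'"
  shows "(\<integral>m. indicator {0<..<s} m *\<^sub>R F' m \<partial>lborel) = F s - F 0"
proof -
  have "(\<integral>m. indicator {0<..<s} m *\<^sub>R F' m \<partial>lborel) = (\<integral>m. indicator {0..s} m *\<^sub>R F' m \<partial>lborel)"
  proof (rule integral_cong_AE)
    have [measurable]: "F' \<in> borel_measurable borel" using F' by (rule borel_measurable_continuous_onI)
    show "(\<lambda>m. indicator {0<..<s} m *\<^sub>R F' m) \<in> borel_measurable lborel"
      "(\<lambda>m. indicator {0..s} m *\<^sub>R F' m) \<in> borel_measurable lborel" by measurable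
    show "AE m in lborel. indicator {0<..<s} m *\<^sub>R F' m = indicator {0..s} m *\<^sub>R F' m"
      using AE_lborel_singleton[of 0] AE_lborel_singleton[of s]
      by eventually_elim (auto simp: indicator_def)
  qed
  also have "\<dots> = F s - F 0"
  proof (rule integral_FTC_Icc)
    show "(F has_vector_derivative F' x) (at x within {0..s})" for x
      using F by (rule has_vector_derivative_at_within)
    show "continuous_on {0..s} F'" using F' by (rule continuous_on_subset) simp
  qed (use s in simp)
  finally show ?thesis .
qed

context tetrahedron
begin

text \<open>The Jacobian of the slicing parametrisation. Written as a quotient of volumes it is
  visibly the same for every edge, so one constant serves all facets; its value is six times the
  volume of \<open>T\<close>.\<close>

definition face_const :: real where
  "face_const = measure lborel T / measure lborel ref_tet"

lemma edge_parametrization: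
  assumes P: "P = {p, q, k, l}" and d: "p \<noteq> q" "k \<noteq> l" "k \<noteq> p" "k \<noteq> q" "l \<noteq> p" "l \<noteq> q"
  shows "triple (q - p) (l - k) (p - k) \<noteq> 0"
    and "k + m *\<^sub>R (q - p) + t *\<^sub>R (l - k) + s *\<^sub>R (p - k) \<in> T \<longleftrightarrow> (m, t, s) \<in> ref_tet"
    and "\<bar>triple (q - p) (l - k) (p - k)\<bar> = face_const"
proof -
  have mem: "p \<in> P" "q \<in> P" "k \<in> P" "l \<in> P" by (simp_all add: P)
  have dd: "q \<noteq> p" "l \<noteq> k" "p \<noteq> k" "q \<noteq> k" "p \<noteq> l" "q \<noteq> l" using d by auto
  \<comment> \<open>The biorthogonal system consists of \<open>g q\<close>, \<open>g l\<close> and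
    \<open>g p + g q\<close>; the sum in the last one compensates the pairing of \<open>g p\<close>
    with \<open>q - p\<close>.\<close>
  show nz: "triple (q - p) (l - k) (p - k) \<noteq> 0"
    by (rule triple_nonzero_of_dual[of "g q" _ _ _ "g l" "g p + g q"])
      (simp_all add: inner_add_left g_diff mem d dd)
  have par: "k + m *\<^sub>R (q - p) + t *\<^sub>R (l - k) + s *\<^sub>R (p - k) \<in> T \<longleftrightarrow> (m, t, s) \<in> ref_tet" for m t s
  proof -
    let ?x = "k + m *\<^sub>R (q - p) + t *\<^sub>R (l - k) + s *\<^sub>R (p - k)"
    have "lam r ?x = lam r k + m * (g r \<bullet> (q - p)) + t * (g r \<bullet> (l - k)) + s * (g r \<bullet> (p - k))" for r
      by (simp only: lam_add inner_scaleR_right)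
    then have "lam p ?x = s - m" "lam q ?x = m" "lam k ?x = 1 - t - s" "lam l ?x = t"
      by (simp_all add: lam_vertex g_diff mem d dd)
    moreover have "?x \<in> T \<longleftrightarrow> 0 < lam p ?x \<and> 0 < lam q ?x \<and> 0 < lam k ?x \<and> 0 < lam l ?x"
      unfolding T_def mem_Collect_eq by (simp add: P)
    ultimately show ?thesis by (auto simp: ref_tet_def)
  qed
  then show "k + m *\<^sub>R (q - p) + t *\<^sub>R (l - k) + s *\<^sub>R (p - k) \<in> T \<longleftrightarrow> (m, t, s) \<in> ref_tet" .
  \<comment> \<open>Transforming the constant function one determines the Jacobian without computing
    a determinant.\<close>
  have "measure lborel T = (\<integral>x. indicator T x \<partial>lborel)" by simp
  also have "\<dots> = \<bar>triple (q - p) (l - k) (p - k)\<bar> *\<^sub>R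
      (\<integral>(m, t, s). indicator T (k + m *\<^sub>R (q - p) + t *\<^sub>R (l - k) + s *\<^sub>R (p - k)) \<partial>lborel)"
    using open_T by (intro integral_parametrized[OF nz]) simp
  also have "(\<lambda>(m, t, s). indicator T (k + m *\<^sub>R (q - p) + t *\<^sub>R (l - k) + s *\<^sub>R (p - k)) :: real) = indicator ref_tet"
    by (auto simp: fun_eq_iff indicator_def par)
  also have "(\<integral>x. indicator ref_tet x \<partial>lborel) = measure lborel ref_tet" by simp
  finally have m: "measure lborel T = \<bar>triple (q - p) (l - k) (p - k)\<bar> * measure lborel ref_tet" by simp
  then have "measure lborel ref_tet \<noteq> 0" using measure_T_pos by auto
  then show "\<bar>triple (q - p) (l - k) (p - k)\<bar> = face_const" using m by (simp add: face_const_def)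
qed

text \<open>The fundamental theorem of calculus along the lines parallel to the edge, followed by
  Fubini: the boundary terms of the segments are the values on the two facets that the edge
  joins.\<close>

lemma integral_directional_derivative:
  fixes f :: "real^3 \<Rightarrow> complex"
  assumes p: "p \<in> P" and q: "q \<in> P" and f: "\<And>x. (f has_derivative f' x) (at x)"
    and f': "\<And>e. continuous_on UNIV (\<lambda>x. f' x e)"
  shows "(\<integral>x. indicator T x *\<^sub>R f' x (q - p) \<partial>lborel) = face_const *\<^sub>R (face_int (P - {p}) f - face_int (P - {q}) f)"
proof (cases "p = q")
  case True
  have "f' x 0 = 0" for x using f[of x] by (rule has_derivative_linear[THEN linear_0])
  then show ?thesis using True by simp
next
  case False
  obtain k l where P: "P = {p, q, k, l}" and d: "k \<noteq> l" "k \<noteq> p" "k \<noteq> q" "l \<noteq> p" "l \<noteq> q"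
    using vertex_facts[OF p q False] by metis
  note par = edge_parametrization[OF P False d]
  have cf: "continuous_on UNIV f"
    by (intro continuous_at_imp_continuous_on ballI has_derivative_continuous[OF f])
  have fm: "f \<in> borel_measurable borel" "(\<lambda>x. f' x (q - p)) \<in> borel_measurable borel"
    using cf f' by (auto intro: borel_measurable_continuous_onI)
  define X where "X m t s = k + m *\<^sub>R (q - p) + t *\<^sub>R (l - k) + s *\<^sub>R (p - k)" for m t s
  define h where "h m y = indicator ref_tet (m, y) *\<^sub>R f' (X m (fst y) (snd y)) (q - p)" for m y
  have hcase: "case_prod h = (\<lambda>x. indicator ref_tet x *\<^sub>R f' (X (fst x) (fst (snd x)) (snd (snd x))) (q - p))"
    by (auto simp: fun_eq_iff h_def)
  have "integrable lborel (case_prod h)" unfolding hcase X_def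
    using open_ref_tet
    by (intro integrable_bounded_continuous bounded_ref_tet continuous_on_compose2[OF f'] continuous_intros) auto
  then have hint: "integrable (lborel \<Otimes>\<^sub>M lborel) (case_prod h)" by (simp add: lborel_prod)
  have inner: "(\<integral>m. h m y \<partial>lborel) = indicator ref_tri y *\<^sub>R (f (X (snd y) (fst y) (snd y)) - f (X 0 (fst y) (snd y)))" for y
  proof (cases "y \<in> ref_tri")
    case True
    then have y: "0 < fst y" "0 < snd y" "fst y + snd y < 1" by (auto simp: ref_tri_def)
    have "h m y = indicator {0<..<snd y} m *\<^sub>R f' (X m (fst y) (snd y)) (q - p)" for m
      using y by (cases y) (auto simp: h_def ref_tet_def indicator_def)
    then have "(\<integral>m. h m y \<partial>lborel) = (\<integral>m. indicator {0<..<snd y} m *\<^sub>R f' (X m (fst y) (snd y)) (q - p) \<partial>lborel)" by simp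
    also have "\<dots> = f (X (snd y) (fst y) (snd y)) - f (X 0 (fst y) (snd y))"
    proof (rule integral_derivative_segment)
      show "continuous_on UNIV (\<lambda>m. f' (X m (fst y) (snd y)) (q - p))" unfolding X_def
        by (intro continuous_on_compose2[OF f'] continuous_intros) auto
      fix m :: real
      have "((\<lambda>m. X m (fst y) (snd y)) has_derivative (\<lambda>u. u *\<^sub>R (q - p))) (at m)"
        unfolding X_def by (auto intro!: derivative_eq_intros)
      from has_derivative_compose[OF this f]
      show "((\<lambda>m. f (X m (fst y) (snd y))) has_vector_derivative f' (X m (fst y) (snd y)) (q - p)) (at m)"
        unfolding has_vector_derivative_def
        using linear_scale[OF has_derivative_linear[OF f]] by simp
    qed (use y in simp)
    finally show ?thesis using True by simp
  next
    case False
    then have "h m y = 0" for m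
      by (cases y) (auto simp: h_def ref_tet_def ref_tri_def indicator_def)
    then show ?thesis using False by simp
  qed
  have "(\<integral>x. indicator T x *\<^sub>R f' x (q - p) \<partial>lborel) = face_const *\<^sub>R
      (\<integral>(m, t, s). indicator T (X m t s) *\<^sub>R f' (X m t s) (q - p) \<partial>lborel)"
    unfolding X_def par(3)[symmetric]
    using open_T by (intro integral_parametrized[OF par(1)] borel_measurable_scaleR fm borel_measurable_indicator) simp_all
  also have "(\<lambda>(m, t, s). indicator T (X m t s) *\<^sub>R f' (X m t s) (q - p)) = case_prod h"
    by (auto simp: fun_eq_iff h_def X_def indicator_def par(2))
  also have "integral\<^sup>L lborel (case_prod h) = (\<integral>y. (\<integral>m. h m y \<partial>lborel) \<partial>lborel)"
    using lborel_pair.integral_snd[OF hint] by (simp only: lborel_prod)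
  also have "\<dots> = (\<integral>y. indicator ref_tri y *\<^sub>R f (k + fst y *\<^sub>R (l - k) + snd y *\<^sub>R (q - k)) -
      indicator ref_tri y *\<^sub>R f (k + fst y *\<^sub>R (l - k) + snd y *\<^sub>R (p - k)) \<partial>lborel)"
    unfolding inner X_def by (intro Bochner_Integration.integral_cong refl) (simp add: algebra_simps)
  also have "\<dots> = tri_int k l q f - tri_int k l p f"
    unfolding tri_int_def by (intro Bochner_Integration.integral_diff tri_int_integrable cf)
  \<comment> \<open>The end \<open>m = s\<close> replaces \<open>p\<close> by \<open>q\<close> in
    the parametrisation, so it sweeps the facet without \<open>p\<close>; the end
    \<open>m = 0\<close> sweeps the facet without \<open>q\<close>.\<close>
  also have "tri_int k l q f = face_int (P - {p}) f"
    using False d by (intro face_int_eq[symmetric] cf) (auto simp: P)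
  also have "tri_int k l p f = face_int (P - {q}) f"
    using False d by (intro face_int_eq[symmetric] cf) (auto simp: P)
  finally show ?thesis .
qed

lemma sum_g_components: "(\<Sum>q\<in>P. g q $ i * q $ j) = (if i = j then 1 else 0)"
proof -
  have "(\<Sum>q\<in>P. g q $ i * q $ j) = (\<Sum>q\<in>P. (g q \<bullet> axis i 1) *\<^sub>R q) $ j"
    by (simp add: inner_axis)
  then show ?thesis unfolding repr_g by (auto simp: axis_def)
qed

text \<open>The tensors formed from \<open>g q\<close> and \<open>q\<close> add up to the identity,
  and the common point \<open>p0\<close> drops out since the gradients add up to zero. A divergence
  thereby becomes a sum of derivatives along the edges issuing from \<open>p0\<close>.\<close>

lemma trace_eq:
  assumes M: "linear (M :: real^3 \<Rightarrow> complex^3)" and p0: "p0 \<in> P"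
  shows "(\<Sum>q\<in>P. rdot (g q) (M (q - p0))) = (\<Sum>i\<in>UNIV. M (axis i 1) $ i)"
proof -
  have Mv: "M v = (\<Sum>j\<in>UNIV. v $ j *\<^sub>R M (axis j 1))" for v
  proof -
    have "M v = M (\<Sum>j\<in>UNIV. v $ j *\<^sub>R axis j 1)"
      using basis_expansion[of v] by (simp add: scalar_mult_eq_scaleR)
    also have "\<dots> = (\<Sum>j\<in>UNIV. v $ j *\<^sub>R M (axis j 1))"
      by (simp add: linear_sum[OF M] linear_scale[OF M])
    finally show ?thesis .
  qed
  have "(\<Sum>q\<in>P. rdot (g q) (M (q - p0))) = (\<Sum>q\<in>P. rdot (g q) (M q)) - rdot (\<Sum>q\<in>P. g q) (M p0)"
    by (simp add: linear_diff[OF M] linear_diff[OF linear_rdot_right] linear_sum[OF linear_rdot_left] sum_subtractf)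
  also have "\<dots> = (\<Sum>q\<in>P. rdot (g q) (M q))" by (simp add: sum_g rdot_3)
  also have "\<dots> = (\<Sum>q\<in>P. \<Sum>i\<in>UNIV. \<Sum>j\<in>UNIV. (g q $ i * q $ j) *\<^sub>R M (axis j 1) $ i)"
    by (subst Mv) (simp add: rdot_def scaleR_sum_right)
  also have "\<dots> = (\<Sum>i\<in>UNIV. \<Sum>j\<in>UNIV. (\<Sum>q\<in>P. g q $ i * q $ j) *\<^sub>R M (axis j 1) $ i)"
    by (subst sum.swap, intro sum.cong refl, subst sum.swap) (simp add: scaleR_sum_left)
  also have "\<dots> = (\<Sum>i\<in>UNIV. M (axis i 1) $ i)"
    by (simp add: sum_g_components if_distrib[of "\<lambda>x. x *\<^sub>R _"] cong: if_cong)
  finally show ?thesis .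
qed

lemma face_int_sum:
  assumes p: "p \<in> P" and "finite I" "\<And>i. i \<in> I \<Longrightarrow> continuous_on UNIV (f i)"
  shows "face_int (P - {p}) (\<lambda>x. \<Sum>i\<in>I. f i x) = (\<Sum>i\<in>I. face_int (P - {p}) (f i))"
proof -
  obtain q0 q1 q2 where q: "P - {p} = {q0, q1, q2}" "card (P - {p}) = 3" using facet_vertices[OF p] by metis
  have "face_int (P - {p}) (\<lambda>x. \<Sum>i\<in>I. f i x) = tri_int q0 q1 q2 (\<lambda>x. \<Sum>i\<in>I. f i x)"
    using assms by (intro face_int_eq q continuous_on_sum)
  also have "\<dots> = (\<Sum>i\<in>I. tri_int q0 q1 q2 (f i))" using assms by (intro tri_int_linear_sum)
  also have "\<dots> = (\<Sum>i\<in>I. face_int (P - {p}) (f i))"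
    using assms by (intro sum.cong refl face_int_eq[symmetric] q)
  finally show ?thesis .
qed

text \<open>Each gradient \<open>g q\<close> is an inward normal of the facet opposite
  \<open>q\<close>, which explains the minus sign. The edge formula yields these facet terms plus
  extra terms on the facet opposite \<open>p0\<close>, and the latter cancel.\<close>

lemma divergence_theorem:
  fixes X :: "real^3 \<Rightarrow> complex^3"
  assumes X: "\<And>x. (X has_derivative X' x) (at x)" and X': "\<And>e. continuous_on UNIV (\<lambda>x. X' x e)"
  shows "(\<integral>x. indicator T x *\<^sub>R (\<Sum>i\<in>UNIV. X' x (axis i 1) $ i) \<partial>lborel)
    = - (face_const *\<^sub>R (\<Sum>q\<in>P. face_int (P - {q}) (\<lambda>x. rdot (g q) (X x))))"
proof -
  obtain p0 where p0: "p0 \<in> P" using card_P by fastforce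
  have cX: "continuous_on UNIV X"
    by (intro continuous_at_imp_continuous_on ballI has_derivative_continuous[OF X])
  have rX: "continuous_on UNIV (\<lambda>x. rdot v (X x))" for v
    by (rule continuous_on_linear_fun[OF linear_rdot_right cX])
  have rX': "continuous_on UNIV (\<lambda>x. rdot v (X' x e))" for v e
    by (rule continuous_on_linear_fun[OF linear_rdot_right X'])
  have dir: "(\<integral>x. indicator T x *\<^sub>R rdot (g q) (X' x (q - p0)) \<partial>lborel)
      = face_const *\<^sub>R (face_int (P - {p0}) (\<lambda>x. rdot (g q) (X x)) - face_int (P - {q}) (\<lambda>x. rdot (g q) (X x)))"
    if "q \<in> P" for q
  proof (rule integral_directional_derivative[where f' = "\<lambda>x e. rdot (g q) (X' x e)", OF p0 that _ rX'])
    fix x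
    have "bounded_linear (rdot (g q))"
      using linear_rdot_right[of "g q"] by (simp add: linear_conv_bounded_linear)
    then show "((\<lambda>x. rdot (g q) (X x)) has_derivative (\<lambda>e. rdot (g q) (X' x e))) (at x)"
      by (rule bounded_linear.has_derivative[OF _ X])
  qed
  have "(\<integral>x. indicator T x *\<^sub>R (\<Sum>i\<in>UNIV. X' x (axis i 1) $ i) \<partial>lborel)
     = (\<integral>x. (\<Sum>q\<in>P. indicator T x *\<^sub>R rdot (g q) (X' x (q - p0))) \<partial>lborel)"
    using trace_eq[OF has_derivative_linear[OF X] p0] by (simp add: scaleR_sum_right[symmetric])
  also have "\<dots> = (\<Sum>q\<in>P. \<integral>x. indicator T x *\<^sub>R rdot (g q) (X' x (q - p0)) \<partial>lborel)"
    using open_T by (intro Bochner_Integration.integral_sum integrable_bounded_continuous rX' bounded_T) auto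
  also have "\<dots> = (\<Sum>q\<in>P. face_const *\<^sub>R (face_int (P - {p0}) (\<lambda>x. rdot (g q) (X x)) - face_int (P - {q}) (\<lambda>x. rdot (g q) (X x))))"
    by (rule sum.cong[OF refl dir])
  also have "\<dots> = face_const *\<^sub>R ((\<Sum>q\<in>P. face_int (P - {p0}) (\<lambda>x. rdot (g q) (X x))) - (\<Sum>q\<in>P. face_int (P - {q}) (\<lambda>x. rdot (g q) (X x))))"
    by (simp add: scaleR_sum_right[symmetric] sum_subtractf)
  also have "(\<Sum>q\<in>P. face_int (P - {p0}) (\<lambda>x. rdot (g q) (X x))) = face_int (P - {p0}) (\<lambda>x. \<Sum>q\<in>P. rdot (g q) (X x))"
    using finite_P rX by (intro face_int_sum[symmetric] p0) auto
  \<comment> \<open>All extra terms live on the same facet, where their normals add up to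
    zero.\<close>
  also have "(\<lambda>x. \<Sum>q\<in>P. rdot (g q) (X x)) = (\<lambda>x. 0)"
    by (simp only: linear_sum[OF linear_rdot_left, symmetric] sum_g) (simp add: rdot_3)
  also have "face_int (P - {p0}) (\<lambda>x. 0 :: complex) = 0"
  proof -
    obtain q0 q1 q2 where q: "P - {p0} = {q0, q1, q2}" "card (P - {p0}) = 3" using facet_vertices[OF p0] by metis
    show ?thesis by (subst face_int_eq[OF q]) (simp_all add: tri_int_def)
  qed
  finally show ?thesis by simp
qed

end

section \<open>Green's formula for lowest-order Nedelec fields\<close>

definition ned :: "complex^3 \<Rightarrow> complex^3 \<Rightarrow> vfield" where
  "ned a b x = a + ccross b (cvec x)"

lemma nedelec0_eq: "nedelec0 = {ned a b | a b. True}"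
  by (simp add: nedelec0_def ned_def[abs_def] cvec_def)

lemma continuous_ned: "continuous_on S (ned a b)"
  unfolding ned_def[abs_def]
  by (intro continuous_intros continuous_on_ccross continuous_on_linear_fun[OF linear_cvec])

text \<open>If \<open>G\<close> is the curl of \<open>N\<close>, this is the divergence of the cross
  product of \<open>N\<close> with the conjugate of \<open>V\<close>. For \<open>N = ned a b\<close>
  that curl is the constant \<open>2 *\<^sub>R b\<close>. Integrated over the domain it gives the
  tangential trace functional.\<close>

definition green :: "complex^3 \<Rightarrow> vfield \<Rightarrow> vfield \<Rightarrow> real^3 \<Rightarrow> complex" where
  "green G N V x = (\<Sum>i\<in>UNIV. G $ i * cnj (V x $ i)) - (\<Sum>i\<in>UNIV. N x $ i * cnj (classical_curl V x $ i))"

lemma smooth_field_has_derivative: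
  "smooth_field V \<Longrightarrow> (V has_derivative frechet_derivative V (at x)) (at x)"
  using smooth_field_differentiable frechet_derivative_works by blast

lemma frechet_derivative_components:
  assumes "smooth_field V"
  shows "frechet_derivative V (at x) e = (\<Sum>j\<in>UNIV. e $ j *\<^sub>R partial_deriv j V x)"
proof -
  note L = has_derivative_linear[OF smooth_field_has_derivative[OF assms, of x]]
  have "frechet_derivative V (at x) e = frechet_derivative V (at x) (\<Sum>j\<in>UNIV. e $ j *\<^sub>R axis j 1)"
    using basis_expansion[of e] by (simp add: scalar_mult_eq_scaleR)
  then show ?thesis by (simp add: linear_sum[OF L] linear_scale[OF L] partial_deriv_def)
qed

text \<open>The divergence theorem applied to the cross product of the field with the conjugated
  test field. Since \<open>V\<close> need not vanish on the boundary of \<open>T\<close>, all four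
  facet terms remain.\<close>

lemma (in tetrahedron) green_formula:
  assumes V: "smooth_field V"
  shows "(\<integral>x. indicator T x *\<^sub>R green (2 *\<^sub>R b) (ned a b) V x \<partial>lborel)
    = - (face_const *\<^sub>R (\<Sum>q\<in>P. face_int (P - {q}) (\<lambda>x. rdot (g q) (ccross (ned a b x) (vcnj (V x))))))"
proof -
  let ?V' = "\<lambda>x. frechet_derivative V (at x)"
  define X' where "X' x e = ccross (ned a b x) (vcnj (?V' x e)) + ccross (ccross b (cvec e)) (vcnj (V x))" for x e
  have blc: "bounded_linear vcnj" "bounded_linear cvec"
    using linear_vcnj linear_cvec linear_conv_bounded_linear by blast+
  have sc: "r *\<^sub>R z = complex_of_real r * z" for r z by (rule scaleR_conv_of_real)
  have "green (2 *\<^sub>R b) (ned a b) V x = (\<Sum>i\<in>UNIV. X' x (axis i 1) $ i)" for x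
    unfolding green_def X'_def classical_curl_def
    by (simp add: sum_3 ccross_nth vcnj_def cvec_def axis_def partial_deriv_def sc algebra_simps)
  then have "(\<integral>x. indicator T x *\<^sub>R green (2 *\<^sub>R b) (ned a b) V x \<partial>lborel)
      = (\<integral>x. indicator T x *\<^sub>R (\<Sum>i\<in>UNIV. X' x (axis i 1) $ i) \<partial>lborel)" by simp
  also have "\<dots> = - (face_const *\<^sub>R (\<Sum>q\<in>P. face_int (P - {q}) (\<lambda>x. rdot (g q) (ccross (ned a b x) (vcnj (V x))))))"
  proof (rule divergence_theorem)
    fix x
    have "((\<lambda>x. ccross (ned a b x) (vcnj (V x))) has_derivative
      (\<lambda>h. ccross (ned a b x) (vcnj (?V' x h)) + ccross (0 + ccross b (cvec h)) (vcnj (V x)))) (at x)"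
      unfolding ned_def[abs_def]
      by (intro bounded_bilinear.FDERIV[OF bounded_bilinear_ccross] bounded_linear.has_derivative[OF blc(1)]
          smooth_field_has_derivative V has_derivative_add has_derivative_const
          bounded_linear.has_derivative[OF bounded_bilinear.bounded_linear_right[OF bounded_bilinear_ccross]]
          bounded_linear_imp_has_derivative[OF blc(2)])
    then show "((\<lambda>x. ccross (ned a b x) (vcnj (V x))) has_derivative X' x) (at x)"
      by (simp add: X'_def[abs_def])
  next
    fix e
    have cV: "continuous_on UNIV V" using V by (rule smooth_field_continuous)
    have cV': "continuous_on UNIV (\<lambda>x. ?V' x e)"
      unfolding frechet_derivative_components[OF V]
      by (intro continuous_intros smooth_field_continuous_partial V)
    show "continuous_on UNIV (\<lambda>x. X' x e)"
      unfolding X'_def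
      by (intro continuous_on_add continuous_on_const continuous_on_ccross continuous_ned
          continuous_on_linear_fun[OF linear_vcnj cV] continuous_on_linear_fun[OF linear_vcnj cV'])
  qed
  finally show ?thesis .
qed

section \<open>Edge interpolation and an inverse estimate\<close>

lemma norm_rdot_le: "norm (rdot v w) \<le> norm v * norm w"
proof -
  have "norm (rdot v w) \<le> (\<Sum>i\<in>UNIV. norm (v $ i *\<^sub>R w $ i))"
    unfolding rdot_def by (rule norm_sum)
  also have "\<dots> = (\<Sum>i\<in>UNIV. \<bar>v $ i\<bar> * \<bar>norm (w $ i)\<bar>)" by simp
  also have "\<dots> \<le> L2_set (\<lambda>i. v $ i) UNIV * L2_set (\<lambda>i. norm (w $ i)) UNIV"
    by (rule L2_set_mult_ineq)
  also have "\<dots> = norm v * norm w" by (simp add: norm_vec_def L2_set_def)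
  finally show ?thesis .
qed

lemma norm_cvec: "norm (cvec v) = norm v"
  by (simp add: norm_vec_def cvec_def L2_set_def)

lemma norm_smult_vec: "norm (c *s (v :: complex^3)) = norm c * norm v"
  by (simp add: norm_vec_def norm_mult L2_set_right_distrib)

lemma norm_cross3_le: "norm (cross3 a b) \<le> norm a * norm b"
proof (rule power2_le_imp_le)
  show "(norm (cross3 a b))\<^sup>2 \<le> (norm a * norm b)\<^sup>2"
    using norm_cross_dot[of a b] zero_le_power2[of "a \<bullet> b"] by linarith
qed simp

text \<open>The Binet-Cauchy identity. With \<open>a\<close> and \<open>b\<close> spanning a facet,
  the normal component of the cross product is expressed by tangential components alone.\<close>

lemma rdot_ccross: "rdot (cross3 a b) (ccross N W) = rdot a N * rdot b W - rdot b N * rdot a W"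
  by (simp add: rdot_3 cross3_nth ccross_nth scaleR_conv_of_real algebra_simps)

text \<open>The field varies along the edge by a multiple of the cross product with
  \<open>q - p\<close>, which is orthogonal to the edge. The tangential component is therefore
  constant on the edge, and its value at either endpoint can serve as the degree of freedom.\<close>

lemma ned_edge: "rdot (q - p) (ned a b q) = rdot (q - p) (ned a b p)"
  by (simp add: ned_def rdot_3 ccross_nth cvec_def scaleR_conv_of_real algebra_simps)

lemma ned_affine:
  assumes "finite I" "sum u I = 1"
  shows "ned a b (\<Sum>i\<in>I. u i *\<^sub>R x i) = (\<Sum>i\<in>I. u i *\<^sub>R ned a b (x i))"
proof -
  have L: "linear (\<lambda>x. ccross b (cvec x))"
    using linear_compose[OF linear_cvec, of "ccross b"] bilinear_ccross by (simp add: bilinear_def o_def)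
  then have "ned a b (\<Sum>i\<in>I. u i *\<^sub>R x i) = sum u I *\<^sub>R a + (\<Sum>i\<in>I. u i *\<^sub>R ccross b (cvec (x i)))"
    using assms by (simp add: ned_def linear_sum[OF L] linear_scale[OF L])
  then show ?thesis by (simp add: ned_def scaleR_add_right sum.distrib scaleR_sum_left)
qed

lemma ned_tri:
  "ned a b (q0 + s *\<^sub>R (q1 - q0) + t *\<^sub>R (q2 - q0))
    = (1 - s - t) *\<^sub>R ned a b q0 + s *\<^sub>R ned a b q1 + t *\<^sub>R ned a b q2"
  by (simp add: vec_eq_iff forall_3 ned_def ccross_nth cvec_def scaleR_conv_of_real[where 'a=complex] algebra_simps)

lemma ned_inject:
  assumes "ned a b = ned a' b'" shows "a = a'" "b = b'"
proof -
  have e: "a + ccross b (cvec x) = a' + ccross b' (cvec x)" for x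
    using fun_cong[OF assms, of x] by (simp add: ned_def)
  have "ccross b (cvec 0) = 0" for b by (simp add: vec_eq_iff forall_3 ccross_nth cvec_def)
  then show a: "a = a'" using e[of 0] by simp
  have "ccross b (cvec x) = ccross b' (cvec x)" for x using e[of x] a by simp
  from this[of "axis 1 1"] this[of "axis 2 1"] show "b = b'"
    by (simp add: vec_eq_iff forall_3 ccross_nth cvec_def axis_def)
qed

context tetrahedron
begin

text \<open>For antisymmetric \<open>\<omega>\<close> this is the Whitney interpolant: the sum over the edges of \<open>\<omega> p q\<close> times
  \<open>\<lambda>\<^sub>p \<nabla>\<lambda>\<^sub>q - \<lambda>\<^sub>q \<nabla>\<lambda>\<^sub>p\<close>.\<close>

definition interp :: "(real^3 \<Rightarrow> real^3 \<Rightarrow> complex) \<Rightarrow> vfield" where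
  "interp \<omega> x = (\<Sum>p\<in>P. \<Sum>q\<in>P. (complex_of_real (lam p x) * \<omega> p q) *s cvec (g q))"

text \<open>The constant curl of \<open>interp\<close> for antisymmetric \<open>\<omega>\<close>.
  The sum runs over ordered pairs and so counts each edge twice; this is the factor 2 in the curl of
  a Whitney function.\<close>

definition interp_curl :: "(real^3 \<Rightarrow> real^3 \<Rightarrow> complex) \<Rightarrow> complex^3" where
  "interp_curl \<omega> = (\<Sum>p\<in>P. \<Sum>q\<in>P. \<omega> p q *s cvec (cross3 (g p) (g q)))"

text \<open>Only the part linear in \<open>x\<close> needs an argument. Antisymmetry gives
  \<open>A = - B\<close>, so this part is half of \<open>A - B\<close>, and the expansion of the
  double cross product turns \<open>A - B\<close> into the cross product of
  \<open>interp_curl\<close> with \<open>x\<close>.\<close>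

lemma interp_eq_ned:
  assumes anti: "\<And>p q. \<omega> q p = - \<omega> p q"
  shows "\<exists>a. interp \<omega> = ned a ((1/2) *\<^sub>R interp_curl \<omega>)"
proof -
  define a where "a = (\<Sum>p\<in>P. \<Sum>q\<in>P. (complex_of_real (\<beta> p) * \<omega> p q) *s cvec (g q))"
  have "interp \<omega> x = ned a ((1/2) *\<^sub>R interp_curl \<omega>) x" for x
  proof -
    define A where "A = (\<Sum>p\<in>P. \<Sum>q\<in>P. (complex_of_real (g p \<bullet> x) * \<omega> p q) *s cvec (g q))"
    define B where "B = (\<Sum>p\<in>P. \<Sum>q\<in>P. (complex_of_real (g q \<bullet> x) * \<omega> p q) *s cvec (g p))"
    have iA: "interp \<omega> x = A + a"
      by (simp add: interp_def lam_def A_def a_def sum.distrib[symmetric] algebra_simps)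
    have "A = (\<Sum>q\<in>P. \<Sum>p\<in>P. (complex_of_real (g p \<bullet> x) * \<omega> p q) *s cvec (g q))"
      unfolding A_def by (rule sum.swap)
    then have "A = (\<Sum>p\<in>P. \<Sum>q\<in>P. (complex_of_real (g q \<bullet> x) * \<omega> q p) *s cvec (g p))" .
    then have AB: "A = - B" unfolding B_def
      by (subst (asm) anti) (simp add: sum_negf[symmetric] vec_eq_iff)
    have X: "A - B = ccross (interp_curl \<omega>) (cvec x)"
    proof -
      have "ccross (\<omega> p q *s cvec (cross3 (g p) (g q))) (cvec x)
        = (complex_of_real (g p \<bullet> x) * \<omega> p q) *s cvec (g q) - (complex_of_real (g q \<bullet> x) * \<omega> p q) *s cvec (g p)" for p q
        by (simp add: vec_eq_iff forall_3 ccross_nth cross3_nth cvec_def inner_3 algebra_simps)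
      moreover have L: "linear (\<lambda>c. ccross c (cvec x))" using bilinear_ccross by (simp add: bilinear_def)
      ultimately show ?thesis
        by (simp add: interp_curl_def linear_sum[OF L] A_def B_def sum_subtractf)
    qed
    have "A - B = 2 *\<^sub>R A" using AB by (simp add: scaleR_2)
    then have "interp \<omega> x = a + (1/2) *\<^sub>R ccross (interp_curl \<omega>) (cvec x)"
      unfolding iA X[symmetric] by simp
    also have "(1/2) *\<^sub>R ccross (interp_curl \<omega>) (cvec x) = ccross ((1/2) *\<^sub>R interp_curl \<omega>) (cvec x)"
    proof -
      have L: "linear (\<lambda>c. ccross c (cvec x))" using bilinear_ccross by (simp add: bilinear_def)
      show ?thesis by (simp only: linear_scale[OF L])
    qed
    finally show ?thesis by (simp add: ned_def)
  qed
  then show ?thesis by blast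
qed

text \<open>At the vertex \<open>r\<close> only its own barycentric coordinate survives. Pairing
  with \<open>s - r\<close> then picks the gradients of \<open>s\<close> and \<open>r\<close>, and
  the diagonal entry removes the second.\<close>

lemma interp_dof:
  assumes r: "r \<in> P" and s: "s \<in> P" and diag: "\<omega> r r = 0"
  shows "rdot (s - r) (interp \<omega> r) = \<omega> r s"
proof -
  have "interp \<omega> r = (\<Sum>p\<in>P. if p = r then \<Sum>q\<in>P. \<omega> r q *s cvec (g q) else 0)"
    unfolding interp_def using r by (intro sum.cong refl) (auto simp: lam_vertex)
  also have "\<dots> = (\<Sum>q\<in>P. \<omega> r q *s cvec (g q))" using finite_P r by simp
  finally have "rdot (s - r) (interp \<omega> r) = (\<Sum>q\<in>P. rdot (s - r) (\<omega> r q *s cvec (g q)))"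
    by (simp add: linear_sum[OF linear_rdot_right])
  also have "\<dots> = (\<Sum>q\<in>P. \<omega> r q * complex_of_real (g q \<bullet> (s - r)))"
    by (intro sum.cong refl) (simp add: rdot_3 cvec_def inner_3 scaleR_conv_of_real algebra_simps)
  also have "\<dots> = (\<Sum>q\<in>P. (if q = s then \<omega> r s else 0) - (if q = r then \<omega> r r else 0))"
    using r s by (intro sum.cong refl) (auto simp: g_diff)
  also have "\<dots> = \<omega> r s" using finite_P r s diag by (simp add: sum_subtractf)
  finally show ?thesis .
qed

lemma sum_rdot_g: "(\<Sum>q\<in>P. rdot (q - p) w *s cvec (g q)) = w"
proof -
  have "(\<Sum>q\<in>P. rdot (q - p) w *s cvec (g q)) $ i = w $ i" for i
  proof -
    have "(\<Sum>q\<in>P. rdot (q - p) w *s cvec (g q)) $ i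
       = (\<Sum>q\<in>P. (\<Sum>j\<in>UNIV. (g q $ i * q $ j) *\<^sub>R w $ j) - g q $ i *\<^sub>R rdot p w)"
      unfolding sum_component
      by (intro sum.cong refl) (simp add: cvec_def rdot_3 sum_3 scaleR_conv_of_real algebra_simps)
    also have "\<dots> = (\<Sum>q\<in>P. \<Sum>j\<in>UNIV. (g q $ i * q $ j) *\<^sub>R w $ j) - (\<Sum>q\<in>P. g q $ i) *\<^sub>R rdot p w"
      by (simp add: sum_subtractf scaleR_sum_left)
    also have "(\<Sum>q\<in>P. g q $ i) = 0" using sum_g by (metis sum_component zero_index)
    also have "(\<Sum>q\<in>P. \<Sum>j\<in>UNIV. (g q $ i * q $ j) *\<^sub>R w $ j) = (\<Sum>j\<in>UNIV. (\<Sum>q\<in>P. g q $ i * q $ j) *\<^sub>R w $ j)"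
      by (subst sum.swap) (simp add: scaleR_sum_left)
    also have "\<dots> = w $ i" by (simp add: sum_g_components if_distrib[of "\<lambda>x. x *\<^sub>R _"] cong: if_cong)
    finally show ?thesis by simp
  qed
  then show ?thesis by (simp add: vec_eq_iff)
qed

text \<open>Reciprocity of gradients and edges (\<open>sum_rdot_g\<close>) rebuilds the field at
  each vertex from its three edge values there; since the field is affine, its vertex values
  determine it.\<close>

lemma interp_exact: "interp (\<lambda>p q. rdot (q - p) (ned a b p)) = ned a b"
proof
  fix x
  have "interp (\<lambda>p q. rdot (q - p) (ned a b p)) x = (\<Sum>p\<in>P. lam p x *\<^sub>R (\<Sum>q\<in>P. rdot (q - p) (ned a b p) *s cvec (g q)))"
    unfolding interp_def scaleR_sum_right
    by (intro sum.cong refl) (simp add: vec_eq_iff scaleR_conv_of_real[where 'a=complex])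
  also have "\<dots> = (\<Sum>p\<in>P. lam p x *\<^sub>R ned a b p)" by (simp add: sum_rdot_g)
  also have "\<dots> = ned a b x"
    using ned_affine[OF finite_P sum_lam, of a b x "\<lambda>p. p"] by (simp add: lam_repr)
  finally show "interp (\<lambda>p q. rdot (q - p) (ned a b p)) x = ned a b x" .
qed

lemma dof_antisym: "rdot (p - q) (ned a b q) = - rdot (q - p) (ned a b p)"
  using ned_edge[of q p a b] linear_neg[OF linear_rdot_left, of "q - p"] by simp

text \<open>A Nedelec field determines its coefficients, so the exactness of the interpolant passes
  to its curl.\<close>

lemma interp_curl_exact: "interp_curl (\<lambda>p q. rdot (q - p) (ned a b p)) = 2 *\<^sub>R b"
proof -
  have "\<exists>a'. interp (\<lambda>p q. rdot (q - p) (ned a b p)) = ned a' ((1/2) *\<^sub>R interp_curl (\<lambda>p q. rdot (q - p) (ned a b p)))"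
    by (rule interp_eq_ned) (rule dof_antisym)
  then obtain a' where "ned a b = ned a' ((1/2) *\<^sub>R interp_curl (\<lambda>p q. rdot (q - p) (ned a b p)))"
    unfolding interp_exact by blast
  from ned_inject(2)[OF this] have "2 *\<^sub>R b = 2 *\<^sub>R ((1/2) *\<^sub>R interp_curl (\<lambda>p q. rdot (q - p) (ned a b p)))" by simp
  then show ?thesis by simp
qed

lemma facet_normal:
  assumes p: "p \<in> P" and F: "P - {p} = {q0, q1, q2}" "card (P - {p}) = 3"
  shows "triple (q1 - q0) (q2 - q0) (p - q0) \<noteq> 0"
    "triple (q1 - q0) (q2 - q0) (p - q0) *\<^sub>R g p = cross3 (q1 - q0) (q2 - q0)"
proof -
  have "card {q0, q1, q2} = 3" using F by simp
  then have ne: "q0 \<noteq> q1" "q0 \<noteq> q2" "q1 \<noteq> q2" by (auto simp: card_insert_if split: if_splits)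
  have mem: "q0 \<in> P" "q1 \<in> P" "q2 \<in> P" and np: "p \<noteq> q0" "p \<noteq> q1" "p \<noteq> q2" using F(1) by blast+
  have ne': "q1 \<noteq> q0" "q2 \<noteq> q0" "q2 \<noteq> q1" "q0 \<noteq> p" "q1 \<noteq> p" "q2 \<noteq> p" using ne np by auto
  show "triple (q1 - q0) (q2 - q0) (p - q0) \<noteq> 0"
    by (rule triple_nonzero_of_dual[of "g q1" _ _ _ "g q2" "g p"]) (simp_all add: g_diff p mem ne ne' np)
  show "triple (q1 - q0) (q2 - q0) (p - q0) *\<^sub>R g p = cross3 (q1 - q0) (q2 - q0)"
    using triple_expand_cross[of "q1 - q0" "q2 - q0" "p - q0" "g p"] ne ne' p mem by (simp add: g_diff np)
qed

text \<open>The gradient times the determinant \<open>D\<close> is a cross product of two edge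
  vectors, of length at most \<open>d\<^sup>2\<close>. The volume is at most
  \<open>\<bar>D\<bar>\<close> since \<open>T\<close> lies in the parallelepiped of its edge
  vectors; this crude comparison is enough.\<close>

lemma norm_g_le:
  assumes p: "p \<in> P" and d: "\<And>u v. u \<in> P \<Longrightarrow> v \<in> P \<Longrightarrow> norm (u - v) \<le> d"
  shows "norm (g p) * measure lborel T \<le> d\<^sup>2"
proof -
  obtain q0 q1 q2 where P: "P = {p, q0, q1, q2}" and ne: "q0 \<noteq> q1" "q0 \<noteq> q2" "q1 \<noteq> q2" "p \<noteq> q0" "p \<noteq> q1" "p \<noteq> q2"
    using facet_vertices[OF p] by metis
  have mem: "q0 \<in> P" "q1 \<in> P" "q2 \<in> P" by (simp_all add: P)
  have ne': "q1 \<noteq> q0" "q2 \<noteq> q0" "q2 \<noteq> q1" "q0 \<noteq> p" "q1 \<noteq> p" "q2 \<noteq> p" using ne by auto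
  have F: "P - {p} = {q0, q1, q2}" "card (P - {p}) = 3" using P ne ne' by auto
  define a b c where "a = q1 - q0" and "b = q2 - q0" and "c = p - q0"
  define D where "D = triple a b c"
  have D: "D \<noteq> 0" and gp: "D *\<^sub>R g p = cross3 a b"
    unfolding D_def a_def b_def c_def using facet_normal[OF p F] by simp_all
  let ?X = "\<lambda>r s t. q0 + r *\<^sub>R a + s *\<^sub>R b + t *\<^sub>R c"
  have sub: "(r, s, t) \<in> cbox (0, 0, 0) (1, 1, 1)" if "?X r s t \<in> T" for r s t
  proof -
    have l: "lam u (?X r s t) = lam u q0 + r * (g u \<bullet> a) + s * (g u \<bullet> b) + t * (g u \<bullet> c)" for u
      by (simp only: lam_add inner_scaleR_right)
    have "lam q0 (?X r s t) = 1 - r - s - t" "lam q1 (?X r s t) = r" "lam q2 (?X r s t) = s" "lam p (?X r s t) = t"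
      unfolding l unfolding a_def b_def c_def using ne ne' by (simp_all add: lam_vertex g_diff p mem)
    moreover have "0 < lam u (?X r s t)" if "u \<in> P" for u using \<open>?X r s t \<in> T\<close> that by (simp add: T_def)
    from this[OF mem(1)] this[OF mem(2)] this[OF mem(3)] this[OF p]
    have "0 < lam q0 (?X r s t)" "0 < lam q1 (?X r s t)" "0 < lam q2 (?X r s t)" "0 < lam p (?X r s t)" .
    ultimately show ?thesis by (simp add: cbox_Pair_eq)
  qed
  have "measure lborel T = (\<integral>x. indicator T x \<partial>lborel)" by simp
  also have "\<dots> = \<bar>D\<bar> *\<^sub>R (\<integral>(r, s, t). indicator T (?X r s t) \<partial>lborel)"
    unfolding D_def using open_T D by (intro integral_parametrized) (simp_all add: D_def)
  also have "\<dots> \<le> \<bar>D\<bar> *\<^sub>R (\<integral>x. indicator (cbox (0, 0, 0) (1, 1, 1)) x \<partial>(lborel :: (real \<times> real \<times> real) measure))"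
  proof (intro scaleR_left_mono integral_mono')
    show "integrable lborel (indicator (cbox (0, 0, 0) (1, 1, 1)) :: real \<times> real \<times> real \<Rightarrow> real)"
      using emeasure_bounded_finite[OF bounded_cbox, of "(0, 0, 0) :: real \<times> real \<times> real" "(1, 1, 1)"]
      by (simp add: integrable_indicator_iff)
    fix x :: "real \<times> real \<times> real"
    show "(case x of (r, s, t) \<Rightarrow> indicator T (?X r s t)) \<le> (indicator (cbox (0, 0, 0) (1, 1, 1)) x :: real)"
      using sub by (cases x) (simp split: split_indicator)
  qed simp_all
  also have "(\<integral>x. indicator (cbox (0, 0, 0) (1, 1, 1)) x \<partial>(lborel :: (real \<times> real \<times> real) measure)) = (1 :: real)"
  proof -
    have "measure lborel (cbox (0, 0, 0) (1, 1, 1) :: (real \<times> real \<times> real) set) = 1"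
      by (simp add: cbox_Pair_eq measure_def emeasure_lborel_Times borel_Times)
    moreover have "(\<integral>x. indicator S x \<partial>lborel) = measure lborel S" for S :: "(real \<times> real \<times> real) set" by simp
    ultimately show ?thesis by (simp only:)
  qed
  finally have m: "measure lborel T \<le> \<bar>D\<bar>" by simp
  have "norm (g p) * measure lborel T \<le> norm (g p) * \<bar>D\<bar>" using m by (intro mult_left_mono) auto
  also have "\<dots> = norm (cross3 a b)" unfolding gp[symmetric] by simp
  also have "\<dots> \<le> norm a * norm b" by (rule norm_cross3_le)
  also have "\<dots> \<le> d * d" unfolding a_def b_def using mem d
    by (intro mult_mono) (auto intro: order_trans[OF norm_ge_zero])
  finally show ?thesis by (simp add: power2_eq_square)
qed

text \<open>An affine field \<open>f\<close> satisfies \<open>|T| f p = 16 \<integral>\<^sub>A f - \<integral>\<^sub>T f\<close>, where \<open>A = p + (T - p) / 2 \<subseteq> T\<close>.\<close>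

lemma inverse_estimate:
  fixes a b :: "complex^3"
  assumes p: "p \<in> P"
  shows "measure lborel T * (norm (ned a b p))\<^sup>2 \<le> 289 * (\<integral>x. indicator T x * (norm (ned a b x))\<^sup>2 \<partial>lborel)"
proof -
  define f where "f = ned a b"
  define m where "m = measure lborel T"
  define A where "A = (\<lambda>y. (1/2) *\<^sub>R p + (1/2) *\<^sub>R y) ` T"
  have m: "m > 0" unfolding m_def by (rule measure_T_pos)
  have cf: "continuous_on UNIV f" unfolding f_def by (rule continuous_ned)
  have Tb: "T \<in> sets borel" using open_T by simp
  have A_iff: "(1/2) *\<^sub>R p + (1/2) *\<^sub>R y \<in> A \<longleftrightarrow> y \<in> T" for y by (auto simp: A_def)
  have openA: "open A" unfolding A_def
    using open_affinity[OF open_T, of "1/2" "(1/2) *\<^sub>R p"] by simp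
  have AT: "A \<subseteq> T"
  proof
    fix x assume "x \<in> A"
    then obtain y where y: "y \<in> T" "x = (1/2) *\<^sub>R p + (1/2) *\<^sub>R y" by (auto simp: A_def)
    have "lam r x = (1/2) * lam r p + (1/2) * lam r y" for r
      by (simp add: y(2) lam_def inner_add_right field_simps)
    then show "x \<in> T" using y(1) p by (auto simp: T_def lam_vertex add_nonneg_pos)
  qed
  have Ab: "bounded A" using AT bounded_T by (rule bounded_subset[rotated])
  have intT: "integrable lborel (\<lambda>x. indicator T x *\<^sub>R h x)" if "continuous_on UNIV h" for h :: "real^3 \<Rightarrow> 'c::{banach,second_countable_topology}"
    using that bounded_T Tb by (rule integrable_bounded_continuous)
  have intA: "integrable lborel (\<lambda>x. indicator A x *\<^sub>R h x)" if "continuous_on UNIV h" for h :: "real^3 \<Rightarrow> 'c::{banach,second_countable_topology}"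
    using that Ab openA by (intro integrable_bounded_continuous) auto
  have in3: "integrable lborel (indicator T :: real^3 \<Rightarrow> real)"
    using emeasure_bounded_finite[OF bounded_T] Tb by (simp add: integrable_indicator_iff)
  have half: "f ((1/2) *\<^sub>R p + (1/2) *\<^sub>R y) = (1/2) *\<^sub>R (f p + f y)" for y
  proof -
    have eq: "(1/2) *\<^sub>R p + (1/2) *\<^sub>R y = p + (1/2) *\<^sub>R (y - p) + 0 *\<^sub>R (p - p)"
      by (simp add: vec_eq_iff field_simps)
    show ?thesis unfolding f_def eq ned_tri by (simp add: scaleR_add_right)
  qed
  have "(\<integral>x. indicator A x *\<^sub>R f x \<partial>lborel) = (1/8) *\<^sub>R (\<integral>y. indicator A ((1/2) *\<^sub>R p + (1/2) *\<^sub>R y) *\<^sub>R f ((1/2) *\<^sub>R p + (1/2) *\<^sub>R y) \<partial>lborel)"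
  proof -
    have cm: "(\<lambda>y. (1/2) *\<^sub>R p + (1/2) *\<^sub>R y) \<in> borel_measurable borel"
      by (intro borel_measurable_continuous_onI continuous_intros)
    have fm: "(\<lambda>x. indicator A x *\<^sub>R f x) \<in> borel_measurable borel"
      using borel_measurable_integrable[OF intA[OF cf]] by simp
    have "(\<integral>x. indicator A x *\<^sub>R f x \<partial>lborel)
       = (\<integral>x. indicator A x *\<^sub>R f x \<partial>density (distr lborel borel (\<lambda>y. (1/2) *\<^sub>R p + (1/2) *\<^sub>R y)) (\<lambda>_. ennreal (1/8)))"
      using lborel_affine[of "1/2" "(1/2) *\<^sub>R p"] by (simp add: power3_eq_cube)
    also have "\<dots> = (\<integral>x. (1/8) *\<^sub>R (indicator A x *\<^sub>R f x) \<partial>distr lborel borel (\<lambda>y. (1/2) *\<^sub>R p + (1/2) *\<^sub>R y))"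
      using fm by (intro integral_density) auto
    also have "\<dots> = (1/8) *\<^sub>R (\<integral>x. indicator A x *\<^sub>R f x \<partial>distr lborel borel (\<lambda>y. (1/2) *\<^sub>R p + (1/2) *\<^sub>R y))"
      by (rule integral_scaleR_right)
    also have "(\<integral>x. indicator A x *\<^sub>R f x \<partial>distr lborel borel (\<lambda>y. (1/2) *\<^sub>R p + (1/2) *\<^sub>R y))
       = (\<integral>y. indicator A ((1/2) *\<^sub>R p + (1/2) *\<^sub>R y) *\<^sub>R f ((1/2) *\<^sub>R p + (1/2) *\<^sub>R y) \<partial>lborel)"
      using cm fm by (intro integral_distr) simp_all
    finally show ?thesis .
  qed
  also have "\<dots> = (1/16) *\<^sub>R (\<integral>y. indicator T y *\<^sub>R f p + indicator T y *\<^sub>R f y \<partial>lborel)"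
  proof -
    have "indicator A ((1/2) *\<^sub>R p + (1/2) *\<^sub>R y) *\<^sub>R f ((1/2) *\<^sub>R p + (1/2) *\<^sub>R y)
       = (1/2) *\<^sub>R (indicator T y *\<^sub>R f p + indicator T y *\<^sub>R f y)" for y
      unfolding half using A_iff[of y] by (simp add: indicator_def)
    then show ?thesis by simp
  qed
  also have "(\<integral>y. indicator T y *\<^sub>R f p + indicator T y *\<^sub>R f y \<partial>lborel) = m *\<^sub>R f p + (\<integral>y. indicator T y *\<^sub>R f y \<partial>lborel)"
    using Bochner_Integration.integral_add[OF intT[OF continuous_on_const] intT[OF cf], of "f p"]
      in3 by (simp add: m_def)
  finally have e: "m *\<^sub>R f p = 16 *\<^sub>R (\<integral>x. indicator A x *\<^sub>R f x \<partial>lborel) - (\<integral>x. indicator T x *\<^sub>R f x \<partial>lborel)"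
    by simp
  define I where "I = (\<integral>x. indicator T x * norm (f x) \<partial>lborel)"
  define Q where "Q = (\<integral>x. indicator T x * (norm (f x))\<^sup>2 \<partial>lborel)"
  have cn: "continuous_on UNIV (\<lambda>x. norm (f x))" "continuous_on UNIV (\<lambda>x. (norm (f x))\<^sup>2)"
    using cf by (auto intro!: continuous_intros)
  note in1 = intT[OF cn(1), unfolded real_scaleR_def] and in2 = intT[OF cn(2), unfolded real_scaleR_def]
  have lin: "(\<integral>x. u x - c * v x + d * w x \<partial>lborel) = (\<integral>x. u x \<partial>lborel) - c * (\<integral>x. v x \<partial>lborel) + d * (\<integral>x. w x \<partial>lborel)"
    if "integrable lborel u" "integrable lborel v" "integrable lborel w" for u v w :: "real^3 \<Rightarrow> real" and c d
    using that by simp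
  have "norm (\<integral>x. indicator A x *\<^sub>R f x \<partial>lborel) \<le> (\<integral>x. norm (indicator A x *\<^sub>R f x) \<partial>lborel)" by (rule integral_norm_bound)
  also have "\<dots> \<le> I" unfolding I_def
    using AT by (intro integral_mono' in1) (auto simp: indicator_def)
  finally have 1: "norm (\<integral>x. indicator A x *\<^sub>R f x \<partial>lborel) \<le> I" .
  have "norm (\<integral>x. indicator T x *\<^sub>R f x \<partial>lborel) \<le> (\<integral>x. norm (indicator T x *\<^sub>R f x) \<partial>lborel)" by (rule integral_norm_bound)
  also have "\<dots> = I" unfolding I_def by simp
  finally have 2: "norm (\<integral>x. indicator T x *\<^sub>R f x \<partial>lborel) \<le> I" .
  have "m * norm (f p) = norm (m *\<^sub>R f p)" using m by simp
  also have "\<dots> \<le> 16 * norm (\<integral>x. indicator A x *\<^sub>R f x \<partial>lborel) + norm (\<integral>x. indicator T x *\<^sub>R f x \<partial>lborel)"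
    unfolding e by (rule order_trans[OF norm_triangle_ineq4]) simp
  \<comment> \<open>The coefficients 16 and 1 add up to 17, whose square is the 289 of the
    statement.\<close>
  finally have fp: "m * norm (f p) \<le> 17 * I" using 1 2 by linarith
  \<comment> \<open>Cauchy-Schwarz in the form of a nonnegative variance: \<open>I / m\<close> is
    the mean of the norm over \<open>T\<close>.\<close>
  have "0 \<le> (\<integral>x. indicator T x * (norm (f x) - I / m)\<^sup>2 \<partial>lborel)" by (intro integral_nonneg_AE AE_I2) simp
  also have "\<dots> = (\<integral>x. indicator T x * (norm (f x))\<^sup>2 - (2 * I / m) * (indicator T x * norm (f x)) + (I / m)\<^sup>2 * indicator T x \<partial>lborel)"
    by (intro Bochner_Integration.integral_cong refl) (simp add: power2_eq_square algebra_simps)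
  also have "\<dots> = Q - (2 * I / m) * I + (I / m)\<^sup>2 * m"
    using lin[OF in2 in1 in3, of "2 * I / m" "(I / m)\<^sup>2"] unfolding I_def[symmetric] Q_def[symmetric] by (simp add: m_def)
  also have "\<dots> = Q - I\<^sup>2 / m" using m by (simp add: power2_eq_square field_simps)
  finally have Q: "I\<^sup>2 \<le> m * Q" using m by (simp add: field_simps)
  have "m * (m * (norm (f p))\<^sup>2) = (m * norm (f p))\<^sup>2" by (simp add: power2_eq_square)
  also have "\<dots> \<le> (17 * I)\<^sup>2" using fp m by (intro power_mono) auto
  also have "\<dots> \<le> m * (289 * Q)" using Q by (simp add: power_mult_distrib)
  finally show ?thesis using m by (simp add: f_def m_def Q_def)
qed

end

section \<open>Tangential continuity across facets\<close>

lemma integral_Re_cmult: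
  assumes "integrable M k"
  shows "(\<integral>y. Re (c * k y) \<partial>M) = Re (c * (\<integral>y. k y \<partial>M))"
proof -
  have "integrable M (\<lambda>y. c * k y)" using assms by (intro integrable_mult_right)
  from integral_Re[OF this] show ?thesis by (simp only: integral_mult_right_zero)
qed

text \<open>Otherwise the real part of \<open>\<alpha>\<close> times the conjugate of
  \<open>\<alpha> x0\<close> is positive near \<open>x0\<close>. A bump confined to that region
  makes the integrand nonnegative, and positive on a nonempty open subset of the parameter triangle,
  so the integral cannot vanish.\<close>

lemma tri_bump_zero:
  fixes \<alpha> :: "real^3 \<Rightarrow> complex"
  assumes \<alpha>: "continuous_on UNIV \<alpha>" and st: "y0 \<in> ref_tri"
    and x0: "x0 = q0 + fst y0 *\<^sub>R (q1 - q0) + snd y0 *\<^sub>R (q2 - q0)" and r: "r > 0"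
    and z: "\<And>a b. cbox a b \<subseteq> ball x0 r \<Longrightarrow> tri_int q0 q1 q2 (\<lambda>x. bump 1 a b x *\<^sub>R \<alpha> x) = 0"
  shows "\<alpha> x0 = 0"
proof (rule ccontr)
  assume nz: "\<alpha> x0 \<noteq> 0"
  define h where "h x = Re (cnj (\<alpha> x0) * \<alpha> x)" for x
  have ch: "continuous_on UNIV h" unfolding h_def by (intro continuous_intros \<alpha>)
  have "h x0 = (norm (\<alpha> x0))\<^sup>2" unfolding h_def by (simp only: mult.commute[of "cnj _"] complex_norm_square[symmetric] Re_complex_of_real)
  then have h0: "h x0 > 0" using nz by simp
  have "open (ball x0 r \<inter> {x. 0 < h x})" using ch by (intro open_Int open_Collect_less open_ball continuous_intros)
  moreover have "x0 \<in> ball x0 r \<inter> {x. 0 < h x}" using h0 r by simp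
  ultimately obtain a b where ab: "cbox a b \<subseteq> ball x0 r \<inter> {x. 0 < h x}" "x0 \<in> box a b"
    by (rule open_contains_cbox)
  define X where "X y = q0 + fst y *\<^sub>R (q1 - q0) + snd y *\<^sub>R (q2 - q0)" for y :: "real \<times> real"
  have cX: "continuous_on UNIV X" unfolding X_def by (intro continuous_intros)
  define f where "f y = indicator ref_tri y *\<^sub>R (bump 1 a b (X y) * h (X y))" for y
  have cb: "continuous_on UNIV (bump 1 a b)" by (rule continuous_bump) simp
  have cba: "continuous_on UNIV (\<lambda>x. bump 1 a b x *\<^sub>R \<alpha> x)" by (intro continuous_intros cb \<alpha>)
  have fint: "integrable lborel f" unfolding f_def
    using open_ref_tri bounded_ref_tri
    by (intro integrable_bounded_continuous continuous_intros continuous_on_compose2[OF cb cX] continuous_on_compose2[OF ch cX]) auto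
  have fpos: "0 \<le> f y" for y
  proof (cases "X y \<in> box a b")
    case True
    then have "0 < h (X y)" using ab(1) box_subset_cbox[of a b] by blast
    then show ?thesis using bump_bounds(1)[of 1 a b "X y"] by (simp add: f_def)
  next
    case False
    then show ?thesis by (simp add: f_def bump_outside)
  qed
  have "integral\<^sup>L lborel f = (\<integral>y. Re (cnj (\<alpha> x0) * (indicator ref_tri y *\<^sub>R (bump 1 a b (X y) *\<^sub>R \<alpha> (X y)))) \<partial>lborel)"
    by (intro Bochner_Integration.integral_cong refl) (simp add: f_def h_def algebra_simps)
  also have "\<dots> = Re (cnj (\<alpha> x0) * (\<integral>y. indicator ref_tri y *\<^sub>R (bump 1 a b (X y) *\<^sub>R \<alpha> (X y)) \<partial>lborel))"
    by (rule integral_Re_cmult) (use tri_int_integrable[OF cba, of q0 q1 q2] in \<open>simp only: X_def\<close>)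
  also have "\<dots> = 0" using z[of a b] ab(1) by (simp add: tri_int_def X_def)
  finally have "AE y in lborel. f y = 0"
    using integral_nonneg_eq_0_iff_AE[OF fint] fpos by simp
  define W where "W = ref_tri \<inter> X -` box a b"
  have oW: "open W" unfolding W_def using open_ref_tri cX by (intro open_Int open_vimage open_box)
  have "AE y in lborel. y \<notin> W"
    using \<open>AE y in lborel. f y = 0\<close>
  proof eventually_elim
    case (elim y)
    have "f y > 0" if "y \<in> W"
    proof -
      have y: "y \<in> ref_tri" "X y \<in> box a b" using that by (simp_all add: W_def)
      then have "0 < h (X y)" using ab(1) box_subset_cbox[of a b] by blast
      then show ?thesis using y bump_pos[OF y(2)] by (simp add: f_def)
    qed
    then show ?case using elim by force
  qed
  then have "W \<in> null_sets lborel" using oW by (subst AE_iff_null_sets) simp_all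
  then have "W \<in> null_sets lebesgue" by (rule null_sets_completionI)
  then have "negligible W" by (simp add: negligible_iff_null_sets)
  moreover have "y0 \<in> W" using st ab(2) x0 by (simp add: W_def X_def)
  ultimately show False using open_not_negligible[OF oW] by blast
qed

lemma ned_sum: "(\<Sum>i\<in>I. k i *\<^sub>R ned (A i) (B i) x) = ned (\<Sum>i\<in>I. k i *\<^sub>R A i) (\<Sum>i\<in>I. k i *\<^sub>R B i) x"
proof -
  have L: "linear (\<lambda>c. ccross c (cvec x))" using bilinear_ccross by (simp add: bilinear_def)
  show ?thesis
    by (simp add: ned_def linear_sum[OF L] linear_scale[OF L] scaleR_add_right sum.distrib)
qed

lemma tri_int_scale: "tri_int q0 q1 q2 (\<lambda>x. c *\<^sub>R f x) = c *\<^sub>R tri_int q0 q1 q2 f"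
  unfolding tri_int_def by (simp only: scaleR_left_commute[of _ c] integral_scaleR_right)

text \<open>By \<open>rdot_ccross\<close> this is the pairing of \<open>cross3 a b\<close> with the
  cross product of \<open>M\<close> and \<open>W\<close>. The expanded form shows that only
  components of \<open>M\<close> along \<open>a\<close> and \<open>b\<close> enter.\<close>

definition tang :: "real^3 \<Rightarrow> real^3 \<Rightarrow> complex^3 \<Rightarrow> complex^3 \<Rightarrow> complex" where
  "tang a b M W = rdot a M * rdot b W - rdot b M * rdot a W"

text \<open>All elements at one facet have parallel normals there, so their contributions merge into
  one functional of a single combined Nedelec field. On an interior facet this combination plays the
  role of the jump.\<close>

lemma facet_functional:
  assumes F: "F = {q0, q1, q2}" "card F = 3" and I: "finite I" and W: "continuous_on UNIV W"
    and \<nu>: "\<And>i. i \<in> I \<Longrightarrow> \<nu> i = \<tau> i *\<^sub>R cross3 (q1 - q0) (q2 - q0)"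
  shows "(\<Sum>i\<in>I. c i *\<^sub>R face_int F (\<lambda>x. rdot (\<nu> i) (ccross (ned (A i) (B i) x) (W x))))
    = tri_int q0 q1 q2 (\<lambda>x. tang (q1 - q0) (q2 - q0)
        (ned (\<Sum>i\<in>I. (c i * \<tau> i) *\<^sub>R A i) (\<Sum>i\<in>I. (c i * \<tau> i) *\<^sub>R B i) x) (W x))"
proof -
  let ?a = "q1 - q0" and ?b = "q2 - q0"
  have cont: "continuous_on UNIV (\<lambda>x. rdot v (ccross (ned A B x) (W x)))" for v A B
    by (intro continuous_on_linear_fun[OF linear_rdot_right] continuous_on_ccross continuous_ned W)
  have "(\<Sum>i\<in>I. c i *\<^sub>R face_int F (\<lambda>x. rdot (\<nu> i) (ccross (ned (A i) (B i) x) (W x))))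
      = (\<Sum>i\<in>I. tri_int q0 q1 q2 (\<lambda>x. c i *\<^sub>R rdot (\<nu> i) (ccross (ned (A i) (B i) x) (W x))))"
    by (intro sum.cong refl) (simp add: face_int_eq[OF F cont] tri_int_scale)
  also have "\<dots> = tri_int q0 q1 q2 (\<lambda>x. \<Sum>i\<in>I. c i *\<^sub>R rdot (\<nu> i) (ccross (ned (A i) (B i) x) (W x)))"
    using I cont by (intro tri_int_linear_sum[symmetric] continuous_intros)
  also have "(\<lambda>x. \<Sum>i\<in>I. c i *\<^sub>R rdot (\<nu> i) (ccross (ned (A i) (B i) x) (W x)))
      = (\<lambda>x. tang ?a ?b (ned (\<Sum>i\<in>I. (c i * \<tau> i) *\<^sub>R A i) (\<Sum>i\<in>I. (c i * \<tau> i) *\<^sub>R B i) x) (W x))"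
  proof
    fix x
    have "(\<Sum>i\<in>I. c i *\<^sub>R rdot (\<nu> i) (ccross (ned (A i) (B i) x) (W x)))
       = (\<Sum>i\<in>I. (c i * \<tau> i) *\<^sub>R tang ?a ?b (ned (A i) (B i) x) (W x))"
      using \<nu> by (intro sum.cong refl) (simp add: linear_scale[OF linear_rdot_left] rdot_ccross tang_def)
    also have "\<dots> = tang ?a ?b (\<Sum>i\<in>I. (c i * \<tau> i) *\<^sub>R ned (A i) (B i) x) (W x)"
      by (simp add: tang_def linear_sum[OF linear_rdot_right] linear_scale[OF linear_rdot_right]
          sum_distrib_right scaleR_diff_right sum_subtractf)
    finally show "(\<Sum>i\<in>I. c i *\<^sub>R rdot (\<nu> i) (ccross (ned (A i) (B i) x) (W x)))
       = tang ?a ?b (ned (\<Sum>i\<in>I. (c i * \<tau> i) *\<^sub>R A i) (\<Sum>i\<in>I. (c i * \<tau> i) *\<^sub>R B i) x) (W x)"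
      by (simp only: ned_sum)
  qed
  finally show ?thesis .
qed

lemma tangential_iff_dofs:
  assumes F: "F = {q0, q1, q2}"
  shows "(\<forall>u\<in>F. rdot (q1 - q0) (M u) = 0 \<and> rdot (q2 - q0) (M u) = 0) \<longleftrightarrow> (\<forall>u\<in>F. \<forall>v\<in>F. rdot (v - u) (M u) = 0)"
  unfolding F by (auto simp: linear_diff[OF linear_rdot_left])

lemma affine_vanishes:
  fixes \<alpha>0 \<alpha>1 \<alpha>2 :: complex
  assumes "\<And>y. y \<in> ref_tri \<Longrightarrow> (1 - fst y - snd y) *\<^sub>R \<alpha>0 + fst y *\<^sub>R \<alpha>1 + snd y *\<^sub>R \<alpha>2 = 0"
  shows "\<alpha>0 = 0" "\<alpha>1 = 0" "\<alpha>2 = 0"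
proof -
  have e: "(1/4, 1/4) \<in> ref_tri" "(1/2, 1/4) \<in> ref_tri" "(1/4, 1/2) \<in> ref_tri" by (simp_all add: ref_tri_def)
  have "2 * \<alpha>0 + \<alpha>1 + \<alpha>2 = 0" "\<alpha>0 + 2 * \<alpha>1 + \<alpha>2 = 0" "\<alpha>0 + \<alpha>1 + 2 * \<alpha>2 = 0"
    using assms[OF e(1)] assms[OF e(2)] assms[OF e(3)] by (simp_all add: complex_eq_iff field_simps)
  then show "\<alpha>0 = 0" "\<alpha>1 = 0" "\<alpha>2 = 0" by algebra+
qed

lemma rdot_cvec: "rdot v (cvec w) = complex_of_real (v \<bullet> w)"
  by (simp add: rdot_3 cvec_def inner_3 scaleR_conv_of_real)

text \<open>Bumps with a fixed direction, concentrated near a point of the open triangle, show that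
  each tangential component vanishes at that point. These components are affine on the triangle, so
  they vanish at the vertices as well. The radius may depend on the point, which lets the test
  fields avoid all other facets.\<close>

lemma dofs_of_local_vanishing:
  assumes F: "F = {q0, q1, q2}" and ind: "cross3 (q1 - q0) (q2 - q0) \<noteq> 0"
    and loc: "\<And>y. y \<in> ref_tri \<Longrightarrow> \<exists>r>0. \<forall>V. smooth_field V \<longrightarrow>
        (\<forall>x. x \<notin> ball (q0 + fst y *\<^sub>R (q1 - q0) + snd y *\<^sub>R (q2 - q0)) r \<longrightarrow> V x = 0) \<longrightarrow>
        tri_int q0 q1 q2 (\<lambda>x. tang (q1 - q0) (q2 - q0) (ned A B x) (vcnj (V x))) = 0"
  shows "\<forall>u\<in>F. \<forall>v\<in>F. rdot (v - u) (ned A B u) = 0"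
proof -
  let ?a = "q1 - q0" and ?b = "q2 - q0"
  define n where "n = cross3 ?a ?b"
  \<comment> \<open>Here \<open>v\<close> is a direction for which the facet functional reduces to
    \<open>k\<close> times the single component of the field along \<open>e\<close>.\<close>
  have pt: "rdot e (ned A B (q0 + fst y *\<^sub>R ?a + snd y *\<^sub>R ?b)) = 0" if y: "y \<in> ref_tri"
    and v: "\<And>M W. W = cvec v \<Longrightarrow> tang ?a ?b M W = k * rdot e M" and k: "k \<noteq> 0" for y e v k
  proof -
    define x0 where "x0 = q0 + fst y *\<^sub>R ?a + snd y *\<^sub>R ?b"
    obtain r where r: "r > 0" and rV: "\<And>V. smooth_field V \<Longrightarrow> (\<And>x. x \<notin> ball x0 r \<Longrightarrow> V x = 0) \<Longrightarrow>
        tri_int q0 q1 q2 (\<lambda>x. tang ?a ?b (ned A B x) (vcnj (V x))) = 0"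
      using loc[OF y] unfolding x0_def by blast
    have "k * rdot e (ned A B x0) = 0"
    proof (rule tri_bump_zero[OF _ y x0_def r])
      show "continuous_on UNIV (\<lambda>x. k * rdot e (ned A B x))"
        by (intro continuous_intros continuous_on_linear_fun[OF linear_rdot_right] continuous_ned)
      fix a b :: "real^3" assume ab: "cbox a b \<subseteq> ball x0 r"
      define V where "V = (\<lambda>x. bump 1 a b x *\<^sub>R cvec v)"
      have "smooth_field V" unfolding V_def by (rule smooth_field_bump) simp
      moreover have "V x = 0" if "x \<notin> ball x0 r" for x
      proof -
        have "x \<notin> box a b" using that ab box_subset_cbox[of a b] by blast
        then show ?thesis by (simp add: V_def bump_outside)
      qed
      ultimately have "tri_int q0 q1 q2 (\<lambda>x. tang ?a ?b (ned A B x) (vcnj (V x))) = 0" by (rule rV)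
      moreover have "tang ?a ?b M (vcnj (V x)) = bump 1 a b x *\<^sub>R (k * rdot e M)" for x M
      proof -
        have "vcnj (cvec v) = cvec v" by (simp add: vcnj_def cvec_def)
        then have "vcnj (V x) = bump 1 a b x *\<^sub>R cvec v" by (simp add: V_def linear_scale[OF linear_vcnj])
        then have "tang ?a ?b M (vcnj (V x)) = bump 1 a b x *\<^sub>R tang ?a ?b M (cvec v)"
          by (simp add: tang_def linear_scale[OF linear_rdot_right] scaleR_diff_right)
        then show ?thesis by (simp add: v)
      qed
      ultimately show "tri_int q0 q1 q2 (\<lambda>x. bump 1 a b x *\<^sub>R (k * rdot e (ned A B x))) = 0" by simp
    qed
    then show ?thesis using k by (simp add: x0_def)
  qed
  have nn: "n \<bullet> n \<noteq> 0" using ind by (simp add: n_def)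
  \<comment> \<open>The directions \<open>cross3 n ?a\<close> and \<open>cross3 n ?b\<close> lie in
    the facet plane and are orthogonal to one edge vector each, so each of them removes one of the
    two terms of \<open>tang\<close>.\<close>
  have i1: "?a \<bullet> cross3 n ?a = 0" "?b \<bullet> cross3 n ?a = n \<bullet> n" "?b \<bullet> cross3 n ?b = 0" "?a \<bullet> cross3 n ?b = - (n \<bullet> n)"
    unfolding n_def by (simp_all add: inner_3 cross3_nth algebra_simps)
  have ta: "rdot ?a (ned A B (q0 + fst y *\<^sub>R ?a + snd y *\<^sub>R ?b)) = 0" if "y \<in> ref_tri" for y
    by (rule pt[OF that, of "cross3 n ?a" "complex_of_real (n \<bullet> n)"]) (use nn in \<open>simp_all add: tang_def rdot_cvec i1 mult.commute\<close>)
  have tb: "rdot ?b (ned A B (q0 + fst y *\<^sub>R ?a + snd y *\<^sub>R ?b)) = 0" if "y \<in> ref_tri" for y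
    by (rule pt[OF that, of "cross3 n ?b" "complex_of_real (n \<bullet> n)"]) (use nn in \<open>simp_all add: tang_def rdot_cvec i1 mult.commute\<close>)
  have ex: "rdot e (ned A B (q0 + fst y *\<^sub>R ?a + snd y *\<^sub>R ?b)) =
     (1 - fst y - snd y) *\<^sub>R rdot e (ned A B q0) + fst y *\<^sub>R rdot e (ned A B q1) + snd y *\<^sub>R rdot e (ned A B q2)" for e y
    unfolding ned_tri by (simp add: linear_add[OF linear_rdot_right] linear_scale[OF linear_rdot_right])
  have "rdot ?a (ned A B q0) = 0" "rdot ?a (ned A B q1) = 0" "rdot ?a (ned A B q2) = 0"
    using affine_vanishes[of "rdot ?a (ned A B q0)" "rdot ?a (ned A B q1)" "rdot ?a (ned A B q2)"] ta unfolding ex by blast+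
  moreover have "rdot ?b (ned A B q0) = 0" "rdot ?b (ned A B q1) = 0" "rdot ?b (ned A B q2) = 0"
    using affine_vanishes[of "rdot ?b (ned A B q0)" "rdot ?b (ned A B q1)" "rdot ?b (ned A B q2)"] tb unfolding ex by blast+
  ultimately show ?thesis
    by (intro tangential_iff_dofs[OF F, of "ned A B", THEN iffD1]) (simp add: F)
qed

lemma tang_zero_of_dofs:
  assumes F: "F = {q0, q1, q2}" and d: "\<forall>u\<in>F. \<forall>v\<in>F. rdot (v - u) (ned A B u) = 0"
  shows "tri_int q0 q1 q2 (\<lambda>x. tang (q1 - q0) (q2 - q0) (ned A B x) (W x)) = 0"
proof -
  have d': "rdot (q1 - q0) (ned A B u) = 0" "rdot (q2 - q0) (ned A B u) = 0" if "u \<in> {q0, q1, q2}" for u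
    using that tangential_iff_dofs[OF F, of "ned A B", THEN iffD2, OF d] unfolding F by auto
  have "tang (q1 - q0) (q2 - q0) (ned A B (q0 + s *\<^sub>R (q1 - q0) + t *\<^sub>R (q2 - q0))) W = 0" for s t W
    unfolding ned_tri tang_def
    by (simp add: linear_add[OF linear_rdot_right] linear_scale[OF linear_rdot_right] d')
  then show ?thesis by (simp add: tri_int_def)
qed

lemma (in tetrahedron) facet_normal_parallel:
  assumes p: "p \<in> P" and F: "P - {p} = {q0, q1, q2}" "card (P - {p}) = 3"
  shows "\<exists>\<tau>. g p = \<tau> *\<^sub>R cross3 (q1 - q0) (q2 - q0)" "cross3 (q1 - q0) (q2 - q0) \<noteq> 0"
proof -
  define D where "D = triple (q1 - q0) (q2 - q0) (p - q0)"
  have D: "D \<noteq> 0" and gp: "D *\<^sub>R g p = cross3 (q1 - q0) (q2 - q0)"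
    unfolding D_def using facet_normal[OF p F] by simp_all
  then have "g p = (1 / D) *\<^sub>R cross3 (q1 - q0) (q2 - q0)" by (simp flip: gp)
  then show "\<exists>\<tau>. g p = \<tau> *\<^sub>R cross3 (q1 - q0) (q2 - q0)" by blast
  have "q0 \<in> P" "q0 \<noteq> p" using F(1) by blast+
  then have "g p \<bullet> (p - q0) = 1" using p by (simp add: g_diff)
  then have "g p \<noteq> 0" by auto
  then show "cross3 (q1 - q0) (q2 - q0) \<noteq> 0" using gp D by auto
qed

lemma tri_point_mem_hull:
  assumes "y \<in> ref_tri" shows "q0 + fst y *\<^sub>R (q1 - q0) + snd y *\<^sub>R (q2 - q0) \<in> convex hull {q0, q1, q2}"
proof -
  have "q0 + fst y *\<^sub>R (q1 - q0) + snd y *\<^sub>R (q2 - q0) = (1 - fst y - snd y) *\<^sub>R q0 + fst y *\<^sub>R q1 + snd y *\<^sub>R q2"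
    by (simp add: algebra_simps)
  moreover have "0 \<le> 1 - fst y - snd y" "0 \<le> fst y" "0 \<le> snd y" using assms by (auto simp: ref_tri_def)
  ultimately show ?thesis unfolding convex_hull_3 by force
qed

lemma tri_point_rel_interior:
  assumes y: "y \<in> ref_tri" and card: "card {q0, q1, q2} = 3" and ind: "\<not> affine_dependent {q0, q1, q2 :: real^3}"
  shows "q0 + fst y *\<^sub>R (q1 - q0) + snd y *\<^sub>R (q2 - q0) \<in> rel_interior (convex hull {q0, q1, q2})"
proof -
  have ne: "q0 \<noteq> q1" "q0 \<noteq> q2" "q1 \<noteq> q2" using card by (auto simp: card_insert_if split: if_splits)
  define u where "u q = (if q = q0 then 1 - fst y - snd y else if q = q1 then fst y else snd y)" for q
  have u: "u q0 = 1 - fst y - snd y" "u q1 = fst y" "u q2 = snd y" using ne by (auto simp: u_def)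
  have "\<forall>q\<in>{q0, q1, q2}. 0 < u q" using y by (auto simp: u ref_tri_def)
  moreover have "sum u {q0, q1, q2} = 1" using ne by (simp add: u)
  moreover have "(\<Sum>q\<in>{q0, q1, q2}. u q *\<^sub>R q) = q0 + fst y *\<^sub>R (q1 - q0) + snd y *\<^sub>R (q2 - q0)"
    using ne by (simp add: u algebra_simps)
  ultimately show ?thesis unfolding rel_interior_convex_hull_explicit[OF ind] by blast
qed

section \<open>Families of tetrahedra meeting along common faces\<close>

locale tet_family =
  fixes \<T> :: "(real^3) set set" and vert :: "(real^3) set \<Rightarrow> (real^3) set"
    and gr :: "(real^3) set \<Rightarrow> real^3 \<Rightarrow> real^3" and off :: "(real^3) set \<Rightarrow> real^3 \<Rightarrow> real"
  assumes finite_family: "finite \<T>"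
    and tet: "\<And>T. T \<in> \<T> \<Longrightarrow> tetrahedron (vert T) (gr T) (off T)"
    and T_eq: "\<And>T. T \<in> \<T> \<Longrightarrow> tetrahedron.T (vert T) (gr T) (off T) = T"
    and faces: "\<And>T T'. T \<in> \<T> \<Longrightarrow> T' \<in> \<T> \<Longrightarrow> convex hull vert T \<inter> convex hull vert T' face_of convex hull vert T"
begin

text \<open>The intersection of the two elements is a face of the first that meets the relative
  interior of its facet, hence contains the facet. The vertices of the facet are extreme in the
  first element, thus in the common face and in the second element. The coordinate of
  \<open>p'\<close> is nonnegative at these vertices and vanishes at a strictly positive combination
  of them, so it vanishes at each, and counting vertices gives equality.\<close>

lemma facet_unique:
  assumes T: "T \<in> \<T>" "p \<in> vert T" and T': "T' \<in> \<T>" "p' \<in> vert T'"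
    and F: "vert T - {p} = {q0, q1, q2}" and y: "y \<in> ref_tri"
    and x: "q0 + fst y *\<^sub>R (q1 - q0) + snd y *\<^sub>R (q2 - q0) \<in> convex hull (vert T' - {p'})"
  shows "vert T' - {p'} = vert T - {p}"
proof -
  interpret t: tetrahedron "vert T" "gr T" "off T" using T(1) by (rule tet)
  interpret t': tetrahedron "vert T'" "gr T'" "off T'" using T'(1) by (rule tet)
  let ?x = "q0 + fst y *\<^sub>R (q1 - q0) + snd y *\<^sub>R (q2 - q0)"
  have cF: "card {q0, q1, q2} = 3" using t.card_P T(2) by (simp flip: F)
  have sub: "{q0, q1, q2} \<subseteq> vert T" using F by blast
  have xr: "?x \<in> rel_interior (convex hull {q0, q1, q2})"
    using y cF affine_independent_subset[OF t.indep sub] by (rule tri_point_rel_interior)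
  let ?K = "convex hull vert T \<inter> convex hull vert T'"
  have K: "?K face_of convex hull vert T" using faces[OF T(1) T'(1)] .
  have K': "?K face_of convex hull vert T'" using faces[OF T'(1) T(1)] by (simp add: Int_commute)
  have hs: "convex hull {q0, q1, q2} \<subseteq> convex hull vert T" using sub by (rule hull_mono)
  have xT': "?x \<in> convex hull vert T'" using x hull_mono[of "vert T' - {p'}" "vert T'"] by blast
  have "?x \<in> ?K" using xT' hs xr rel_interior_subset by blast
  then have "?K \<inter> rel_interior (convex hull {q0, q1, q2}) \<noteq> {}" using xr by blast
  then have hK: "convex hull {q0, q1, q2} \<subseteq> ?K" using subset_of_face_of[OF K hs] by blast
  have q_in: "q \<in> vert T' \<and> t'.lam p' q = 0" if q: "q \<in> {q0, q1, q2}" for q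
  proof
    have "q \<in> convex hull {q0, q1, q2}" using q by (rule hull_inc)
    then have qK: "q \<in> ?K" using hK by blast
    have "q extreme_point_of (convex hull vert T)"
      using extreme_point_of_convex_hull_affine_independent[OF t.indep] sub q by blast
    then have qf: "{q} face_of (convex hull vert T)" by (simp only: face_of_singleton)
    have "{q} face_of ?K"
    proof (rule face_of_subset[OF qf])
      show "{q} \<subseteq> ?K" using qK by blast
      show "?K \<subseteq> convex hull vert T" by blast
    qed
    then have "{q} face_of (convex hull vert T')" using K' by (rule face_of_trans)
    then have "q extreme_point_of (convex hull vert T')" by (simp only: face_of_singleton)
    then show "q \<in> vert T'" by (rule extreme_point_of_convex_hull)
    have pos: "0 \<le> t'.lam p' u" if "u \<in> {q0, q1, q2}" for u
    proof -
      have "u \<in> convex hull {q0, q1, q2}" using that by (rule hull_inc)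
      then have "u \<in> convex hull vert T'" using hK by blast
      then show ?thesis using T'(2) by (simp add: t'.convex_hull_eq)
    qed
    have x0: "t'.lam p' ?x = 0"
    proof -
      have "vert T' - {p'} \<subseteq> {z. t'.lam p' z = 0}" using T'(2) by (auto simp: t'.lam_vertex)
      moreover have "convex {z. t'.lam p' z = 0}"
      proof -
        have "{z. t'.lam p' z = 0} = {z. gr T' p' \<bullet> z = - off T' p'}" by (auto simp: t'.lam_def)
        then show ?thesis by (simp add: convex_hyperplane)
      qed
      ultimately have "convex hull (vert T' - {p'}) \<subseteq> {z. t'.lam p' z = 0}" by (rule hull_minimal)
      then show ?thesis using x by blast
    qed
    have lx: "t'.lam p' ?x = (1 - fst y - snd y) * t'.lam p' q0 + fst y * t'.lam p' q1 + snd y * t'.lam p' q2"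
      by (simp add: t'.lam_def inner_add_right inner_diff_right algebra_simps)
    have w: "0 < 1 - fst y - snd y" "0 < fst y" "0 < snd y" using y by (auto simp: ref_tri_def)
    have three: "\<alpha> = 0 \<and> \<beta> = 0 \<and> \<gamma> = 0" if "a * \<alpha> + b * \<beta> + c * \<gamma> = 0" "0 < a" "0 < b" "0 < c"
      "0 \<le> \<alpha>" "0 \<le> \<beta>" "0 \<le> \<gamma>" for a b c \<alpha> \<beta> \<gamma> :: real
    proof -
      have "0 \<le> a * \<alpha>" "0 \<le> b * \<beta>" "0 \<le> c * \<gamma>" using that by simp_all
      then have "a * \<alpha> = 0" "b * \<beta> = 0" "c * \<gamma> = 0" using that(1) by linarith+
      then show ?thesis using that by simp
    qed
    have "t'.lam p' q0 = 0 \<and> t'.lam p' q1 = 0 \<and> t'.lam p' q2 = 0"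
      by (rule three[OF trans[OF lx[symmetric] x0] w pos pos pos]) simp_all
    then show "t'.lam p' q = 0" using q by blast
  qed
  have "{q0, q1, q2} \<subseteq> vert T' - {p'}"
  proof
    fix q assume "q \<in> {q0, q1, q2}"
    from q_in[OF this] show "q \<in> vert T' - {p'}" using t'.lam_vertex[OF T'(2) T'(2)] by auto
  qed
  moreover have "card (vert T' - {p'}) = 3" using t'.card_P T'(2) by simp
  moreover have "finite (vert T' - {p'})" using t'.finite_P by simp
  ultimately have "{q0, q1, q2} = vert T' - {p'}" using cF by (intro card_subset_eq) simp_all
  then show ?thesis using F by simp
qed

abbreviation fc :: "(real^3) set \<Rightarrow> real" where
  "fc T \<equiv> tetrahedron.face_const (vert T) (gr T) (off T)"

text \<open>A flag is a facet seen from one element and named by the opposite vertex. A facet shared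
  by two elements occurs in two flags with the same remaining vertex set.\<close>

definition flags :: "((real^3) set \<times> (real^3)) set" where
  "flags = Sigma \<T> vert"

lemma finite_flags: "finite flags"
proof -
  have "finite (vert T)" if "T \<in> \<T>" for T
  proof -
    interpret tetrahedron "vert T" "gr T" "off T" using that by (rule tet)
    show ?thesis by (rule finite_P)
  qed
  then show ?thesis unfolding flags_def using finite_family by (intro finite_SigmaI)
qed

definition facet_term :: "((real^3) set \<Rightarrow> complex^3) \<Rightarrow> ((real^3) set \<Rightarrow> complex^3) \<Rightarrow> vfield \<Rightarrow> (real^3) set \<times> (real^3) \<Rightarrow> complex" where
  "facet_term A B V i = fc (fst i) *\<^sub>R face_int (vert (fst i) - {snd i})
     (\<lambda>x. rdot (gr (fst i) (snd i)) (ccross (ned (A (fst i)) (B (fst i)) x) (vcnj (V x))))"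

lemma green_sum:
  assumes V: "smooth_field V"
  shows "(\<Sum>T\<in>\<T>. \<integral>x. indicator T x *\<^sub>R green (2 *\<^sub>R B T) (ned (A T) (B T)) V x \<partial>lborel)
     = - (\<Sum>i\<in>flags. facet_term A B V i)"
proof -
  have "(\<integral>x. indicator T x *\<^sub>R green (2 *\<^sub>R B T) (ned (A T) (B T)) V x \<partial>lborel)
     = - (\<Sum>q\<in>vert T. facet_term A B V (T, q))" if "T \<in> \<T>" for T
  proof -
    interpret tetrahedron "vert T" "gr T" "off T" using that by (rule tet)
    show ?thesis using green_formula[OF V, of "B T" "A T"] T_eq[OF that]
      by (simp add: facet_term_def scaleR_sum_right)
  qed
  then have "(\<Sum>T\<in>\<T>. \<integral>x. indicator T x *\<^sub>R green (2 *\<^sub>R B T) (ned (A T) (B T)) V x \<partial>lborel)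
      = (\<Sum>T\<in>\<T>. - (\<Sum>q\<in>vert T. facet_term A B V (T, q)))" by (intro sum.cong refl)
  also have "\<dots> = - (\<Sum>i\<in>flags. facet_term A B V i)"
  proof -
    have "(\<Sum>T\<in>\<T>. \<Sum>q\<in>vert T. facet_term A B V (T, q)) = (\<Sum>(T, q)\<in>Sigma \<T> vert. facet_term A B V (T, q))"
      using tetrahedron.finite_P[OF tet] by (intro sum.Sigma finite_family) simp
    then show ?thesis by (simp add: sum_negf flags_def)
  qed
  finally show ?thesis .
qed

text \<open>The order of the quantifiers matters: the weights \<open>k\<close>, each a Jacobian
  times a normal factor, are chosen before the coefficients and the test field. One relation thus
  applies both to the given field and to the field with scaled edge values.\<close>

lemma facet_sum_eq:
  assumes F: "F = {q0, q1, q2}" "card F = 3"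
  shows "\<exists>k. \<forall>A B V. smooth_field V \<longrightarrow> (\<Sum>i | i \<in> flags \<and> vert (fst i) - {snd i} = F. facet_term A B V i)
    = tri_int q0 q1 q2 (\<lambda>x. tang (q1 - q0) (q2 - q0)
       (ned (\<Sum>i | i \<in> flags \<and> vert (fst i) - {snd i} = F. k i *\<^sub>R A (fst i))
            (\<Sum>i | i \<in> flags \<and> vert (fst i) - {snd i} = F. k i *\<^sub>R B (fst i)) x) (vcnj (V x)))"
proof -
  let ?I = "{i. i \<in> flags \<and> vert (fst i) - {snd i} = F}"
  have "\<forall>i\<in>?I. \<exists>\<tau>. gr (fst i) (snd i) = \<tau> *\<^sub>R cross3 (q1 - q0) (q2 - q0)"
  proof
    fix i assume that: "i \<in> ?I"
    have i: "fst i \<in> \<T>" "snd i \<in> vert (fst i)" "vert (fst i) - {snd i} = F"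
      using that by (auto simp: flags_def)
    interpret tetrahedron "vert (fst i)" "gr (fst i)" "off (fst i)" using i(1) by (rule tet)
    show "\<exists>\<tau>. gr (fst i) (snd i) = \<tau> *\<^sub>R cross3 (q1 - q0) (q2 - q0)" by (rule facet_normal_parallel(1)[OF i(2) trans[OF i(3) F(1)]]) (simp only: i(3) F(2))
  qed
  then have "\<exists>\<tau>. \<forall>i\<in>?I. gr (fst i) (snd i) = \<tau> i *\<^sub>R cross3 (q1 - q0) (q2 - q0)" by (rule bchoice)
  then obtain \<tau> where \<tau>: "\<And>i. i \<in> ?I \<Longrightarrow> gr (fst i) (snd i) = \<tau> i *\<^sub>R cross3 (q1 - q0) (q2 - q0)" by blast
  show ?thesis
  proof (intro exI allI impI)
    fix A B and V :: vfield assume V: "smooth_field V"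
    have "(\<Sum>i\<in>?I. facet_term A B V i) = (\<Sum>i\<in>?I. fc (fst i) *\<^sub>R face_int F
       (\<lambda>x. rdot (gr (fst i) (snd i)) (ccross (ned (A (fst i)) (B (fst i)) x) (vcnj (V x)))))"
      by (intro sum.cong refl) (simp add: facet_term_def)
    also have "\<dots> = tri_int q0 q1 q2 (\<lambda>x. tang (q1 - q0) (q2 - q0)
       (ned (\<Sum>i\<in>?I. (fc (fst i) * \<tau> i) *\<^sub>R A (fst i)) (\<Sum>i\<in>?I. (fc (fst i) * \<tau> i) *\<^sub>R B (fst i)) x) (vcnj (V x)))"
      using finite_flags \<tau> smooth_field_continuous[OF V]
      by (intro facet_functional F continuous_on_linear_fun[OF linear_vcnj]) simp_all
    finally show "(\<Sum>i\<in>?I. facet_term A B V i) = tri_int q0 q1 q2 (\<lambda>x. tang (q1 - q0) (q2 - q0)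
       (ned (\<Sum>i\<in>?I. (fc (fst i) * \<tau> i) *\<^sub>R A (fst i)) (\<Sum>i\<in>?I. (fc (fst i) * \<tau> i) *\<^sub>R B (fst i)) x) (vcnj (V x)))" .
  qed
qed

lemma facet_term_local:
  assumes i: "i \<in> flags" and V: "\<And>x. x \<in> convex hull (vert (fst i) - {snd i}) \<Longrightarrow> V x = 0" and cV: "continuous_on UNIV V"
  shows "facet_term A B V i = 0"
proof -
  have i: "fst i \<in> \<T>" "snd i \<in> vert (fst i)" using i by (auto simp: flags_def)
  interpret tetrahedron "vert (fst i)" "gr (fst i)" "off (fst i)" using i(1) by (rule tet)
  obtain q0 q1 q2 where q: "vert (fst i) - {snd i} = {q0, q1, q2}" "card (vert (fst i) - {snd i}) = 3"
    using facet_vertices[OF i(2)] by metis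
  let ?f = "\<lambda>x. rdot (gr (fst i) (snd i)) (ccross (ned (A (fst i)) (B (fst i)) x) (vcnj (V x)))"
  have "continuous_on UNIV ?f"
    by (intro continuous_on_linear_fun[OF linear_rdot_right] continuous_on_ccross continuous_ned
        continuous_on_linear_fun[OF linear_vcnj cV])
  then have "face_int (vert (fst i) - {snd i}) ?f = tri_int q0 q1 q2 ?f" by (intro face_int_eq q)
  also have "\<dots> = 0"
  proof -
    have "indicator ref_tri y *\<^sub>R ?f (q0 + fst y *\<^sub>R (q1 - q0) + snd y *\<^sub>R (q2 - q0)) = 0" for y :: "real \<times> real"
    proof (cases "y \<in> ref_tri")
      case True
      have "V (q0 + fst y *\<^sub>R (q1 - q0) + snd y *\<^sub>R (q2 - q0)) = 0"
        using V tri_point_mem_hull[OF True] unfolding q(1) by blast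
      moreover have "vcnj 0 = 0" "ccross w 0 = 0" "rdot v 0 = 0" for w v
        by (simp_all add: vcnj_def vec_eq_iff forall_3 ccross_nth rdot_3)
      ultimately show ?thesis by simp
    qed simp
    then show ?thesis unfolding tri_int_def by (simp only: integral_zero)
  qed
  finally show ?thesis by (simp add: facet_term_def)
qed

text \<open>Localised test fields turn conformity into one equation per facet and edge, namely that
  the weighted edge values of the adjacent elements add up to zero. Since \<open>w u v\<close> does
  not depend on the element, the scaled values satisfy the same equations, and these make every
  facet sum vanish for every test field.\<close>

lemma scaled_dofs_conforming:
  assumes conf: "\<And>V. smooth_field V \<Longrightarrow> (\<Sum>T\<in>\<T>. \<integral>x. indicator T x *\<^sub>R green (2 *\<^sub>R B T) (ned (A T) (B T)) V x \<partial>lborel) = 0"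
    and dofs: "\<And>T u v. T \<in> \<T> \<Longrightarrow> u \<in> vert T \<Longrightarrow> v \<in> vert T \<Longrightarrow>
       rdot (v - u) (ned (A' T) (B' T) u) = w u v * rdot (v - u) (ned (A T) (B T) u)"
    and V: "smooth_field V"
  shows "(\<Sum>T\<in>\<T>. \<integral>x. indicator T x *\<^sub>R green (2 *\<^sub>R B' T) (ned (A' T) (B' T)) V x \<partial>lborel) = 0"
proof -
  define fac where "fac i = vert (fst i) - {snd i}" for i :: "(real^3) set \<times> (real^3)"
  have zero: "(\<Sum>i | i \<in> flags \<and> fac i = F. facet_term A' B' V i) = 0" if F_in: "F \<in> fac ` flags" for F
  proof -
    from F_in obtain i where i: "F = fac i" "i \<in> flags" by (rule imageE)
    define T p where "T = fst i" and "p = snd i"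
    have Tp: "T \<in> \<T>" "p \<in> vert T" "F = vert T - {p}" using i by (auto simp: fac_def flags_def T_def p_def)
    interpret tetrahedron "vert T" "gr T" "off T" using Tp(1) by (rule tet)
    obtain q0 q1 q2 where q: "vert T - {p} = {q0, q1, q2}" "card (vert T - {p}) = 3"
      using facet_vertices[OF Tp(2)] by metis
    have F: "F = {q0, q1, q2}" "card F = 3" using q Tp(3) by simp_all
    let ?I = "{i. i \<in> flags \<and> vert (fst i) - {snd i} = F}"
    obtain k where k: "\<And>A B V. smooth_field V \<Longrightarrow> (\<Sum>i\<in>?I. facet_term A B V i)
      = tri_int q0 q1 q2 (\<lambda>x. tang (q1 - q0) (q2 - q0)
       (ned (\<Sum>i\<in>?I. k i *\<^sub>R A (fst i)) (\<Sum>i\<in>?I. k i *\<^sub>R B (fst i)) x) (vcnj (V x)))"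
      using facet_sum_eq[OF F] by blast
    have "\<forall>u\<in>F. \<forall>v\<in>F. rdot (v - u) (ned (\<Sum>i\<in>?I. k i *\<^sub>R A (fst i)) (\<Sum>i\<in>?I. k i *\<^sub>R B (fst i)) u) = 0"
    proof (rule dofs_of_local_vanishing[OF F(1)])
      show "cross3 (q1 - q0) (q2 - q0) \<noteq> 0" using facet_normal_parallel(2)[OF Tp(2) q] .
      fix y assume y: "y \<in> ref_tri"
      let ?x = "q0 + fst y *\<^sub>R (q1 - q0) + snd y *\<^sub>R (q2 - q0)"
      \<comment> \<open>The union of all other facets is closed and misses the point, so test fields
        supported in a small ball see the facet \<open>F\<close> only.\<close>
      define C where "C = (\<Union>i\<in>{i\<in>flags. fac i \<noteq> F}. convex hull (fac i))"
      have "closed C" unfolding C_def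
      proof (rule closed_UN)
        show "finite {i \<in> flags. fac i \<noteq> F}" using finite_flags by simp
        show "\<forall>i\<in>{i \<in> flags. fac i \<noteq> F}. closed (convex hull (fac i))"
        proof
          fix i assume "i \<in> {i \<in> flags. fac i \<noteq> F}"
          then have "fst i \<in> \<T>" by (auto simp: flags_def)
          then have "finite (fac i)" unfolding fac_def using tetrahedron.finite_P[OF tet] by simp
          then show "closed (convex hull (fac i))" by (intro compact_imp_closed finite_imp_compact_convex_hull)
        qed
      qed
      moreover have "?x \<notin> C"
      proof
        assume "?x \<in> C"
        then obtain i where i: "i \<in> flags" "fac i \<noteq> F" "?x \<in> convex hull (fac i)"
          unfolding C_def by blast
        have i': "fst i \<in> \<T>" "snd i \<in> vert (fst i)" using i(1) by (auto simp: flags_def)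
        have "vert (fst i) - {snd i} = vert T - {p}"
          by (rule facet_unique[OF Tp(1,2) i' q(1) y]) (use i(3) in \<open>simp only: fac_def\<close>)
        then show False using i(2) Tp(3) by (simp add: fac_def)
      qed
      ultimately have "open (- C)" "?x \<in> - C" by (simp_all add: open_Compl)
      then obtain r where r: "r > 0" "ball ?x r \<subseteq> - C" unfolding open_contains_ball by blast
      show "\<exists>r>0. \<forall>V. smooth_field V \<longrightarrow> (\<forall>x. x \<notin> ball ?x r \<longrightarrow> V x = 0) \<longrightarrow>
        tri_int q0 q1 q2 (\<lambda>x. tang (q1 - q0) (q2 - q0)
          (ned (\<Sum>i\<in>?I. k i *\<^sub>R A (fst i)) (\<Sum>i\<in>?I. k i *\<^sub>R B (fst i)) x) (vcnj (V x))) = 0"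
      proof (intro exI[of _ r] conjI allI impI r(1))
        fix V :: vfield assume V: "smooth_field V" "\<forall>x. x \<notin> ball ?x r \<longrightarrow> V x = 0"
        have other: "facet_term A B V i = 0" if i: "i \<in> flags" "fac i \<noteq> F" for i
        proof (rule facet_term_local[OF i(1) _ smooth_field_continuous[OF V(1)]])
          fix x assume "x \<in> convex hull (vert (fst i) - {snd i})"
          then have "x \<in> convex hull (fac i)" by (simp only: fac_def)
          then have "x \<in> C" unfolding C_def using i by blast
          then show "V x = 0" using r(2) V(2) by blast
        qed
        have "0 = (\<Sum>i\<in>flags. facet_term A B V i)" using conf[OF V(1)] green_sum[OF V(1), of B A] by simp
        also have "\<dots> = (\<Sum>i\<in>?I. facet_term A B V i)"
          using finite_flags other by (intro sum.mono_neutral_right) (auto simp: fac_def)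
        finally show "tri_int q0 q1 q2 (\<lambda>x. tang (q1 - q0) (q2 - q0)
          (ned (\<Sum>i\<in>?I. k i *\<^sub>R A (fst i)) (\<Sum>i\<in>?I. k i *\<^sub>R B (fst i)) x) (vcnj (V x))) = 0"
          unfolding k[OF V(1)] by simp
      qed
    qed
    then have d: "(\<Sum>i\<in>?I. k i *\<^sub>R rdot (v - u) (ned (A (fst i)) (B (fst i)) u)) = 0" if "u \<in> F" "v \<in> F" for u v
      using that by (simp add: ned_sum[symmetric] linear_sum[OF linear_rdot_right] linear_scale[OF linear_rdot_right])
    have "\<forall>u\<in>F. \<forall>v\<in>F. rdot (v - u) (ned (\<Sum>i\<in>?I. k i *\<^sub>R A' (fst i)) (\<Sum>i\<in>?I. k i *\<^sub>R B' (fst i)) u) = 0"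
    proof (intro ballI)
      fix u v assume uv: "u \<in> F" "v \<in> F"
      have "rdot (v - u) (ned (\<Sum>i\<in>?I. k i *\<^sub>R A' (fst i)) (\<Sum>i\<in>?I. k i *\<^sub>R B' (fst i)) u)
          = (\<Sum>i\<in>?I. k i *\<^sub>R rdot (v - u) (ned (A' (fst i)) (B' (fst i)) u))"
        by (simp add: ned_sum[symmetric] linear_sum[OF linear_rdot_right] linear_scale[OF linear_rdot_right])
      \<comment> \<open>The common factor of the edge can be pulled out of the sum over the elements
        adjacent to the facet.\<close>
      also have "\<dots> = (\<Sum>i\<in>?I. w u v * (k i *\<^sub>R rdot (v - u) (ned (A (fst i)) (B (fst i)) u)))"
      proof (intro sum.cong refl)
        fix i assume "i \<in> ?I"
        then have "fst i \<in> \<T>" "u \<in> vert (fst i)" "v \<in> vert (fst i)" using uv by (auto simp: flags_def)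
        from dofs[OF this] show "k i *\<^sub>R rdot (v - u) (ned (A' (fst i)) (B' (fst i)) u)
          = w u v * (k i *\<^sub>R rdot (v - u) (ned (A (fst i)) (B (fst i)) u))" by simp
      qed
      also have "\<dots> = 0" unfolding sum_distrib_left[symmetric] d[OF uv] by simp
      finally show "rdot (v - u) (ned (\<Sum>i\<in>?I. k i *\<^sub>R A' (fst i)) (\<Sum>i\<in>?I. k i *\<^sub>R B' (fst i)) u) = 0" .
    qed
    from tang_zero_of_dofs[OF F(1) this] show ?thesis
      unfolding fac_def k[OF V] .
  qed
  have "(\<Sum>i\<in>flags. facet_term A' B' V i) = (\<Sum>F\<in>fac ` flags. \<Sum>i | i \<in> flags \<and> fac i = F. facet_term A' B' V i)"
    using finite_flags by (rule sum.image_gen)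
  also have "\<dots> = 0" using zero by simp
  finally show ?thesis using green_sum[OF V, of B' A'] by simp
qed

end

section \<open>Estimates and weak curls on one tetrahedron\<close>

context tetrahedron
begin

lemma lam_bounds:
  assumes "x \<in> T" "p \<in> P" shows "0 \<le> lam p x" "lam p x \<le> 1"
proof -
  have pos: "0 \<le> lam q x" if "q \<in> P" for q using assms(1) that by (simp add: T_def less_imp_le)
  show "0 \<le> lam p x" using pos assms(2) .
  have "lam p x \<le> (\<Sum>q\<in>P. lam q x)" using assms(2) finite_P pos by (intro member_le_sum) auto
  then show "lam p x \<le> 1" by (simp add: sum_lam)
qed

lemma norm_double_sum_le:
  fixes f :: "real^3 \<Rightarrow> real^3 \<Rightarrow> 'b::real_normed_vector"
  assumes "\<And>p q. p \<in> P \<Longrightarrow> q \<in> P \<Longrightarrow> norm (f p q) \<le> K"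
  shows "norm (\<Sum>p\<in>P. \<Sum>q\<in>P. f p q) \<le> 16 * K"
proof -
  have "norm (\<Sum>p\<in>P. \<Sum>q\<in>P. f p q) \<le> (\<Sum>p\<in>P. \<Sum>q\<in>P. K)"
    using assms by (intro sum_norm_le order_trans[OF norm_sum] sum_mono) auto
  then show ?thesis using card_P by simp
qed

text \<open>The constant 272 is 16 times 17: there are 16 ordered pairs of vertices, and 17 bounds
  the vertex values. A gradient costs \<open>\<gamma> ^ 3 / d\<close> and an edge value one factor
  \<open>d\<close>; two gradients and one edge value give \<open>\<gamma> ^ 6 / d\<close> for the
  curl, one gradient gives \<open>\<gamma> ^ 3\<close> for the field. The last clause keeps the
  support of the test field under control.\<close>

lemma interp_estimates:
  fixes d \<gamma> e \<delta> :: real and w :: "real^3 \<Rightarrow> real^3 \<Rightarrow> real" and a b :: "complex^3"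
  defines "Q \<equiv> (\<integral>x. indicator T x * (norm (ned a b x))\<^sup>2 \<partial>lborel)" and "m \<equiv> measure lborel T"
  assumes d: "\<And>u v. u \<in> P \<Longrightarrow> v \<in> P \<Longrightarrow> norm (u - v) \<le> d" "d > 0" and \<gamma>: "d ^ 3 \<le> \<gamma> ^ 3 * m" "\<gamma> > 0"
    and w: "\<And>p q. w p q = w q p" "\<And>p q. 0 \<le> w p q" "\<And>p q. w p q \<le> 1"
    and e: "\<And>p q. p \<in> P \<Longrightarrow> q \<in> P \<Longrightarrow> \<bar>w p q - e\<bar> \<le> \<delta>"
  shows "\<exists>a' b'. (\<forall>u\<in>P. \<forall>v\<in>P. rdot (v - u) (ned a' b' u) = complex_of_real (w u v) * rdot (v - u) (ned a b u))
     \<and> sqrt m * norm (2 *\<^sub>R b' - e *\<^sub>R (2 *\<^sub>R b)) \<le> 272 * \<gamma> ^ 6 * \<delta> / d * sqrt Q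
     \<and> (\<forall>x\<in>T. sqrt m * norm (ned a' b' x) \<le> 272 * \<gamma> ^ 3 * sqrt Q)
     \<and> ((\<forall>p\<in>P. \<forall>q\<in>P. w p q = 0) \<longrightarrow> a' = 0 \<and> b' = 0)"
proof -
  have m: "m > 0" unfolding m_def by (rule measure_T_pos)
  define dof where "dof p q = rdot (q - p) (ned a b p)" for p q
  define \<omega> where "\<omega> p q = complex_of_real (w p q) * dof p q" for p q
  have anti: "\<omega> q p = - \<omega> p q" for p q
    using w(1)[of p q] dof_antisym[of p q a b] by (simp add: \<omega>_def dof_def)
  have "\<exists>a'. interp \<omega> = ned a' ((1/2) *\<^sub>R interp_curl \<omega>)" by (rule interp_eq_ned) (rule anti)
  then obtain a' where a': "interp \<omega> = ned a' ((1/2) *\<^sub>R interp_curl \<omega>)" by blast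
  define b' where "b' = (1/2) *\<^sub>R interp_curl \<omega>"
  have diag: "\<omega> p p = 0" for p using linear_0[OF linear_rdot_left] by (simp add: \<omega>_def dof_def)
  have gb: "norm (g p) \<le> \<gamma> ^ 3 / d" if "p \<in> P" for p
  proof -
    have "norm (g p) * d ^ 3 \<le> norm (g p) * (\<gamma> ^ 3 * m)" using \<gamma> by (intro mult_left_mono) auto
    also have "\<dots> = \<gamma> ^ 3 * (norm (g p) * m)" by simp
    also have "\<dots> \<le> \<gamma> ^ 3 * d\<^sup>2" using norm_g_le[OF that d(1)] \<gamma>(2) unfolding m_def by (intro mult_left_mono) auto
    finally have "norm (g p) * d * d\<^sup>2 \<le> \<gamma> ^ 3 * d\<^sup>2" by (simp add: power3_eq_cube power2_eq_square mult.assoc)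
    then have "norm (g p) * d \<le> \<gamma> ^ 3" using d(2) by simp
    then show ?thesis using d(2) by (simp add: field_simps)
  qed
  have Np: "sqrt m * norm (ned a b p) \<le> 17 * sqrt Q" if "p \<in> P" for p
  proof -
    have "m * (norm (ned a b p))\<^sup>2 \<le> 289 * Q" unfolding m_def Q_def by (rule inverse_estimate[OF that])
    then have "sqrt (m * (norm (ned a b p))\<^sup>2) \<le> sqrt (289 * Q)" by (rule real_sqrt_le_mono)
    moreover have "sqrt 289 = (17 :: real)" by (rule real_sqrt_unique) simp_all
    ultimately show ?thesis by (simp add: real_sqrt_mult)
  qed
  have dofb: "sqrt m * norm (dof p q) \<le> 17 * d * sqrt Q" if "p \<in> P" "q \<in> P" for p q
  proof -
    have "norm (dof p q) \<le> norm (q - p) * norm (ned a b p)" unfolding dof_def by (rule norm_rdot_le)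
    then have "sqrt m * norm (dof p q) \<le> sqrt m * (norm (q - p) * norm (ned a b p))"
      using m by (intro mult_left_mono) auto
    also have "\<dots> = norm (q - p) * (sqrt m * norm (ned a b p))" by simp
    also have "\<dots> \<le> d * (17 * sqrt Q)"
      by (rule mult_mono[OF d(1)[OF that(2,1)] Np[OF that(1)]]) (use d(2) m in auto)
    finally show ?thesis by simp
  qed
  have 1: "\<forall>u\<in>P. \<forall>v\<in>P. rdot (v - u) (ned a' b' u) = complex_of_real (w u v) * rdot (v - u) (ned a b u)"
  proof (intro ballI)
    fix u v assume "u \<in> P" "v \<in> P"
    from interp_dof[where \<omega> = \<omega>, OF this diag] show "rdot (v - u) (ned a' b' u) = complex_of_real (w u v) * rdot (v - u) (ned a b u)"
      unfolding a' b'_def[symmetric] by (simp add: \<omega>_def dof_def)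
  qed
  have 2: "sqrt m * norm (2 *\<^sub>R b' - e *\<^sub>R (2 *\<^sub>R b)) \<le> 272 * \<gamma> ^ 6 * \<delta> / d * sqrt Q"
  proof -
    \<comment> \<open>The curl of the given field is the same expression with unit weights, so in
      the difference only \<open>w p q - e\<close> is left as a weight.\<close>
    have "2 *\<^sub>R b' - e *\<^sub>R (2 *\<^sub>R b) = interp_curl \<omega> - e *\<^sub>R interp_curl dof"
      using interp_curl_exact[of a b] by (simp add: b'_def dof_def[abs_def])
    also have "\<dots> = (\<Sum>p\<in>P. \<Sum>q\<in>P. (complex_of_real (w p q - e) * dof p q) *s cvec (cross3 (g p) (g q)))"
      unfolding interp_curl_def scaleR_sum_right sum_subtractf[symmetric]
      by (intro sum.cong refl) (simp add: vec_eq_iff \<omega>_def algebra_simps scaleR_conv_of_real[where 'a=complex])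
    finally have "sqrt m * norm (2 *\<^sub>R b' - e *\<^sub>R (2 *\<^sub>R b))
       = norm (\<Sum>p\<in>P. \<Sum>q\<in>P. sqrt m *\<^sub>R ((complex_of_real (w p q - e) * dof p q) *s cvec (cross3 (g p) (g q))))"
      using m by (simp add: scaleR_sum_right[symmetric])
    also have "\<dots> \<le> 16 * (17 * \<gamma> ^ 6 * \<delta> / d * sqrt Q)"
    proof (rule norm_double_sum_le)
      fix p q assume pq: "p \<in> P" "q \<in> P"
      have "norm (sqrt m *\<^sub>R ((complex_of_real (w p q - e) * dof p q) *s cvec (cross3 (g p) (g q))))
         = \<bar>w p q - e\<bar> * (sqrt m * norm (dof p q)) * norm (cross3 (g p) (g q))"
        using m by (simp add: norm_smult_vec norm_cvec norm_mult del: of_real_diff)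
      also have "\<dots> \<le> \<delta> * (17 * d * sqrt Q) * (\<gamma> ^ 3 / d * (\<gamma> ^ 3 / d))"
      proof -
        have c: "norm (cross3 (g p) (g q)) \<le> \<gamma> ^ 3 / d * (\<gamma> ^ 3 / d)"
          using gb[OF pq(1)] gb[OF pq(2)] \<gamma>(2) d(2)
          by (intro order_trans[OF norm_cross3_le] mult_mono) auto
        have \<delta>: "0 \<le> \<delta>" using e[OF pq] by linarith
        then have "0 \<le> \<delta> * (17 * d * sqrt Q)" using d(2) by (simp add: Q_def)
        then show ?thesis
          using mult_mono[OF mult_mono[OF e[OF pq] dofb[OF pq] \<delta>] c] m by simp
      qed
      also have "\<dots> = 17 * \<gamma> ^ 6 * \<delta> / d * sqrt Q"
        using d(2) by (simp add: field_simps power2_eq_square flip: power_add)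
      finally show "norm (sqrt m *\<^sub>R ((complex_of_real (w p q - e) * dof p q) *s cvec (cross3 (g p) (g q))))
        \<le> 17 * \<gamma> ^ 6 * \<delta> / d * sqrt Q" .
    qed
    finally show ?thesis by simp
  qed
  have 3: "sqrt m * norm (ned a' b' x) \<le> 272 * \<gamma> ^ 3 * sqrt Q" if x: "x \<in> T" for x
  proof -
    have "ned a' b' x = interp \<omega> x" unfolding a' b'_def ..
    then have "sqrt m * norm (ned a' b' x)
       = norm (\<Sum>p\<in>P. \<Sum>q\<in>P. sqrt m *\<^sub>R ((complex_of_real (lam p x) * \<omega> p q) *s cvec (g q)))"
      using m by (simp add: interp_def scaleR_sum_right[symmetric])
    also have "\<dots> \<le> 16 * (17 * \<gamma> ^ 3 * sqrt Q)"
    proof (rule norm_double_sum_le)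
      fix p q assume pq: "p \<in> P" "q \<in> P"
      have "norm (sqrt m *\<^sub>R ((complex_of_real (lam p x) * \<omega> p q) *s cvec (g q)))
         = lam p x * w p q * (sqrt m * norm (dof p q)) * norm (g q)"
        using m lam_bounds[OF x pq(1)] w(2)[of p q] by (simp add: norm_smult_vec norm_cvec norm_mult \<omega>_def)
      also have "\<dots> \<le> 1 * 1 * (17 * d * sqrt Q) * (\<gamma> ^ 3 / d)"
      proof (rule mult_mono[OF mult_mono[OF mult_mono[OF lam_bounds(2)[OF x pq(1)] w(3)] dofb[OF pq]] gb[OF pq(2)]])
        show "0 \<le> 1 * 1 * (17 * d * sqrt Q)" using d(2) by (simp add: Q_def)
      qed (use w(2) m in simp_all)
      also have "\<dots> = 17 * \<gamma> ^ 3 * sqrt Q" using d(2) by simp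
      finally show "norm (sqrt m *\<^sub>R ((complex_of_real (lam p x) * \<omega> p q) *s cvec (g q))) \<le> 17 * \<gamma> ^ 3 * sqrt Q" .
    qed
    finally show ?thesis by simp
  qed
  have 4: "a' = 0 \<and> b' = 0" if "\<forall>p\<in>P. \<forall>q\<in>P. w p q = 0"
  proof -
    have "interp \<omega> x = 0" for x using that by (simp add: interp_def \<omega>_def)
    moreover have "ned 0 0 x = 0" for x by (simp add: ned_def vec_eq_iff forall_3 ccross_nth)
    ultimately have "ned a' b' = ned 0 0" unfolding a' b'_def[symmetric] by (auto simp: fun_eq_iff)
    then show ?thesis using ned_inject by blast
  qed
  show ?thesis using 1 2 3 4 by blast
qed

end

section \<open>L2 pairings by indicators, restriction of weak curls\<close>

definition ip :: "complex^3 \<Rightarrow> complex^3 \<Rightarrow> complex" where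
  "ip u v = (\<Sum>i\<in>UNIV. u $ i * cnj (v $ i))"

lemma L2_inner_lebesgue:
  assumes "\<omega> \<in> sets lebesgue"
  shows "L2_inner \<omega> f h = (\<integral>x. indicator \<omega> x *\<^sub>R ip (f x) (h x) \<partial>lebesgue)"
  using assms integral_restrict_space[of \<omega> lebesgue "\<lambda>x. ip (f x) (h x)"]
  by (simp add: L2_inner_def ip_def set_lebesgue_integral_def)

lemma L2_inner_integrable_lebesgue:
  assumes "\<omega> \<in> sets lebesgue" "f \<in> L2_field \<omega>" "h \<in> L2_field \<omega>"
  shows "integrable lebesgue (\<lambda>x. indicator \<omega> x *\<^sub>R ip (f x) (h x))"
  using L2_inner_integrable[OF assms(2,3)] assms(1) integrable_restrict_space[of \<omega> lebesgue "\<lambda>x. ip (f x) (h x)"]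
  by (simp add: ip_def set_integrable_def)

lemma L2_norm_lebesgue:
  assumes "\<omega> \<in> sets lebesgue"
  shows "(L2_norm \<omega> f)\<^sup>2 = (\<integral>x. indicator \<omega> x * (norm (f x))\<^sup>2 \<partial>lebesgue)"
  using assms integral_restrict_space[of \<omega> lebesgue "\<lambda>x. (norm (f x))\<^sup>2"]
  by (simp add: L2_norm_def set_lebesgue_integral_def)

lemma L2_norm_integrable_lebesgue:
  assumes "\<omega> \<in> sets lebesgue" "f \<in> L2_field \<omega>"
  shows "integrable lebesgue (\<lambda>x. indicator \<omega> x * (norm (f x))\<^sup>2)"
  using assms integrable_restrict_space[of \<omega> lebesgue "\<lambda>x. (norm (f x))\<^sup>2"]
  by (simp add: L2_field_def set_integrable_def)

lemma L2_field_subset: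
  assumes "\<omega>' \<subseteq> \<omega>" "\<omega>' \<in> sets lebesgue" "\<omega> \<in> sets lebesgue" "f \<in> L2_field \<omega>"
  shows "f \<in> L2_field \<omega>'"
proof -
  have "set_integrable lebesgue \<omega> (\<lambda>x. (norm (f x))\<^sup>2)"
    using assms integrable_restrict_space[of \<omega> lebesgue "\<lambda>x. (norm (f x))\<^sup>2"] by (simp add: L2_field_def set_integrable_def)
  then have "set_integrable lebesgue \<omega>' (\<lambda>x. (norm (f x))\<^sup>2)" using assms(2,1) by (rule set_integrable_subset)
  then have "integrable (lebesgue_on \<omega>') (\<lambda>x. (norm (f x))\<^sup>2)"
    using assms(2) integrable_restrict_space[of \<omega>' lebesgue "\<lambda>x. (norm (f x))\<^sup>2"] by (simp add: set_integrable_def)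
  moreover have "f \<in> borel_measurable (lebesgue_on \<omega>')"
    using assms(4) unfolding L2_field_def by (blast intro: measurable_restrict_mono[OF _ assms(1)])
  ultimately show ?thesis by (simp add: L2_field_def)
qed

lemma classical_curl_outside_support:
  assumes "x \<notin> closure {y. \<phi> y \<noteq> 0}" shows "classical_curl \<phi> x = 0"
proof -
  have "(\<phi> has_derivative (\<lambda>h. 0)) (at x)"
  proof (rule has_derivative_transform_within_open[of "\<lambda>_. 0"])
    show "open (- closure {y. \<phi> y \<noteq> 0})" by (rule open_Compl[OF closed_closure])
    show "x \<in> - closure {y. \<phi> y \<noteq> 0}" using assms by simp
    show "0 = \<phi> y" if "y \<in> - closure {y. \<phi> y \<noteq> 0}" for y
      using that closure_subset[of "{y. \<phi> y \<noteq> 0}"] by auto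
  qed simp
  from frechet_derivative_at[OF this] have "partial_deriv i \<phi> x = 0" for i
    unfolding partial_deriv_def by (metis (no_types))
  then show ?thesis by (simp add: classical_curl_def vec_eq_iff forall_3)
qed

lemma continuous_classical_curl:
  assumes "smooth_field V" shows "continuous_on UNIV (classical_curl V)"
proof -
  note c = smooth_field_continuous_partial[OF assms]
  have e: "classical_curl V = (\<lambda>x. (partial_deriv 2 V x $ 3 - partial_deriv 3 V x $ 2) *s axis 1 1
      + (partial_deriv 3 V x $ 1 - partial_deriv 1 V x $ 3) *s axis 2 1 + (partial_deriv 1 V x $ 2 - partial_deriv 2 V x $ 1) *s axis 3 1)"
    by (auto simp: fun_eq_iff vec_eq_iff forall_3 classical_curl_def axis_def)
  have s: "continuous_on UNIV (\<lambda>x. f x *s (v :: complex^3))" if "continuous_on UNIV f" for f v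
    unfolding vector_scalar_mult_def using that by (intro continuous_intros)
  show ?thesis unfolding e by (intro continuous_on_add s continuous_on_diff continuous_on_component c)
qed

lemma integral_lebesgue_continuous:
  fixes h :: "real^3 \<Rightarrow> 'b::{banach, second_countable_topology}"
  assumes "open T" "continuous_on UNIV h"
  shows "(\<integral>x. indicator T x *\<^sub>R h x \<partial>lebesgue) = (\<integral>x. indicator T x *\<^sub>R h x \<partial>lborel)"
proof (rule integral_completion)
  show "(\<lambda>x. indicator T x *\<^sub>R h x) \<in> borel_measurable lborel"
    using assms borel_measurable_continuous_onI[OF assms(2)] by (intro borel_measurable_scaleR borel_measurable_indicator) simp_all
qed

lemma continuous_ip: "continuous_on S f \<Longrightarrow> continuous_on S h \<Longrightarrow> continuous_on S (\<lambda>x. ip (f x) (h x))"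
  unfolding ip_def by (intro continuous_intros)

lemma green_ip: "green G N V x = ip G (V x) - ip (N x) (classical_curl V x)"
  by (simp add: green_def ip_def)

lemma continuous_green:
  assumes "smooth_field V" shows "continuous_on UNIV (green G (ned a b) V)"
  unfolding green_ip[abs_def]
  by (intro continuous_on_diff continuous_ip continuous_on_const continuous_ned
      smooth_field_continuous[OF assms] continuous_classical_curl[OF assms])

lemma L2_inner_test_restrict:
  assumes "\<omega>' \<subseteq> \<omega>" "\<omega>' \<in> sets lebesgue" "\<omega> \<in> sets lebesgue" "\<And>x. x \<notin> \<omega>' \<Longrightarrow> h x = 0"
  shows "L2_inner \<omega> f h = L2_inner \<omega>' f h"
  unfolding L2_inner_lebesgue[OF assms(2)] L2_inner_lebesgue[OF assms(3)]
proof (intro Bochner_Integration.integral_cong refl)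
  fix x
  have "ip v 0 = 0" for v by (simp add: ip_def)
  then show "indicator \<omega> x *\<^sub>R ip (f x) (h x) = indicator \<omega>' x *\<^sub>R ip (f x) (h x)"
    using assms(1,4) by (cases "x \<in> \<omega>'") (auto simp: indicator_def)
qed

lemma test_field_mono: "test_field \<omega>' \<phi> \<Longrightarrow> \<omega>' \<subseteq> \<omega> \<Longrightarrow> test_field \<omega> \<phi>"
  by (auto simp: test_field_def)

lemma test_field_zero:
  assumes "test_field \<omega> \<phi>" "x \<notin> \<omega>"
  shows "\<phi> x = 0" "classical_curl \<phi> x = 0"
proof -
  have x: "x \<notin> closure {y. \<phi> y \<noteq> 0}" using assms by (auto simp: test_field_def)
  then show "classical_curl \<phi> x = 0" by (rule classical_curl_outside_support)
  show "\<phi> x = 0" using x closure_subset[of "{y. \<phi> y \<noteq> 0}"] by blast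
qed

lemma has_weak_curl_restrict:
  assumes "has_weak_curl \<omega> U G" "\<omega>' \<subseteq> \<omega>" "\<omega>' \<in> sets lebesgue" "\<omega> \<in> sets lebesgue"
  shows "has_weak_curl \<omega>' U G"
  unfolding has_weak_curl_def
proof (intro allI impI)
  fix \<phi> assume \<phi>: "test_field \<omega>' \<phi>"
  note z = test_field_zero[OF \<phi>]
  have "L2_inner \<omega> G \<phi> = L2_inner \<omega> U (classical_curl \<phi>)"
    using assms(1) test_field_mono[OF \<phi> assms(2)] by (simp add: has_weak_curl_def)
  then show "L2_inner \<omega>' G \<phi> = L2_inner \<omega>' U (classical_curl \<phi>)"
    using L2_inner_test_restrict[OF assms(2-4) z(1)] L2_inner_test_restrict[OF assms(2-4) z(2)] by simp
qed

lemma curl_properties: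
  assumes "U \<in> Hcurl \<omega>" shows "curl \<omega> U \<in> L2_field \<omega>" "has_weak_curl \<omega> U (curl \<omega> U)"
proof -
  have "\<exists>G. G \<in> L2_field \<omega> \<and> has_weak_curl \<omega> U G" using assms by (auto simp: Hcurl_def)
  from someI_ex[OF this] show "curl \<omega> U \<in> L2_field \<omega>" "has_weak_curl \<omega> U (curl \<omega> U)"
    by (simp_all add: curl_def)
qed

text \<open>A test field supported in \<open>T \<inter> \<omega>\<close> vanishes on all facets, so
  Green's formula shows that the constant \<open>2 *\<^sub>R b\<close> acts on it like a weak curl;
  uniqueness finishes. The intersection with \<open>\<omega>\<close> is there because a box may cut
  through an element.\<close>

lemma (in tetrahedron) weak_curl_on_tetrahedron:
  assumes \<omega>: "open \<omega>" "bounded \<omega>" and G: "G \<in> L2_field \<omega>" "has_weak_curl \<omega> U G"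
    and U: "AE x in lebesgue. x \<in> T \<inter> \<omega> \<longrightarrow> U x = ned a b x" "U \<in> L2_field \<omega>"
  shows "AE x in lebesgue. x \<in> T \<inter> \<omega> \<longrightarrow> G x = 2 *\<^sub>R b"
proof -
  let ?\<omega> = "T \<inter> \<omega>"
  have o: "open ?\<omega>" "bounded ?\<omega>" using open_T \<omega> by (auto intro: bounded_subset)
  then have s: "?\<omega> \<in> sets lebesgue" "\<omega> \<in> sets lebesgue" "T \<in> sets lebesgue" using \<omega> open_T by (simp_all add: borel_open)
  have c2: "(\<lambda>x. 2 *\<^sub>R b) \<in> L2_field ?\<omega>" using o s by (intro continuous_L2_field) auto
  have G': "G \<in> L2_field ?\<omega>" using L2_field_subset[OF _ s(1,2) G(1)] by simp
  have "AE x in lebesgue_on ?\<omega>. G x = 2 *\<^sub>R b"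
  proof (rule L2_field_AE_unique[OF o G' c2])
    fix \<phi> assume \<phi>: "test_field ?\<omega> \<phi>"
    note z = test_field_zero[OF \<phi>]
    have sm: "smooth_field \<phi>" using \<phi> by (simp add: test_field_def)
    have "has_weak_curl ?\<omega> U G" using G(2) by (rule has_weak_curl_restrict) (use s in auto)
    then have "L2_inner ?\<omega> G \<phi> = L2_inner ?\<omega> U (classical_curl \<phi>)" using \<phi> by (simp add: has_weak_curl_def)
    also have "\<dots> = (\<integral>x. indicator T x *\<^sub>R ip (ned a b x) (classical_curl \<phi> x) \<partial>lebesgue)"
      unfolding L2_inner_lebesgue[OF s(1)]
    proof (rule integral_cong_AE)
      have L: "U \<in> L2_field ?\<omega>" "classical_curl \<phi> \<in> L2_field ?\<omega>"
        using L2_field_subset[OF _ s(1,2) U(2)] continuous_L2_field[OF s(1) o(2) continuous_classical_curl[OF sm]] by simp_all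
      show "(\<lambda>x. indicator ?\<omega> x *\<^sub>R ip (U x) (classical_curl \<phi> x)) \<in> borel_measurable lebesgue"
        using L2_inner_integrable_lebesgue[OF s(1) L] by (rule borel_measurable_integrable)
      show "(\<lambda>x. indicator T x *\<^sub>R ip (ned a b x) (classical_curl \<phi> x)) \<in> borel_measurable lebesgue"
        using L2_inner_integrable_lebesgue[OF s(3) continuous_L2_field[OF s(3) bounded_T continuous_ned]
            continuous_L2_field[OF s(3) bounded_T continuous_classical_curl[OF sm]]] by (rule borel_measurable_integrable)
      show "AE x in lebesgue. indicator ?\<omega> x *\<^sub>R ip (U x) (classical_curl \<phi> x) = indicator T x *\<^sub>R ip (ned a b x) (classical_curl \<phi> x)"
        using U(1)
      proof eventually_elim
        case (elim x)
        have "ip v 0 = 0" for v by (simp add: ip_def)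
        then show ?case using elim z(2)[of x] by (cases "x \<in> ?\<omega>") (auto simp: indicator_def)
      qed
    qed
    also have "\<dots> = (\<integral>x. indicator T x *\<^sub>R ip (ned a b x) (classical_curl \<phi> x) \<partial>lborel)"
      by (intro integral_lebesgue_continuous open_T continuous_ip continuous_ned continuous_classical_curl sm)
    also have "\<dots> = (\<integral>x. indicator T x *\<^sub>R ip (2 *\<^sub>R b) (\<phi> x) \<partial>lborel)"
    proof -
      have "(\<integral>x. indicator T x *\<^sub>R green (2 *\<^sub>R b) (ned a b) \<phi> x \<partial>lborel) = 0"
      proof -
        have "face_int (P - {q}) (\<lambda>x. rdot (g q) (ccross (ned a b x) (vcnj (\<phi> x)))) = 0" if q: "q \<in> P" for q
        proof -
          obtain q0 q1 q2 where F: "P - {q} = {q0, q1, q2}" "card (P - {q}) = 3" using facet_vertices[OF q] by metis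
          let ?f = "\<lambda>x. rdot (g q) (ccross (ned a b x) (vcnj (\<phi> x)))"
          have cf: "continuous_on UNIV ?f"
            by (intro continuous_on_linear_fun[OF linear_rdot_right] continuous_on_ccross continuous_ned
              continuous_on_linear_fun[OF linear_vcnj smooth_field_continuous[OF sm]])
          have "face_int (P - {q}) ?f = tri_int q0 q1 q2 ?f" by (rule face_int_eq[OF F cf])
          also have "\<dots> = 0"
          proof -
            have "?f (q0 + s *\<^sub>R (q1 - q0) + t *\<^sub>R (q2 - q0)) = 0" for s t :: real
            proof -
              \<comment> \<open>Points of the facet plane have barycentric coordinate zero at
                \<open>q\<close> and hence lie outside the open set \<open>T\<close>.\<close>
              have "q0 \<in> P" "q1 \<in> P" "q2 \<in> P" "q \<noteq> q0" "q \<noteq> q1" "q \<noteq> q2" using F by blast+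
              then have "lam q (q0 + s *\<^sub>R (q1 - q0) + t *\<^sub>R (q2 - q0)) = 0"
                using q by (simp add: lam_add lam_vertex g_diff inner_scaleR_right)
              then have "q0 + s *\<^sub>R (q1 - q0) + t *\<^sub>R (q2 - q0) \<notin> ?\<omega>" using q by (force simp: T_def)
              from z(1)[OF this] show ?thesis by (simp add: vcnj_def rdot_3 ccross_nth)
            qed
            then show ?thesis by (simp add: tri_int_def)
          qed
          finally show ?thesis .
        qed
        then show ?thesis unfolding green_formula[OF sm] by simp
      qed
      moreover have "(\<integral>x. indicator T x *\<^sub>R green (2 *\<^sub>R b) (ned a b) \<phi> x \<partial>lborel)
        = (\<integral>x. indicator T x *\<^sub>R ip (2 *\<^sub>R b) (\<phi> x) \<partial>lborel) - (\<integral>x. indicator T x *\<^sub>R ip (ned a b x) (classical_curl \<phi> x) \<partial>lborel)"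
        unfolding green_ip scaleR_diff_right
        using open_T by (intro Bochner_Integration.integral_diff integrable_bounded_continuous bounded_T continuous_ip continuous_ned
          continuous_classical_curl sm continuous_on_const smooth_field_continuous) simp_all
      ultimately show ?thesis by simp
    qed
    also have "\<dots> = (\<integral>x. indicator T x *\<^sub>R ip (2 *\<^sub>R b) (\<phi> x) \<partial>lebesgue)"
      by (intro integral_lebesgue_continuous[symmetric] open_T continuous_ip continuous_on_const smooth_field_continuous sm)
    also have "\<dots> = L2_inner ?\<omega> (\<lambda>x. 2 *\<^sub>R b) \<phi>"
      unfolding L2_inner_lebesgue[OF s(1)]
    proof (intro Bochner_Integration.integral_cong refl)
      fix x
      have "ip v 0 = 0" for v by (simp add: ip_def)
      then show "indicator T x *\<^sub>R ip (2 *\<^sub>R b) (\<phi> x) = indicator ?\<omega> x *\<^sub>R ip (2 *\<^sub>R b) (\<phi> x)"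
        using z(1)[of x] by (cases "x \<in> ?\<omega>") (auto simp: indicator_def)
    qed
    finally show "L2_inner ?\<omega> G \<phi> = L2_inner ?\<omega> (\<lambda>x. 2 *\<^sub>R b) \<phi>" .
  qed
  then show ?thesis using s(1) by (simp add: AE_restrict_space_iff)
qed

section \<open>Piecewise Nedelec fields on a mesh\<close>

text \<open>The part with \<open>2 * \<eta> T\<close> is split by Young so that half of the left
  side can be subtracted. The part with \<open>4 * h / L\<close> carries the factor \<open>h\<close>
  that belongs to the curl term on the right. The zero-order sum is raised to the scale
  \<open>1 / L\<^sup>2\<close>. Doubling after the subtraction gives the coefficients 4, 4 and
  2.\<close>

lemma absorption_inequality:
  fixes q n \<eta> :: "'a \<Rightarrow> real"
  assumes S: "(\<Sum>T\<in>I. (\<eta> T)\<^sup>2 * (q T)\<^sup>2) \<le> (\<Sum>T\<in>I. K / L * (2 * \<eta> T + 4 * h / L) * q T * n T) + K2 * (\<Sum>T\<in>I. (n T)\<^sup>2)"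
    and pos: "0 \<le> K" "0 \<le> K2" "0 < L" "L \<le> D" "0 \<le> h"
  shows "(\<Sum>T\<in>I. (\<eta> T)\<^sup>2 * (q T)\<^sup>2) \<le> (4 * K\<^sup>2 + 4 * K + 2 * K2 * D\<^sup>2) / L\<^sup>2 * (h\<^sup>2 * (\<Sum>T\<in>I. (q T)\<^sup>2) + (\<Sum>T\<in>I. (n T)\<^sup>2))"
proof -
  let ?S = "\<Sum>T\<in>I. (\<eta> T)\<^sup>2 * (q T)\<^sup>2" and ?q = "\<Sum>T\<in>I. (q T)\<^sup>2" and ?n = "\<Sum>T\<in>I. (n T)\<^sup>2"
  have pt: "K / L * (2 * \<eta> T + 4 * h / L) * q T * n T
      \<le> (\<eta> T)\<^sup>2 * (q T)\<^sup>2 / 2 + (2 * K\<^sup>2 + 2 * K) / L\<^sup>2 * (h\<^sup>2 * (q T)\<^sup>2 + (n T)\<^sup>2)" for T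
  proof -
    define u v w where "u = \<eta> T * q T" and "v = K * n T / L" and "w = h * q T"
    have "K / L * (2 * \<eta> T + 4 * h / L) * q T * n T = 2 * u * v + 4 * (K / L\<^sup>2) * (w * n T)"
      using pos(3) by (simp add: u_def v_def w_def field_simps power2_eq_square)
    \<comment> \<open>Young's inequality with unequal weights, so that \<open>u\<^sup>2\<close>
      keeps the coefficient one half and can be absorbed.\<close>
    also have "2 * u * v \<le> u\<^sup>2 / 2 + 2 * v\<^sup>2"
      using zero_le_power2[of "u / 2 - v"] by (simp add: power2_diff field_simps)
    also have "4 * (K / L\<^sup>2) * (w * n T) \<le> 2 * (K / L\<^sup>2) * (w\<^sup>2 + (n T)\<^sup>2)"
    proof -
      have "2 * (w * n T) \<le> w\<^sup>2 + (n T)\<^sup>2" using sum_squares_bound[of w "n T"] by simp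
      then have "2 * (K / L\<^sup>2) * (2 * (w * n T)) \<le> 2 * (K / L\<^sup>2) * (w\<^sup>2 + (n T)\<^sup>2)"
        using pos by (intro mult_left_mono) auto
      then show ?thesis by simp
    qed
    also have "u\<^sup>2 / 2 + 2 * v\<^sup>2 + 2 * (K / L\<^sup>2) * (w\<^sup>2 + (n T)\<^sup>2)
       \<le> u\<^sup>2 / 2 + (2 * K\<^sup>2 + 2 * K) / L\<^sup>2 * (w\<^sup>2 + (n T)\<^sup>2)"
    proof -
      have "2 * v\<^sup>2 = 2 * K\<^sup>2 / L\<^sup>2 * (n T)\<^sup>2" by (simp add: v_def power_divide power_mult_distrib)
      also have "\<dots> \<le> 2 * K\<^sup>2 / L\<^sup>2 * (w\<^sup>2 + (n T)\<^sup>2)" by (intro mult_left_mono) auto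
      finally show ?thesis by (simp add: add_divide_distrib distrib_right)
    qed
    finally show ?thesis by (simp add: u_def w_def power_mult_distrib)
  qed
  have "(\<Sum>T\<in>I. K / L * (2 * \<eta> T + 4 * h / L) * q T * n T)
     \<le> (\<Sum>T\<in>I. (\<eta> T)\<^sup>2 * (q T)\<^sup>2 / 2 + (2 * K\<^sup>2 + 2 * K) / L\<^sup>2 * (h\<^sup>2 * (q T)\<^sup>2 + (n T)\<^sup>2))"
    by (rule sum_mono) (rule pt)
  also have "\<dots> = ?S / 2 + (2 * K\<^sup>2 + 2 * K) / L\<^sup>2 * (h\<^sup>2 * ?q + ?n)"
    by (simp only: sum.distrib sum_divide_distrib[symmetric] sum_distrib_left[symmetric])
  finally have 1: "?S / 2 \<le> (2 * K\<^sup>2 + 2 * K) / L\<^sup>2 * (h\<^sup>2 * ?q + ?n) + K2 * ?n" using S by linarith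
  have nn: "0 \<le> ?n" "0 \<le> ?q" by (simp_all add: sum_nonneg)
  \<comment> \<open>Only here does the upper bound \<open>D\<close> of \<open>L\<close>
    enter.\<close>
  have "1 \<le> D\<^sup>2 / L\<^sup>2" using pos by (simp add: power_mono)
  then have "K2 * ?n * 1 \<le> K2 * ?n * (D\<^sup>2 / L\<^sup>2)" using nn pos by (intro mult_left_mono) auto
  also have "\<dots> \<le> K2 * D\<^sup>2 / L\<^sup>2 * (h\<^sup>2 * ?q + ?n)"
  proof -
    have "K2 * D\<^sup>2 / L\<^sup>2 * ?n \<le> K2 * D\<^sup>2 / L\<^sup>2 * (h\<^sup>2 * ?q + ?n)" using nn pos by (intro mult_left_mono) auto
    then show ?thesis by (simp add: mult_ac)
  qed
  finally have 2: "K2 * ?n \<le> K2 * D\<^sup>2 / L\<^sup>2 * (h\<^sup>2 * ?q + ?n)" by simp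
  have "(4 * K\<^sup>2 + 4 * K + 2 * K2 * D\<^sup>2) / L\<^sup>2 * (h\<^sup>2 * ?q + ?n)
     = 2 * ((2 * K\<^sup>2 + 2 * K) / L\<^sup>2 * (h\<^sup>2 * ?q + ?n) + K2 * D\<^sup>2 / L\<^sup>2 * (h\<^sup>2 * ?q + ?n))"
    by (simp add: add_divide_distrib algebra_simps)
  moreover have gen: "s \<le> 2 * (a + b)" if "s / 2 \<le> a + k" "k \<le> b" for s a b k :: real
  proof -
    have "s / 2 \<le> a + b" using that by (meson add_left_mono order_trans)
    then show ?thesis by (simp add: field_simps)
  qed
  ultimately show ?thesis using gen[OF 1 2] by (simp only:)
qed

text \<open>Piecewise linear in the maximum-norm distance from the centre, so its level sets are
  cubes: equal to one up to \<open>R / 2\<close> and zero from \<open>R / 2 + L / 4\<close> on.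
  Being Lipschitz is enough since it is only sampled at points. The larger box has half side
  \<open>R / 2 + L / 2\<close>, which leaves a margin of \<open>L / 4\<close>.\<close>

definition cutoff :: "real^3 \<Rightarrow> real \<Rightarrow> real \<Rightarrow> real^3 \<Rightarrow> real" where
  "cutoff c R L x = max 0 (min 1 ((R / 2 + L / 4 - infnorm (x - c)) * (4 / L)))"

lemma cutoff_bounds: "0 \<le> cutoff c R L x" "cutoff c R L x \<le> 1"
  by (auto simp: cutoff_def)

lemma cutoff_lipschitz:
  assumes "L > 0" shows "\<bar>cutoff c R L x - cutoff c R L y\<bar> \<le> 4 / L * norm (x - y)"
proof -
  have clamp: "\<bar>max 0 (min 1 s) - max 0 (min 1 t)\<bar> \<le> \<bar>s - t\<bar>" for s t :: real by linarith
  have "\<bar>cutoff c R L x - cutoff c R L y\<bar> \<le> \<bar>(R / 2 + L / 4 - infnorm (x - c)) * (4 / L) - (R / 2 + L / 4 - infnorm (y - c)) * (4 / L)\<bar>"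
    unfolding cutoff_def by (rule clamp)
  also have "\<dots> = \<bar>(infnorm (y - c) - infnorm (x - c)) * (4 / L)\<bar>" by (simp add: algebra_simps)
  also have "\<dots> = 4 / L * \<bar>infnorm (y - c) - infnorm (x - c)\<bar>"
  proof -
    have "\<bar>4 / L\<bar> = 4 / L" using assms by simp
    then show ?thesis by (simp only: abs_mult mult.commute)
  qed
  also have "\<dots> \<le> 4 / L * norm (x - y)"
  proof (rule mult_left_mono)
    show "\<bar>infnorm (y - c) - infnorm (x - c)\<bar> \<le> norm (x - y)"
      using absdiff_infnorm[of "y - c" "x - c"] infnorm_le_norm[of "y - x"] by (simp add: norm_minus_commute)
  qed (use assms in simp)
  finally show ?thesis .
qed

lemma infnorm_less_cube:
  assumes "infnorm (x - c) < r / 2" shows "x \<in> cube c r"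
proof -
  have "\<bar>x $ i - c $ i\<bar> < r / 2" for i
    using component_le_infnorm_cart[of "x - c" i] assms by simp
  then show ?thesis by (simp add: cube_def)
qed

lemma cube_infnorm: "x \<in> cube c r \<Longrightarrow> infnorm (x - c) < r / 2"
  by (simp add: cube_def infnorm_Max Basis_real3 inner_axis forall_3 max_def)

lemma cutoff_one: "x \<in> cube c R \<Longrightarrow> L > 0 \<Longrightarrow> cutoff c R L x = 1"
  using cube_infnorm[of x c R] by (simp add: cutoff_def field_simps)

lemma cutoff_nonzero:
  assumes "cutoff c R L x \<noteq> 0" "L > 0" shows "infnorm (x - c) < R / 2 + L / 4"
proof (rule ccontr)
  assume "\<not> infnorm (x - c) < R / 2 + L / 4"
  then have "(R / 2 + L / 4 - infnorm (x - c)) * (4 / L) \<le> 0" using assms(2) by (intro mult_nonpos_nonneg) auto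
  then show False using assms(1) by (simp add: cutoff_def)
qed

lemma open_cube: "open (cube c R)"
proof -
  have e: "cube c R = (\<Inter>i. {x. \<bar>x $ i - c $ i\<bar> < R / 2})" by (auto simp: cube_def)
  show ?thesis unfolding e by (intro open_INT ballI open_Collect_less continuous_intros) simp
qed

text \<open>The covering is an identity up to null sets because the elements are open, so that
  points on the faces of elements may belong to none of them.\<close>

locale domain_mesh = tet_family \<T> vert gr off
  for \<T> vert gr off +
  fixes \<Omega> :: "(real^3) set"
  assumes open_domain: "open \<Omega>" and bounded_domain: "bounded \<Omega>"
    and cover: "AE x in lebesgue. x \<in> \<Omega> \<longleftrightarrow> x \<in> \<Union>\<T>"
begin

lemma tet_open: "T \<in> \<T> \<Longrightarrow> open T"
  using tetrahedron.open_T[OF tet] T_eq by force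

lemma tet_bounded: "T \<in> \<T> \<Longrightarrow> bounded T"
  using tetrahedron.bounded_T[OF tet] T_eq by force

lemma tet_interior: "T \<in> \<T> \<Longrightarrow> interior (convex hull vert T) = T"
  using tetrahedron.interior_convex_hull_eq[OF tet] T_eq by force

text \<open>The intersection of the closed elements is a face of each. A face containing an interior
  point is the whole element, so a common point of the open elements forces both closed ones to
  coincide.\<close>

lemma tets_disjoint:
  assumes T: "T \<in> \<T>" "T' \<in> \<T>" and x: "x \<in> T" "x \<in> T'"
  shows "T = T'"
proof -
  have sub: "convex hull vert S \<subseteq> convex hull vert S'" if S: "S \<in> \<T>" "S' \<in> \<T>" "x \<in> S" "x \<in> S'" for S S'
  proof -
    have i: "x \<in> interior (convex hull vert S)" "x \<in> interior (convex hull vert S')" using S tet_interior by simp_all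
    have "x \<in> convex hull vert S \<inter> convex hull vert S'" using i interior_subset by blast
    moreover have "x \<in> rel_interior (convex hull vert S)" using i interior_subset_rel_interior by blast
    ultimately have "convex hull vert S \<inter> convex hull vert S' \<inter> rel_interior (convex hull vert S) \<noteq> {}" by blast
    from subset_of_face_of[OF faces[OF S(1,2)] order_refl this] show ?thesis by blast
  qed
  have "convex hull vert T = convex hull vert T'" using sub[OF T x] sub[OF T(2,1) x(2,1)] by blast
  then show ?thesis using tet_interior T by metis
qed

lemma sum_indicator_tets:
  assumes "T \<in> \<T>" "x \<in> T"
  shows "(\<Sum>S\<in>\<T>. indicator S x *\<^sub>R f S) = (f T :: 'b::real_vector)"
proof -
  have "(\<Sum>S\<in>\<T>. indicator S x *\<^sub>R f S) = (\<Sum>S\<in>\<T>. if S = T then f T else 0)"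
  proof (intro sum.cong refl)
    fix S assume S: "S \<in> \<T>"
    show "indicator S x *\<^sub>R f S = (if S = T then f T else 0)"
    proof (cases "S = T")
      case False
      then have "x \<notin> S" using tets_disjoint[OF assms(1) S assms(2)] by blast
      then show ?thesis using False by simp
    qed (use assms(2) in simp)
  qed
  then show ?thesis using assms(1) finite_family by simp
qed

lemma sum_indicator_outside:
  assumes "x \<notin> \<Union>\<T>"
  shows "(\<Sum>S\<in>\<T>. indicator S x *\<^sub>R f S) = (0 :: 'b::real_vector)"
  using assms by (intro sum.neutral ballI) (auto simp: indicator_def)

lemma AE_tets:
  assumes "\<And>T. T \<in> \<T> \<Longrightarrow> AE x in lebesgue. Q T x"
  shows "AE x in lebesgue. (x \<in> \<Omega> \<longleftrightarrow> x \<in> \<Union>\<T>) \<and> (\<forall>T\<in>\<T>. Q T x)"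
  using cover assms finite_family by (simp add: AE_ball_countable countable_finite)

lemma integral_pieces:
  fixes F :: "real^3 \<Rightarrow> 'b::{banach, second_countable_topology}"
  assumes F: "integrable lebesgue (\<lambda>x. indicator \<Omega> x *\<^sub>R F x)"
    and f: "\<And>T. T \<in> \<T> \<Longrightarrow> continuous_on UNIV (f T)"
    and eq: "\<And>T. T \<in> \<T> \<Longrightarrow> AE x in lebesgue. x \<in> T \<longrightarrow> F x = f T x"
  shows "(\<integral>x. indicator \<Omega> x *\<^sub>R F x \<partial>lebesgue) = (\<Sum>T\<in>\<T>. \<integral>x. indicator T x *\<^sub>R f T x \<partial>lborel)"
proof -
  have int: "integrable lebesgue (\<lambda>x. indicator T x *\<^sub>R f T x)" if "T \<in> \<T>" for T
    using tet_open[OF that] tet_bounded[OF that] f[OF that]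
    by (intro integrable_completion[THEN iffD2] integrable_bounded_continuous borel_measurable_scaleR borel_measurable_indicator)
      (simp_all add: borel_measurable_continuous_onI)
  have "(\<integral>x. indicator \<Omega> x *\<^sub>R F x \<partial>lebesgue) = (\<integral>x. (\<Sum>T\<in>\<T>. indicator T x *\<^sub>R f T x) \<partial>lebesgue)"
  proof (rule integral_cong_AE)
    show "(\<lambda>x. indicator \<Omega> x *\<^sub>R F x) \<in> borel_measurable lebesgue" using F by (rule borel_measurable_integrable)
    show "(\<lambda>x. \<Sum>T\<in>\<T>. indicator T x *\<^sub>R f T x) \<in> borel_measurable lebesgue"
      using int by (intro borel_measurable_sum borel_measurable_integrable)
    have "AE x in lebesgue. (x \<in> \<Omega> \<longleftrightarrow> x \<in> \<Union>\<T>) \<and> (\<forall>T\<in>\<T>. x \<in> T \<longrightarrow> F x = f T x)"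
      by (rule AE_tets) (rule eq)
    then show "AE x in lebesgue. indicator \<Omega> x *\<^sub>R F x = (\<Sum>T\<in>\<T>. indicator T x *\<^sub>R f T x)"
    proof eventually_elim
      case (elim x)
      show ?case
      proof (cases "x \<in> \<Union>\<T>")
        case True
        then obtain T where T: "T \<in> \<T>" "x \<in> T" by blast
        then have "x \<in> \<Omega>" "F x = f T x" using elim by blast+
        then show ?thesis using sum_indicator_tets[OF T, of "\<lambda>T. f T x"] by simp
      next
        case False
        then have "x \<notin> \<Omega>" using elim by blast
        then show ?thesis using sum_indicator_outside[OF False, of "\<lambda>T. f T x"] by simp
      qed
    qed
  qed
  also have "\<dots> = (\<Sum>T\<in>\<T>. \<integral>x. indicator T x *\<^sub>R f T x \<partial>lebesgue)"
    using int by (rule Bochner_Integration.integral_sum)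
  also have "\<dots> = (\<Sum>T\<in>\<T>. \<integral>x. indicator T x *\<^sub>R f T x \<partial>lborel)"
    using tet_open f by (intro sum.cong refl integral_lebesgue_continuous)
  finally show ?thesis .
qed

lemma domain_sets: "\<Omega> \<in> sets lebesgue"
  using open_domain by (simp add: borel_open)

definition piecewise :: "((real^3) set \<Rightarrow> real^3 \<Rightarrow> complex^3) \<Rightarrow> vfield" where
  "piecewise f x = (\<Sum>T\<in>\<T>. indicator T x *\<^sub>R f T x)"

lemma piecewise_eq: "T \<in> \<T> \<Longrightarrow> x \<in> T \<Longrightarrow> piecewise f x = f T x"
  unfolding piecewise_def by (rule sum_indicator_tets)

lemma piecewise_L2:
  assumes f: "\<And>T. T \<in> \<T> \<Longrightarrow> continuous_on UNIV (f T)"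
  shows "piecewise f \<in> L2_field \<Omega>"
proof -
  have meas: "piecewise f \<in> borel_measurable lebesgue" unfolding piecewise_def[abs_def]
    using f tet_open
    by (intro borel_measurable_sum borel_measurable_scaleR borel_measurable_indicator measurable_completion)
      (simp_all add: borel_measurable_continuous_onI)
  have "\<exists>B. \<forall>x\<in>T. norm (f T x) \<le> B" if T: "T \<in> \<T>" for T
  proof -
    have "compact (f T ` closure T)"
      using continuous_on_subset[OF f[OF T] subset_UNIV] tet_bounded[OF T]
      by (intro compact_continuous_image) (simp_all add: compact_closure)
    then have "bounded (f T ` closure T)" by (rule compact_imp_bounded)
    then obtain B where "\<forall>y\<in>f T ` closure T. norm y \<le> B" by (auto simp: bounded_iff)
    then have "\<forall>x\<in>T. norm (f T x) \<le> B" using closure_subset[of T] by blast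
    then show ?thesis by blast
  qed
  then have "\<forall>T\<in>\<T>. \<exists>B. \<forall>x\<in>T. norm (f T x) \<le> B" by blast
  then have "\<exists>B. \<forall>T\<in>\<T>. \<forall>x\<in>T. norm (f T x) \<le> B T" by (rule bchoice)
  then obtain B where B: "\<And>T x. T \<in> \<T> \<Longrightarrow> x \<in> T \<Longrightarrow> norm (f T x) \<le> B T" by blast
  have "norm (piecewise f x) \<le> (\<Sum>T\<in>\<T>. \<bar>B T\<bar>)" for x
    unfolding piecewise_def
  proof (rule sum_norm_le)
    fix T assume T: "T \<in> \<T>"
    show "norm (indicator T x *\<^sub>R f T x) \<le> \<bar>B T\<bar>"
      using B[OF T, of x] by (cases "x \<in> T") (auto simp: indicator_def)
  qed
  then show ?thesis
    using meas by (intro bounded_measurable_L2_field domain_sets bounded_domain measurable_restrict_space1)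
qed

text \<open>The field \<open>V\<close> is smooth but not restricted to compact support in the
  domain. The identity can therefore be used for the defining equation of the weak curl as well as
  for the boundary condition.\<close>

lemma trace_pieces:
  assumes U: "U \<in> L2_field \<Omega>" "\<And>T. T \<in> \<T> \<Longrightarrow> AE x in lebesgue. x \<in> T \<longrightarrow> U x = ned (A T) (B T) x"
    and G: "G \<in> L2_field \<Omega>" "\<And>T. T \<in> \<T> \<Longrightarrow> AE x in lebesgue. x \<in> T \<longrightarrow> G x = 2 *\<^sub>R B T"
    and V: "smooth_field V"
  shows "L2_inner \<Omega> G V - L2_inner \<Omega> U (classical_curl V)
    = (\<Sum>T\<in>\<T>. \<integral>x. indicator T x *\<^sub>R green (2 *\<^sub>R B T) (ned (A T) (B T)) V x \<partial>lborel)"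
proof -
  have V2: "V \<in> L2_field \<Omega>" "classical_curl V \<in> L2_field \<Omega>"
    using smooth_field_continuous[OF V] continuous_classical_curl[OF V]
    by (simp_all add: continuous_L2_field domain_sets bounded_domain)
  note i1 = L2_inner_integrable_lebesgue[OF domain_sets G(1) V2(1)]
    and i2 = L2_inner_integrable_lebesgue[OF domain_sets U(1) V2(2)]
  have "L2_inner \<Omega> G V - L2_inner \<Omega> U (classical_curl V)
     = (\<integral>x. indicator \<Omega> x *\<^sub>R (ip (G x) (V x) - ip (U x) (classical_curl V x)) \<partial>lebesgue)"
    unfolding L2_inner_lebesgue[OF domain_sets] scaleR_diff_right
    using Bochner_Integration.integral_diff[OF i1 i2] by simp
  also have "\<dots> = (\<Sum>T\<in>\<T>. \<integral>x. indicator T x *\<^sub>R green (2 *\<^sub>R B T) (ned (A T) (B T)) V x \<partial>lborel)"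
  proof (rule integral_pieces)
    show "integrable lebesgue (\<lambda>x. indicator \<Omega> x *\<^sub>R (ip (G x) (V x) - ip (U x) (classical_curl V x)))"
      unfolding scaleR_diff_right using i1 i2 by (rule Bochner_Integration.integrable_diff)
    fix T assume T: "T \<in> \<T>"
    show "continuous_on UNIV (green (2 *\<^sub>R B T) (ned (A T) (B T)) V)" using V by (rule continuous_green)
    show "AE x in lebesgue. x \<in> T \<longrightarrow> ip (G x) (V x) - ip (U x) (classical_curl V x) = green (2 *\<^sub>R B T) (ned (A T) (B T)) V x"
      using U(2)[OF T] G(2)[OF T] by eventually_elim (simp add: green_ip)
  qed
  finally show ?thesis .
qed

lemma curl_pieces:
  assumes \<omega>: "open \<omega>" "\<omega> \<subseteq> \<Omega>" and U: "U \<in> Hcurl \<omega>"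
    and eq: "\<And>T. T \<in> \<T> \<Longrightarrow> AE x in lebesgue. x \<in> T \<inter> \<omega> \<longrightarrow> U x = ned (A T) (B T) x"
    and T: "T \<in> \<T>"
  shows "AE x in lebesgue. x \<in> T \<inter> \<omega> \<longrightarrow> curl \<omega> U x = 2 *\<^sub>R B T"
proof -
  interpret tetrahedron "vert T" "gr T" "off T" using T by (rule tet)
  have "bounded \<omega>" using bounded_domain \<omega>(2) by (rule bounded_subset)
  moreover have "U \<in> L2_field \<omega>" using U by (simp add: Hcurl_def)
  ultimately show ?thesis
    using weak_curl_on_tetrahedron[OF \<omega>(1) _ curl_properties[OF U], of "A T" "B T"] eq[OF T] T_eq[OF T] by simp
qed

lemma conforming_of_Hcurl0:
  assumes U: "U \<in> Hcurl0 \<Omega>" and eq: "\<And>T. T \<in> \<T> \<Longrightarrow> AE x in lebesgue. x \<in> T \<longrightarrow> U x = ned (A T) (B T) x"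
    and V: "smooth_field V"
  shows "(\<Sum>T\<in>\<T>. \<integral>x. indicator T x *\<^sub>R green (2 *\<^sub>R B T) (ned (A T) (B T)) V x \<partial>lborel) = 0"
proof -
  have Uc: "U \<in> Hcurl \<Omega>" and tr: "tangential_trace \<Omega> U V = 0" using U V by (auto simp: Hcurl0_def)
  have U2: "U \<in> L2_field \<Omega>" using Uc by (simp add: Hcurl_def)
  have cp: "AE x in lebesgue. x \<in> T \<longrightarrow> curl \<Omega> U x = 2 *\<^sub>R B T" if T: "T \<in> \<T>" for T
  proof -
    have "AE x in lebesgue. x \<in> T \<inter> \<Omega> \<longrightarrow> curl \<Omega> U x = 2 *\<^sub>R B T"
    proof (rule curl_pieces[OF open_domain order_refl Uc _ T])
      fix S assume "S \<in> \<T>"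
      from eq[OF this] show "AE x in lebesgue. x \<in> S \<inter> \<Omega> \<longrightarrow> U x = ned (A S) (B S) x" by eventually_elim simp
    qed
    with cover show ?thesis by eventually_elim (use T in blast)
  qed
  show ?thesis using trace_pieces[OF U2 eq curl_properties(1)[OF Uc] cp V] tr by (simp add: tangential_trace_def)
qed

text \<open>Test fields are particular smooth fields, so the vanishing sums first show that the
  elementwise curl is a weak curl. Once the field is known to lie in \<open>Hcurl\<close>, the same
  sums say that its tangential trace is zero.\<close>

lemma Hcurl0_of_conforming:
  assumes conf: "\<And>V. smooth_field V \<Longrightarrow> (\<Sum>T\<in>\<T>. \<integral>x. indicator T x *\<^sub>R green (2 *\<^sub>R B T) (ned (A T) (B T)) V x \<partial>lborel) = 0"
  shows "piecewise (\<lambda>T. ned (A T) (B T)) \<in> Hcurl0 \<Omega>"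
proof -
  let ?U = "piecewise (\<lambda>T. ned (A T) (B T))" and ?G = "piecewise (\<lambda>T x. 2 *\<^sub>R B T)"
  have U: "?U \<in> L2_field \<Omega>" by (rule piecewise_L2) (rule continuous_ned)
  have G: "?G \<in> L2_field \<Omega>" by (rule piecewise_L2) (rule continuous_on_const)
  have eqU: "AE x in lebesgue. x \<in> T \<longrightarrow> ?U x = ned (A T) (B T) x" if "T \<in> \<T>" for T
    using piecewise_eq[OF that] by (intro AE_I2) simp
  have eqG: "AE x in lebesgue. x \<in> T \<longrightarrow> ?G x = 2 *\<^sub>R B T" if "T \<in> \<T>" for T
    using piecewise_eq[OF that] by (intro AE_I2) simp
  have "has_weak_curl \<Omega> ?U ?G"
    unfolding has_weak_curl_def
  proof (intro allI impI)
    fix \<phi> assume "test_field \<Omega> \<phi>"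
    then have "smooth_field \<phi>" by (simp add: test_field_def)
    from trace_pieces[OF U eqU G eqG this] conf[OF this]
    show "L2_inner \<Omega> ?G \<phi> = L2_inner \<Omega> ?U (classical_curl \<phi>)" by simp
  qed
  then have Uc: "?U \<in> Hcurl \<Omega>" using U G by (auto simp: Hcurl_def)
  have cp: "AE x in lebesgue. x \<in> T \<longrightarrow> curl \<Omega> ?U x = 2 *\<^sub>R B T" if T: "T \<in> \<T>" for T
  proof -
    have "AE x in lebesgue. x \<in> T \<inter> \<Omega> \<longrightarrow> curl \<Omega> ?U x = 2 *\<^sub>R B T"
    proof (rule curl_pieces[OF open_domain order_refl Uc _ T])
      fix S assume "S \<in> \<T>"
      from eqU[OF this] show "AE x in lebesgue. x \<in> S \<inter> \<Omega> \<longrightarrow> ?U x = ned (A S) (B S) x" by eventually_elim simp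
    qed
    with cover show ?thesis by eventually_elim (use T in blast)
  qed
  have "tangential_trace \<Omega> ?U V = 0" if V: "smooth_field V" for V
    unfolding tangential_trace_def using trace_pieces[OF U eqU curl_properties(1)[OF Uc] cp V] conf[OF V] by simp
  then show ?thesis using Uc by (simp add: Hcurl0_def)
qed

lemma Hcurl_subset:
  assumes "\<omega> \<subseteq> \<Omega>" "open \<omega>" "U \<in> Hcurl \<Omega>" shows "U \<in> Hcurl \<omega>"
proof -
  have s: "\<omega> \<in> sets lebesgue" using assms(2) by (simp add: borel_open)
  have "U \<in> L2_field \<omega>" using L2_field_subset[OF assms(1) s domain_sets] assms(3) by (simp add: Hcurl_def)
  moreover have "curl \<Omega> U \<in> L2_field \<omega>"
    using L2_field_subset[OF assms(1) s domain_sets curl_properties(1)[OF assms(3)]] .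
  moreover have "has_weak_curl \<omega> U (curl \<Omega> U)"
    using has_weak_curl_restrict[OF curl_properties(2)[OF assms(3)] assms(1) s domain_sets] .
  ultimately show ?thesis by (auto simp: Hcurl_def)
qed

end

section \<open>Energies and inner products assembled from elements\<close>

lemma norm_ip_le: "norm (ip u v) \<le> norm u * norm v"
proof -
  have "norm (ip u v) \<le> (\<Sum>i\<in>UNIV. norm (u $ i * cnj (v $ i)))"
    unfolding ip_def by (rule norm_sum)
  also have "\<dots> = (\<Sum>i\<in>UNIV. \<bar>norm (u $ i)\<bar> * \<bar>norm (v $ i)\<bar>)" by (simp add: norm_mult)
  also have "\<dots> \<le> L2_set (\<lambda>i. norm (u $ i)) UNIV * L2_set (\<lambda>i. norm (v $ i)) UNIV"
    by (rule L2_set_mult_ineq)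
  also have "\<dots> = norm u * norm v" by (simp add: norm_vec_def)
  finally show ?thesis .
qed

lemma ip_self: "ip u u = complex_of_real ((norm u)\<^sup>2)"
  unfolding ip_def norm_square_vec by (simp add: complex_norm_square del: of_real_power)

lemma ip_zero_right: "ip u 0 = 0"
  by (simp add: ip_def)

lemma ip_diff_right: "ip u (v - w) = ip u v - ip u w"
  by (simp add: ip_def algebra_simps sum_subtractf)

lemma ip_scale_right: "ip u (r *\<^sub>R v) = r *\<^sub>R ip u v"
  by (simp add: ip_def scaleR_sum_right)

lemma ned_zero: "ned 0 0 x = 0"
  by (simp add: ned_def vec_eq_iff forall_3 ccross_nth)

context domain_mesh
begin

text \<open>Up to a null set the active elements are disjoint parts of \<open>\<omega>\<close>, so
  their full energies are dominated by the energy over \<open>\<omega>\<close>.\<close>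

lemma energy_lower:
  assumes \<omega>: "\<omega> \<in> sets lebesgue" and F: "F \<in> L2_field \<omega>"
    and f: "\<And>T. T \<in> \<T> \<Longrightarrow> continuous_on UNIV (f T)"
    and eq: "\<And>T. T \<in> \<T> \<Longrightarrow> AE x in lebesgue. x \<in> T \<inter> \<omega> \<longrightarrow> F x = f T x"
    and sub: "\<And>T. T \<in> \<T> \<Longrightarrow> act T \<Longrightarrow> T \<inter> \<Omega> \<subseteq> \<omega>"
  shows "(\<Sum>T\<in>\<T>. if act T then \<integral>x. indicator T x * (norm (f T x))\<^sup>2 \<partial>lborel else 0) \<le> (L2_norm \<omega> F)\<^sup>2"
proof -
  define g where "g T x = (if act T then (norm (f T x))\<^sup>2 else 0)" for T x
  have cg: "continuous_on UNIV (g T)" if "T \<in> \<T>" for T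
    unfolding g_def[abs_def] using f[OF that] by (cases "act T") (auto intro!: continuous_intros)
  have int: "integrable lebesgue (\<lambda>x. indicator T x *\<^sub>R g T x)" if "T \<in> \<T>" for T
    using tet_open[OF that] tet_bounded[OF that] cg[OF that]
    by (intro integrable_completion[THEN iffD2] integrable_bounded_continuous borel_measurable_scaleR borel_measurable_indicator)
      (simp_all add: borel_measurable_continuous_onI)
  have "(\<Sum>T\<in>\<T>. if act T then \<integral>x. indicator T x * (norm (f T x))\<^sup>2 \<partial>lborel else 0)
     = (\<Sum>T\<in>\<T>. \<integral>x. indicator T x *\<^sub>R g T x \<partial>lborel)"
    by (intro sum.cong refl) (simp add: g_def)
  also have "\<dots> = (\<Sum>T\<in>\<T>. \<integral>x. indicator T x *\<^sub>R g T x \<partial>lebesgue)"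
    using tet_open cg by (intro sum.cong refl integral_lebesgue_continuous[symmetric])
  also have "\<dots> = (\<integral>x. (\<Sum>T\<in>\<T>. indicator T x *\<^sub>R g T x) \<partial>lebesgue)"
    using int by (rule Bochner_Integration.integral_sum[symmetric])
  also have "\<dots> \<le> (\<integral>x. indicator \<omega> x * (norm (F x))\<^sup>2 \<partial>lebesgue)"
  proof (rule integral_mono_AE)
    show "integrable lebesgue (\<lambda>x. \<Sum>T\<in>\<T>. indicator T x *\<^sub>R g T x)" using int by (rule Bochner_Integration.integrable_sum)
    show "integrable lebesgue (\<lambda>x. indicator \<omega> x * (norm (F x))\<^sup>2)" using \<omega> F by (rule L2_norm_integrable_lebesgue)
    have "AE x in lebesgue. (x \<in> \<Omega> \<longleftrightarrow> x \<in> \<Union>\<T>) \<and> (\<forall>T\<in>\<T>. x \<in> T \<inter> \<omega> \<longrightarrow> F x = f T x)"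
      by (rule AE_tets) (rule eq)
    then show "AE x in lebesgue. (\<Sum>T\<in>\<T>. indicator T x *\<^sub>R g T x) \<le> indicator \<omega> x * (norm (F x))\<^sup>2"
    proof eventually_elim
      case (elim x)
      show ?case
      proof (cases "x \<in> \<Union>\<T>")
        case True
        then obtain T where T: "T \<in> \<T>" "x \<in> T" by blast
        have "g T x \<le> indicator \<omega> x * (norm (F x))\<^sup>2"
        proof (cases "act T")
          case True
          then have "x \<in> \<omega>" using sub[OF T(1)] T elim by blast
          then have "F x = f T x" using elim T by blast
          then show ?thesis using \<open>x \<in> \<omega>\<close> by (simp add: g_def)
        qed (simp add: g_def)
        then show ?thesis using sum_indicator_tets[OF T, of "\<lambda>T. g T x"] by simp
      next
        case False
        then show ?thesis using sum_indicator_outside[OF False, of "\<lambda>T. g T x"] by simp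
      qed
    qed
  qed
  also have "\<dots> = (L2_norm \<omega> F)\<^sup>2" using L2_norm_lebesgue[OF \<omega>] by simp
  finally show ?thesis .
qed

text \<open>Every element that meets \<open>\<omega>\<close> has weight one, and the remaining
  weights are nonnegative; an element cut by the boundary of \<open>\<omega>\<close> is simply
  counted in full.\<close>

lemma energy_upper:
  fixes b :: "(real^3) set \<Rightarrow> complex^3"
  assumes \<omega>: "\<omega> \<in> sets lebesgue" "\<omega> \<subseteq> \<Omega>" and F: "F \<in> L2_field \<omega>"
    and eq: "\<And>T. T \<in> \<T> \<Longrightarrow> AE x in lebesgue. x \<in> T \<inter> \<omega> \<longrightarrow> F x = b T"
    and e: "\<And>T x. T \<in> \<T> \<Longrightarrow> x \<in> T \<Longrightarrow> x \<in> \<omega> \<Longrightarrow> e T = 1" and e0: "\<And>T. 0 \<le> e T"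
  shows "(L2_norm \<omega> F)\<^sup>2 \<le> (\<Sum>T\<in>\<T>. e T * (measure lborel T * (norm (b T))\<^sup>2))"
proof -
  define g where "g T = e T * (norm (b T))\<^sup>2" for T
  have int: "integrable lebesgue (\<lambda>x. indicator T x *\<^sub>R g T)" if "T \<in> \<T>" for T
    using tet_open[OF that] tet_bounded[OF that]
    by (intro integrable_completion[THEN iffD2] integrable_bounded_continuous borel_measurable_scaleR borel_measurable_indicator)
      (simp_all add: borel_measurable_continuous_onI)
  have "(L2_norm \<omega> F)\<^sup>2 = (\<integral>x. indicator \<omega> x * (norm (F x))\<^sup>2 \<partial>lebesgue)" using L2_norm_lebesgue[OF \<omega>(1)] by simp
  also have "\<dots> \<le> (\<integral>x. (\<Sum>T\<in>\<T>. indicator T x *\<^sub>R g T) \<partial>lebesgue)"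
  proof (rule integral_mono_AE)
    show "integrable lebesgue (\<lambda>x. \<Sum>T\<in>\<T>. indicator T x *\<^sub>R g T)" using int by (rule Bochner_Integration.integrable_sum)
    show "integrable lebesgue (\<lambda>x. indicator \<omega> x * (norm (F x))\<^sup>2)" using \<omega>(1) F by (rule L2_norm_integrable_lebesgue)
    have "AE x in lebesgue. (x \<in> \<Omega> \<longleftrightarrow> x \<in> \<Union>\<T>) \<and> (\<forall>T\<in>\<T>. x \<in> T \<inter> \<omega> \<longrightarrow> F x = b T)"
      by (rule AE_tets) (rule eq)
    then show "AE x in lebesgue. indicator \<omega> x * (norm (F x))\<^sup>2 \<le> (\<Sum>T\<in>\<T>. indicator T x *\<^sub>R g T)"
    proof eventually_elim
      case (elim x)
      show ?case
      proof (cases "x \<in> \<Union>\<T>")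
        case True
        then obtain T where T: "T \<in> \<T>" "x \<in> T" by blast
        have "indicator \<omega> x * (norm (F x))\<^sup>2 \<le> g T"
        proof (cases "x \<in> \<omega>")
          case True
          then have "F x = b T" using elim T by blast
          then show ?thesis using True e[OF T True] by (simp add: g_def)
        qed (use e0 in \<open>simp add: g_def\<close>)
        then show ?thesis using sum_indicator_tets[OF T, of g] by simp
      next
        case False
        then have "x \<notin> \<omega>" using elim \<omega>(2) by blast
        then show ?thesis using sum_indicator_outside[OF False, of g] by simp
      qed
    qed
  qed
  also have "\<dots> = (\<Sum>T\<in>\<T>. \<integral>x. indicator T x *\<^sub>R g T \<partial>lebesgue)"
    using int by (rule Bochner_Integration.integral_sum)
  also have "\<dots> = (\<Sum>T\<in>\<T>. \<integral>x. indicator T x *\<^sub>R g T \<partial>lborel)"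
    using tet_open by (intro sum.cong refl integral_lebesgue_continuous continuous_on_const)
  also have "\<dots> = (\<Sum>T\<in>\<T>. e T * (measure lborel T * (norm (b T))\<^sup>2))"
  proof (intro sum.cong refl)
    fix T assume "T \<in> \<T>"
    have "(\<integral>x. indicator T x *\<^sub>R g T \<partial>lborel) = measure lborel T * g T" by simp
    then show "(\<integral>x. indicator T x *\<^sub>R g T \<partial>lborel) = e T * (measure lborel T * (norm (b T))\<^sup>2)" by (simp add: g_def)
  qed
  finally show ?thesis .
qed

text \<open>An element is either contained in \<open>\<omega>\<close> up to a null set or carries a
  vanishing second factor. The integrals can thus be taken over whole tetrahedra although
  \<open>\<omega>\<close> cuts some of them.\<close>

lemma inner_pieces:
  assumes \<omega>: "\<omega> \<in> sets lebesgue" "\<omega> \<subseteq> \<Omega>" and F: "F \<in> L2_field \<omega>" "G \<in> L2_field \<omega>"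
    and f: "\<And>T. T \<in> \<T> \<Longrightarrow> continuous_on UNIV (f T)" "\<And>T. T \<in> \<T> \<Longrightarrow> continuous_on UNIV (g T)"
    and eqF: "\<And>T. T \<in> \<T> \<Longrightarrow> AE x in lebesgue. x \<in> T \<inter> \<omega> \<longrightarrow> F x = f T x"
    and eqG: "\<And>T. T \<in> \<T> \<Longrightarrow> AE x in lebesgue. x \<in> T \<inter> \<omega> \<longrightarrow> G x = g T x"
    and sub: "\<And>T. T \<in> \<T> \<Longrightarrow> act T \<Longrightarrow> T \<inter> \<Omega> \<subseteq> \<omega>"
    and inact: "\<And>T x. T \<in> \<T> \<Longrightarrow> \<not> act T \<Longrightarrow> g T x = 0"
  shows "L2_inner \<omega> F G = (\<Sum>T\<in>\<T>. \<integral>x. indicator T x *\<^sub>R ip (f T x) (g T x) \<partial>lborel)"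
proof -
  have e: "indicator \<Omega> x *\<^sub>R (indicator \<omega> x *\<^sub>R v) = indicator \<omega> x *\<^sub>R v" for x and v :: complex
    using \<omega>(2) by (auto simp: indicator_def)
  have "L2_inner \<omega> F G = (\<integral>x. indicator \<Omega> x *\<^sub>R (indicator \<omega> x *\<^sub>R ip (F x) (G x)) \<partial>lebesgue)"
    unfolding e by (rule L2_inner_lebesgue[OF \<omega>(1)])
  also have "\<dots> = (\<Sum>T\<in>\<T>. \<integral>x. indicator T x *\<^sub>R ip (f T x) (g T x) \<partial>lborel)"
  proof (rule integral_pieces)
    show "integrable lebesgue (\<lambda>x. indicator \<Omega> x *\<^sub>R (indicator \<omega> x *\<^sub>R ip (F x) (G x)))"
      unfolding e by (rule L2_inner_integrable_lebesgue[OF \<omega>(1) F])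
    fix T assume T: "T \<in> \<T>"
    show "continuous_on UNIV (\<lambda>x. ip (f T x) (g T x))" using f[OF T] by (rule continuous_ip)
    show "AE x in lebesgue. x \<in> T \<longrightarrow> indicator \<omega> x *\<^sub>R ip (F x) (G x) = ip (f T x) (g T x)"
      using eqF[OF T] eqG[OF T] cover
    proof eventually_elim
      case (elim x)
      show ?case
      proof (intro impI)
        assume x: "x \<in> T"
        show "indicator \<omega> x *\<^sub>R ip (F x) (G x) = ip (f T x) (g T x)"
        proof (cases "x \<in> \<omega>")
          case True
          then show ?thesis using elim x by simp
        next
          case False
          have "x \<in> \<Omega>" using elim x T by blast
          then have "\<not> act T" using sub[OF T] False x by blast
          then show ?thesis using False inact[OF T] by (simp add: ip_zero_right)
        qed
      qed
    qed
  qed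
  finally show ?thesis .
qed

end

text \<open>Bounding \<open>u + v\<close> by \<open>2 * v + \<delta>\<close> keeps the reference
  value \<open>v\<close> as a factor, which is what the later absorption needs.\<close>

lemma square_difference_le:
  fixes u v :: real
  assumes "\<bar>u - v\<bar> \<le> \<delta>" "0 \<le> u" "0 \<le> v"
  shows "\<bar>u\<^sup>2 - v\<^sup>2\<bar> \<le> \<delta> * (2 * v + \<delta>)"
proof -
  have "\<bar>u\<^sup>2 - v\<^sup>2\<bar> = \<bar>u - v\<bar> * (u + v)"
    using assms(2,3) by (simp add: power2_eq_square square_diff_square_factored abs_mult mult.commute)
  also have "\<dots> \<le> \<delta> * (2 * v + \<delta>)" using assms by (intro mult_mono) auto
  finally show ?thesis .
qed

text \<open>Pointwise Young with weight \<open>C\<close> in place of Cauchy-Schwarz: the first half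
  is \<open>C / 2\<close> times the squared norm of the first field, and the uniform bound on the
  second field makes the other half the constant \<open>C * Q / (2 * m)\<close>, whose integral over
  \<open>T\<close> is \<open>C * Q / 2\<close>.\<close>

lemma (in tetrahedron) integral_ip_le:
  assumes C: "C > 0"
    and b: "\<forall>x\<in>T. sqrt (measure lborel T) * norm (ned a' b' x) \<le> C * sqrt (\<integral>x. indicator T x * (norm (ned a b x))\<^sup>2 \<partial>lborel)"
  shows "norm (\<integral>x. indicator T x *\<^sub>R ip (ned a b x) (ned a' b' x) \<partial>lborel) \<le> C * (\<integral>x. indicator T x * (norm (ned a b x))\<^sup>2 \<partial>lborel)"
proof -
  define m where "m = measure lborel T"
  define Q where "Q = (\<integral>x. indicator T x * (norm (ned a b x))\<^sup>2 \<partial>lborel)"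
  have m: "m > 0" unfolding m_def by (rule measure_T_pos)
  have Q: "Q \<ge> 0" unfolding Q_def by simp
  have i1: "integrable lborel (\<lambda>x. indicator T x *\<^sub>R (norm (ned a b x))\<^sup>2)"
    using open_T by (intro integrable_bounded_continuous bounded_T continuous_intros continuous_ned) simp
  have i2: "integrable lborel (indicator T :: real^3 \<Rightarrow> real)"
    using emeasure_bounded_finite[OF bounded_T] open_T by (simp add: integrable_indicator_iff)
  have pt: "norm (indicator T x *\<^sub>R ip (ned a b x) (ned a' b' x)) \<le> C / 2 * (indicator T x *\<^sub>R (norm (ned a b x))\<^sup>2) + (C * Q / (2 * m)) * indicator T x" for x
  proof (cases "x \<in> T")
    case True
    define u v where "u = norm (ned a b x)" and "v = norm (ned a' b' x)"
    have "sqrt m * v \<le> C * sqrt Q" using b True by (simp add: m_def Q_def v_def)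
    then have "(sqrt m * v)\<^sup>2 \<le> (C * sqrt Q)\<^sup>2" using m by (intro power_mono) (auto simp: v_def)
    then have v: "m * v\<^sup>2 \<le> C\<^sup>2 * Q" using m Q by (simp add: power_mult_distrib)
    have "2 * (C * u * v) \<le> C\<^sup>2 * u\<^sup>2 + v\<^sup>2"
      using sum_squares_bound[of "C * u" v] by (simp add: power_mult_distrib mult.assoc)
    also have "\<dots> \<le> C\<^sup>2 * u\<^sup>2 + C\<^sup>2 * Q / m" using v m by (simp add: field_simps)
    also have "\<dots> = 2 * C * (C / 2 * u\<^sup>2 + C * Q / (2 * m))" using m by (simp add: field_simps power2_eq_square)
    finally have "2 * C * (u * v) \<le> 2 * C * (C / 2 * u\<^sup>2 + C * Q / (2 * m))" by (simp add: mult_ac)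
    then have "u * v \<le> C / 2 * u\<^sup>2 + C * Q / (2 * m)" by (rule mult_left_le_imp_le) (use C in simp)
    then show ?thesis using norm_ip_le[of "ned a b x" "ned a' b' x"] True by (simp add: u_def v_def)
  qed simp
  have "norm (\<integral>x. indicator T x *\<^sub>R ip (ned a b x) (ned a' b' x) \<partial>lborel) \<le> (\<integral>x. norm (indicator T x *\<^sub>R ip (ned a b x) (ned a' b' x)) \<partial>lborel)"
    by (rule integral_norm_bound)
  also have "\<dots> \<le> (\<integral>x. C / 2 * (indicator T x *\<^sub>R (norm (ned a b x))\<^sup>2) + (C * Q / (2 * m)) * indicator T x \<partial>lborel)"
    using pt C Q m by (intro integral_mono' Bochner_Integration.integrable_add integrable_mult_right i1 i2) auto
  also have "\<dots> = C / 2 * Q + (C * Q / (2 * m)) * m"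
    using i1 i2 by (simp add: Q_def m_def)
  also have "\<dots> = C * Q" using m by simp
  finally show ?thesis by (simp add: Q_def)
qed

section \<open>The discrete Caccioppoli inequality\<close>

context domain_mesh
begin

lemma hull_dist:
  assumes T: "T \<in> \<T>" and x: "x \<in> convex hull vert T" "y \<in> convex hull vert T"
  shows "norm (x - y) \<le> diameter T"
proof -
  interpret tetrahedron "vert T" "gr T" "off T" using T by (rule tet)
  have cl: "closure T = convex hull vert T" using closure_T T_eq[OF T] by simp
  have "dist x y \<le> diameter (convex hull vert T)"
    using compact_imp_bounded[OF compact_hull] x by (rule diameter_bounded_bound)
  then show ?thesis using diameter_closure[OF tet_bounded[OF T]] by (simp add: cl dist_norm)
qed

lemma tet_subset_hull: "T \<in> \<T> \<Longrightarrow> T \<subseteq> convex hull vert T"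
  using tet_interior interior_subset by blast

lemma tet_nonempty: "T \<in> \<T> \<Longrightarrow> T \<noteq> {}"
  using tetrahedron.barycenter_in_T[OF tet] T_eq by blast

lemma diameter_le_mesh_size: "T \<in> \<T> \<Longrightarrow> diameter T \<le> mesh_size \<T>"
  unfolding mesh_size_def using finite_family by (intro Max_ge) auto

lemma diameter_pos: "T \<in> \<T> \<Longrightarrow> 0 < diameter T"
proof -
  assume T: "T \<in> \<T>"
  interpret tetrahedron "vert T" "gr T" "off T" using T by (rule tet)
  obtain a b c d where P: "vert T = {a, b, c, d}" "a \<noteq> b" using card_P card_4_iff by metis
  have "norm (a - b) \<le> diameter T" by (rule hull_dist[OF T]) (simp_all add: P hull_inc)
  moreover have "0 < norm (a - b)" using P(2) by simp
  ultimately show ?thesis by linarith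
qed

text \<open>The squared inequality with explicit constants for one mesh. They involve only
  \<open>\<gamma>\<close>, \<open>\<gamma>'\<close>, the modulus of \<open>\<kappa>\<close> and the
  bound \<open>D\<close>, so a constant uniform in the mesh and the boxes can be read off.\<close>

lemma discrete_caccioppoli:
  fixes \<gamma> \<gamma>' \<epsilon> R D :: real and \<kappa> :: complex and c :: "real^3"
  defines "\<omega> \<equiv> cube c ((1 + \<epsilon>) * R) \<inter> \<Omega>" and "h \<equiv> mesh_size \<T>" and "L \<equiv> \<epsilon> * R"
    and "K \<equiv> 1088 * \<gamma> ^ 6 * \<gamma>'" and "K2 \<equiv> norm \<kappa> * (272 * \<gamma> ^ 3)"
  assumes quasi: "\<And>T. T \<in> \<T> \<Longrightarrow> diameter T \<le> \<gamma> * root 3 (measure lebesgue T)" "\<And>T. T \<in> \<T> \<Longrightarrow> mesh_size \<T> \<le> \<gamma>' * diameter T"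
    and \<gamma>: "\<gamma> > 0" "\<gamma>' > 0" and \<epsilon>: "0 < \<epsilon>" "\<epsilon> < 1" and R: "0 < R" "R < D"
    and hR: "mesh_size \<T> / R < \<epsilon> / 4" and E: "E \<in> Hch \<kappa> \<T> \<Omega> (cube c ((1 + \<epsilon>) * R))"
    and ne: "\<T> \<noteq> {}"
  shows "(L2_norm (cube c R \<inter> \<Omega>) (curl \<omega> E))\<^sup>2 \<le>
    (4 * K\<^sup>2 + 4 * K + 2 * K2 * D\<^sup>2) / L\<^sup>2 * (h\<^sup>2 * (L2_norm \<omega> (curl \<omega> E))\<^sup>2 + (L2_norm \<omega> E)\<^sup>2)"
proof -
  have "\<epsilon> * R \<le> 1 * R" using \<epsilon> R by (intro mult_right_mono) auto
  then have "L \<le> D" using R(2) unfolding L_def by linarith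
  then have L: "0 < L" "L \<le> D" using \<epsilon> R by (simp_all add: L_def)
  have h: "0 \<le> h"
  proof -
    obtain T where "T \<in> \<T>" using ne by blast
    from diameter_pos[OF this] diameter_le_mesh_size[OF this] show ?thesis by (simp add: h_def)
  qed
  have hL: "h < L / 4" using hR R(1) by (simp add: h_def L_def field_simps)
  have K: "0 \<le> K" "0 \<le> K2" using \<gamma> by (simp_all add: K_def K2_def)
  have o\<omega>: "open \<omega>" "\<omega> \<subseteq> \<Omega>" unfolding \<omega>_def using open_cube open_domain by auto
  have s\<omega>: "\<omega> \<in> sets lebesgue" using o\<omega>(1) by (simp add: borel_open)

  \<comment> \<open>Element coefficients of the local solution\<close>
  from E obtain W where W: "W \<in> Xh0 \<T> \<Omega>" "AE x in lebesgue_on \<omega>. E x = W x"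
    and EH: "E \<in> Hcurl \<omega>"
    and orth: "\<And>\<Psi>. \<Psi> \<in> Xh0 \<T> \<Omega> \<Longrightarrow> ess_support \<Omega> \<Psi> \<subseteq> closure \<omega> \<Longrightarrow> maxwell_form \<kappa> \<omega> E \<Psi> = 0"
    unfolding Hch_def \<omega>_def by blast
  have EW: "AE x in lebesgue. x \<in> \<omega> \<longrightarrow> E x = W x" using W(2) s\<omega> by (simp add: AE_restrict_space_iff)
  have "\<forall>T\<in>\<T>. \<exists>ab. AE x in lebesgue. x \<in> T \<longrightarrow> W x = ned (fst ab) (snd ab) x"
  proof
    fix T assume T: "T \<in> \<T>"
    then obtain N where "N \<in> nedelec0" "AE x in lebesgue_on T. W x = N x" using W(1) by (auto simp: Xh0_def)
    then obtain a b where N: "N = ned a b" "AE x in lebesgue_on T. W x = N x" by (auto simp: nedelec0_eq)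
    have "T \<in> sets lebesgue" using tet_open[OF T] by (simp add: borel_open)
    then have "AE x in lebesgue. x \<in> T \<longrightarrow> W x = ned a b x" using N by (simp add: AE_restrict_space_iff)
    then show "\<exists>ab. AE x in lebesgue. x \<in> T \<longrightarrow> W x = ned (fst ab) (snd ab) x" by (intro exI[of _ "(a, b)"]) simp
  qed
  then have "\<exists>ab. \<forall>T\<in>\<T>. AE x in lebesgue. x \<in> T \<longrightarrow> W x = ned (fst (ab T)) (snd (ab T)) x" by (rule bchoice)
  then obtain ab where ab: "\<forall>T\<in>\<T>. AE x in lebesgue. x \<in> T \<longrightarrow> W x = ned (fst (ab T)) (snd (ab T)) x" by (rule exE)
  define A where "A T = fst (ab T)" for T
  define B where "B T = snd (ab T)" for T
  have WN: "AE x in lebesgue. x \<in> T \<longrightarrow> W x = ned (A T) (B T) x" if "T \<in> \<T>" for T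
    using ab that by (simp add: A_def B_def)
  have W0: "W \<in> Hcurl0 \<Omega>" using W(1) by (simp add: Xh0_def)

  \<comment> \<open>Cutoff values, edge weights and active elements\<close>
  define \<eta> where "\<eta> = cutoff c R L"
  have \<eta>b: "0 \<le> \<eta> x" "\<eta> x \<le> 1" for x by (simp_all add: \<eta>_def cutoff_bounds)
  define w where "w p q = (\<eta> ((1/2) *\<^sub>R (p + q)))\<^sup>2" for p q
  \<comment> \<open>The reference point of \<open>T\<close> lies in \<open>B\<^sub>R\<close> whenever \<open>T\<close> meets \<open>B\<^sub>R\<close>, so that \<open>\<eta>\<^sub>T = 1\<close> there.\<close>
  define xT where "xT T = (SOME x. x \<in> T \<and> (T \<inter> cube c R \<noteq> {} \<longrightarrow> x \<in> cube c R))" for T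
  have xT: "xT T \<in> T" "T \<inter> cube c R \<noteq> {} \<Longrightarrow> xT T \<in> cube c R" if T: "T \<in> \<T>" for T
  proof -
    have "\<exists>x. x \<in> T \<and> (T \<inter> cube c R \<noteq> {} \<longrightarrow> x \<in> cube c R)" using tet_nonempty[OF T] by blast
    from someI_ex[OF this] show "xT T \<in> T" "T \<inter> cube c R \<noteq> {} \<Longrightarrow> xT T \<in> cube c R" by (simp_all add: xT_def)
  qed
  define e where "e T = \<eta> (xT T)" for T
  have eb: "0 \<le> e T" for T by (simp add: e_def \<eta>b)
  \<comment> \<open>Nonvanishing is asked for anywhere on the closed element, so inactivity
    annihilates the reference value and all edge weights of the element at once.\<close>
  define act where "act T \<longleftrightarrow> (\<exists>y\<in>convex hull vert T. \<eta> y \<noteq> 0)" for T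
  have mid: "(1/2) *\<^sub>R (p + q) \<in> convex hull vert T" if "p \<in> vert T" "q \<in> vert T" for p q T
    using convexD[OF convex_convex_hull hull_inc[OF that(1)] hull_inc[OF that(2)], where u = "1/2" and v = "1/2"]
    by (simp add: scaleR_add_right)
  have act_sub: "T \<inter> \<Omega> \<subseteq> \<omega>" if T: "T \<in> \<T>" "act T" for T
  proof
    fix x assume x: "x \<in> T \<inter> \<Omega>"
    obtain y where y: "y \<in> convex hull vert T" "\<eta> y \<noteq> 0" using T(2) by (auto simp: act_def)
    \<comment> \<open>The support radius \<open>R / 2 + L / 4\<close> plus one element diameter,
      which is less than \<open>L / 4\<close>, stays within the half side
      \<open>R / 2 + L / 2\<close> of the larger box.\<close>
    have "infnorm (x - c) \<le> infnorm (x - y) + infnorm (y - c)" using infnorm_triangle[of "x - y" "y - c"] by simp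
    also have "infnorm (x - y) \<le> norm (x - y)" by (rule infnorm_le_norm)
    also have "norm (x - y) \<le> diameter T" using hull_dist[OF T(1) _ y(1)] tet_subset_hull[OF T(1)] x by blast
    also have "diameter T \<le> h" unfolding h_def by (rule diameter_le_mesh_size[OF T(1)])
    also have "infnorm (y - c) < R / 2 + L / 4" using y(2) L(1) unfolding \<eta>_def by (rule cutoff_nonzero)
    finally have "infnorm (x - c) < ((1 + \<epsilon>) * R) / 2" using hL by (simp add: L_def field_simps)
    then have "x \<in> cube c ((1 + \<epsilon>) * R)" by (rule infnorm_less_cube)
    then show "x \<in> \<omega>" using x by (simp add: \<omega>_def)
  qed
  have e_one: "e T = 1" if "T \<in> \<T>" "x \<in> T" "x \<in> cube c R" for T x
    using xT(2)[OF that(1)] that cutoff_one[OF _ L(1)] by (auto simp: e_def \<eta>_def)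
  have inact: "e T = 0" "p \<in> vert T \<Longrightarrow> q \<in> vert T \<Longrightarrow> w p q = 0" if T: "T \<in> \<T>" "\<not> act T" for T p q
  proof -
    have "xT T \<in> convex hull vert T" using xT(1)[OF T(1)] tet_subset_hull[OF T(1)] by blast
    then show "e T = 0" using T(2) by (simp add: act_def e_def)
    show "w p q = 0" if "p \<in> vert T" "q \<in> vert T" using mid[OF that] T(2) by (simp add: act_def w_def)
  qed

  \<comment> \<open>Construction of the test field on each element\<close>
  define \<delta> where "\<delta> T = 4 * h / L * (2 * e T + 4 * h / L)" for T
  define m where "m T = measure lborel T" for T :: "(real^3) set"
  define Q where "Q T = (\<integral>x. indicator T x * (norm (ned (A T) (B T) x))\<^sup>2 \<partial>lborel)" for T
  define C2 where "C2 = 272 * \<gamma> ^ 3"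
  have C2: "C2 > 0" using \<gamma> by (simp add: C2_def)
  define good where "good T a' b' \<longleftrightarrow> (\<forall>u\<in>vert T. \<forall>v\<in>vert T. rdot (v - u) (ned a' b' u) = complex_of_real (w u v) * rdot (v - u) (ned (A T) (B T) u))
     \<and> sqrt (m T) * norm (2 *\<^sub>R b' - (e T)\<^sup>2 *\<^sub>R (2 *\<^sub>R B T)) \<le> 272 * \<gamma> ^ 6 * \<delta> T / diameter T * sqrt (Q T)
     \<and> (\<forall>x\<in>T. sqrt (m T) * norm (ned a' b' x) \<le> C2 * sqrt (Q T))
     \<and> ((\<forall>p\<in>vert T. \<forall>q\<in>vert T. w p q = 0) \<longrightarrow> a' = 0 \<and> b' = 0)" for T a' b'
  have "\<forall>T\<in>\<T>. \<exists>ab'. good T (fst ab') (snd ab')"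
  proof
    fix T assume T: "T \<in> \<T>"
    interpret t: tetrahedron "vert T" "gr T" "off T" using T by (rule tet)
    have Te: "t.T = T" using T_eq[OF T] .
    have mT: "measure lebesgue T = m T" using tet_open[OF T] by (simp add: m_def measure_completion borel_open)
    have "(diameter T) ^ 3 \<le> (\<gamma> * root 3 (m T)) ^ 3"
      using quasi(1)[OF T] diameter_pos[OF T] unfolding mT by (intro power_mono) auto
    also have "\<dots> = \<gamma> ^ 3 * m T" by (simp add: power_mult_distrib m_def)
    finally have d3: "(diameter T) ^ 3 \<le> \<gamma> ^ 3 * measure lborel t.T" by (simp add: m_def Te)
    \<comment> \<open>Edge midpoints and the reference point lie in the same closed element, so the
      cutoff values differ by at most the slope \<open>4 / L\<close> times \<open>h\<close>.\<close>
    have "\<bar>w p q - (e T)\<^sup>2\<bar> \<le> \<delta> T" if pq: "p \<in> vert T" "q \<in> vert T" for p q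
      unfolding w_def \<delta>_def
    proof (rule square_difference_le)
      let ?x = "(1/2) *\<^sub>R (p + q)"
      have "\<bar>\<eta> ?x - e T\<bar> \<le> 4 / L * norm (?x - xT T)"
        unfolding \<eta>_def e_def by (rule cutoff_lipschitz[OF L(1)])
      also have "\<dots> \<le> 4 / L * h"
      proof (rule mult_left_mono)
        have "norm (?x - xT T) \<le> diameter T"
          using hull_dist[OF T mid[OF pq]] xT(1)[OF T] tet_subset_hull[OF T] by blast
        also have "diameter T \<le> h" unfolding h_def by (rule diameter_le_mesh_size[OF T])
        finally show "norm (?x - xT T) \<le> h" .
      qed (use L in simp)
      finally show "\<bar>\<eta> ?x - e T\<bar> \<le> 4 * h / L" by simp
    qed (simp_all add: \<eta>b eb)
    have "\<exists>a' b'. good T a' b'"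
      unfolding good_def m_def Q_def C2_def
    proof (rule t.interp_estimates[of "diameter T" \<gamma> w "(e T)\<^sup>2" "\<delta> T" "A T" "B T", unfolded Te])
      show "norm (u - v) \<le> diameter T" if "u \<in> vert T" "v \<in> vert T" for u v
        using that by (intro hull_dist[OF T] hull_inc)
      show "0 < diameter T" by (rule diameter_pos[OF T])
      show "diameter T ^ 3 \<le> \<gamma> ^ 3 * measure lborel T" using d3 by (simp add: Te)
      show "w p q = w q p" for p q by (simp add: w_def add.commute)
      show "0 \<le> w p q" for p q by (simp add: w_def)
      show "w p q \<le> 1" for p q using \<eta>b[of "(1/2) *\<^sub>R (p + q)"] by (simp add: w_def power_le_one)
    qed (fact | rule \<gamma>)+
    then show "\<exists>ab'. good T (fst ab') (snd ab')" by simp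
  qed
  from bchoice[OF this] obtain ab' where ab': "\<And>T. T \<in> \<T> \<Longrightarrow> good T (fst (ab' T)) (snd (ab' T))" by blast
  define A' where "A' T = fst (ab' T)" for T
  define B' where "B' T = snd (ab' T)" for T
  note abT = ab'[folded A'_def B'_def, unfolded good_def]
  have zero: "A' T = 0" "B' T = 0" if T: "T \<in> \<T>" "\<not> act T" for T
    using abT[OF T(1)] inact(2)[OF T] by simp_all

  \<comment> \<open>Admissibility of the test field\<close>
  define \<Psi> where "\<Psi> = piecewise (\<lambda>T. ned (A' T) (B' T))"
  have \<Psi>0: "\<Psi> \<in> Hcurl0 \<Omega>" unfolding \<Psi>_def
  proof (rule Hcurl0_of_conforming)
    fix V :: vfield assume V: "smooth_field V"
    show "(\<Sum>T\<in>\<T>. \<integral>x. indicator T x *\<^sub>R green (2 *\<^sub>R B' T) (ned (A' T) (B' T)) V x \<partial>lborel) = 0"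
    proof (rule scaled_dofs_conforming[OF conforming_of_Hcurl0[OF W0 WN] _ V])
      show "rdot (v - u) (ned (A' T) (B' T) u) = complex_of_real (w u v) * rdot (v - u) (ned (A T) (B T) u)"
        if "T \<in> \<T>" "u \<in> vert T" "v \<in> vert T" for T u v
        using abT[OF that(1)] that(2,3) by blast
    qed
  qed
  have \<Psi>T: "\<Psi> x = ned (A' T) (B' T) x" if "T \<in> \<T>" "x \<in> T" for T x
    unfolding \<Psi>_def using that by (rule piecewise_eq)
  have \<Psi>X: "\<Psi> \<in> Xh0 \<T> \<Omega>"
  proof -
    have "\<exists>N\<in>nedelec0. AE x in lebesgue_on T. \<Psi> x = N x" if T: "T \<in> \<T>" for T
    proof
      show "ned (A' T) (B' T) \<in> nedelec0" by (auto simp: nedelec0_eq)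
      show "AE x in lebesgue_on T. \<Psi> x = ned (A' T) (B' T) x" using \<Psi>T[OF T] by (intro AE_I2) simp
    qed
    then show ?thesis using \<Psi>0 by (simp add: Xh0_def)
  qed
  \<comment> \<open>Near a point outside \<open>closure \<omega>\<close> no active element can
    occur, because active elements lie inside \<open>\<omega>\<close>; on inactive ones the field is
    zero.\<close>
  have supp: "ess_support \<Omega> \<Psi> \<subseteq> closure \<omega>"
  proof
    fix x assume x: "x \<in> ess_support \<Omega> \<Psi>"
    show "x \<in> closure \<omega>"
    proof (rule ccontr)
      assume "x \<notin> closure \<omega>"
      then have "x \<in> - closure \<omega>" "open (- closure \<omega>)" by (simp_all add: open_Compl)
      then obtain r where r: "r > 0" "ball x r \<subseteq> - closure \<omega>" unfolding open_contains_ball by blast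
      have "AE y in lebesgue. y \<in> \<Omega> \<inter> ball x r \<longrightarrow> \<Psi> y = 0"
        using cover
      proof eventually_elim
        case (elim y)
        show ?case
        proof
          assume y: "y \<in> \<Omega> \<inter> ball x r"
          then obtain T where T: "T \<in> \<T>" "y \<in> T" using elim by blast
          have "y \<notin> \<omega>" using y r(2) closure_subset[of \<omega>] by blast
          then have "\<not> act T" using act_sub[OF T(1)] T(2) y by blast
          then show "\<Psi> y = 0" using \<Psi>T[OF T] zero[OF T(1)] by (simp add: ned_zero)
        qed
      qed
      moreover have "\<Omega> \<inter> ball x r \<in> sets lebesgue" using open_domain by (simp add: borel_open)
      ultimately have "AE y in lebesgue_on (\<Omega> \<inter> ball x r). \<Psi> y = 0" by (simp add: AE_restrict_space_iff)
      then show False using x r(1) by (auto simp: ess_support_def)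
    qed
  qed
  have \<Psi>H: "\<Psi> \<in> Hcurl \<omega>" using Hcurl_subset[OF o\<omega>(2,1)] \<Psi>0 by (simp add: Hcurl0_def)
  define GE where "GE = curl \<omega> E"
  define G\<Psi> where "G\<Psi> = curl \<omega> \<Psi>"
  have E2: "E \<in> L2_field \<omega>" "\<Psi> \<in> L2_field \<omega>" "GE \<in> L2_field \<omega>" "G\<Psi> \<in> L2_field \<omega>"
    using EH \<Psi>H curl_properties(1) by (auto simp: Hcurl_def GE_def G\<Psi>_def)
  have eqE: "AE x in lebesgue. x \<in> T \<inter> \<omega> \<longrightarrow> E x = ned (A T) (B T) x" if "T \<in> \<T>" for T
    using EW WN[OF that] by eventually_elim simp
  have eq\<Psi>: "AE x in lebesgue. x \<in> T \<inter> \<omega> \<longrightarrow> \<Psi> x = ned (A' T) (B' T) x" if "T \<in> \<T>" for T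
    using \<Psi>T[OF that] by (intro AE_I2) simp
  have eqGE: "AE x in lebesgue. x \<in> T \<inter> \<omega> \<longrightarrow> GE x = 2 *\<^sub>R B T" if "T \<in> \<T>" for T
    unfolding GE_def by (rule curl_pieces[OF o\<omega> EH eqE that])
  have eqG\<Psi>: "AE x in lebesgue. x \<in> T \<inter> \<omega> \<longrightarrow> G\<Psi> x = 2 *\<^sub>R B' T" if "T \<in> \<T>" for T
    unfolding G\<Psi>_def by (rule curl_pieces[OF o\<omega> \<Psi>H eq\<Psi> that])

  \<comment> \<open>Testing with the constructed field\<close>
  have i1: "L2_inner \<omega> GE G\<Psi> = (\<Sum>T\<in>\<T>. \<integral>x. indicator T x *\<^sub>R ip (2 *\<^sub>R B T) (2 *\<^sub>R B' T) \<partial>lborel)"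
    by (rule inner_pieces[where act = act, OF s\<omega> o\<omega>(2) E2(3,4) _ _ eqGE eqG\<Psi> act_sub]) (simp_all add: zero)
  have i2: "L2_inner \<omega> E \<Psi> = (\<Sum>T\<in>\<T>. \<integral>x. indicator T x *\<^sub>R ip (ned (A T) (B T) x) (ned (A' T) (B' T) x) \<partial>lborel)"
    by (rule inner_pieces[where act = act, OF s\<omega> o\<omega>(2) E2(1,2) _ _ eqE eq\<Psi> act_sub]) (simp_all add: zero ned_zero continuous_ned)
  have galerkin: "L2_inner \<omega> GE G\<Psi> = \<kappa> * L2_inner \<omega> E \<Psi>"
    using orth[OF \<Psi>X supp] by (simp add: maxwell_form_def GE_def G\<Psi>_def)

  \<comment> \<open>Square roots of the element energies of the curl and of the field. Inactive
    elements are given the value zero, since only active ones are controlled by norms over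
    \<open>\<omega>\<close>.\<close>
  define q where "q T = (if act T then sqrt (m T) * norm (2 *\<^sub>R B T) else 0)" for T
  define n where "n T = (if act T then sqrt (Q T) else 0)" for T
  have m0: "0 \<le> m T" for T by (simp add: m_def)
  have Q0: "0 \<le> Q T" for T by (simp add: Q_def)
  have q2: "(q T)\<^sup>2 = (if act T then m T * (norm (2 *\<^sub>R B T))\<^sup>2 else 0)" for T
    using m0[of T] by (simp add: q_def power_mult_distrib)
  have n2: "(n T)\<^sup>2 = (if act T then Q T else 0)" for T
    using Q0[of T] by (simp add: n_def)
  have mint: "(\<integral>x. indicator T x *\<^sub>R v \<partial>lborel) = m T *\<^sub>R v" if "T \<in> \<T>" for T and v :: "'z::{banach,second_countable_topology}"
  proof -
    have "integrable lborel (indicator T :: real^3 \<Rightarrow> real)"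
      using emeasure_bounded_finite[OF tet_bounded[OF that]] tet_open[OF that] by (simp add: integrable_indicator_iff)
    then show ?thesis by (simp add: m_def)
  qed
  \<comment> \<open>The desired multiple of the curl is the curl of the test field minus a
    commutator; the first part is kept for the Galerkin identity, the second is bounded by the
    interpolation estimate.\<close>
  have local: "(e T)\<^sup>2 * (q T)\<^sup>2 \<le> K / L * (2 * e T + 4 * h / L) * q T * n T
      + Re (\<integral>x. indicator T x *\<^sub>R ip (2 *\<^sub>R B T) (2 *\<^sub>R B' T) \<partial>lborel)" if T: "T \<in> \<T>" for T
  proof (cases "act T")
    case False
    then show ?thesis using zero[OF T] by (simp add: q_def n_def ip_zero_right)
  next
    case True
    let ?b = "2 *\<^sub>R B T" and ?b' = "2 *\<^sub>R B' T"
    have "(e T)\<^sup>2 * (q T)\<^sup>2 = Re (m T *\<^sub>R ip ?b ((e T)\<^sup>2 *\<^sub>R ?b))"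
      unfolding ip_scale_right ip_self using True by (simp add: q2)
    also have "\<dots> = Re (m T *\<^sub>R ip ?b ?b') - Re (m T *\<^sub>R ip ?b (?b' - (e T)\<^sup>2 *\<^sub>R ?b))"
      by (simp add: ip_diff_right algebra_simps)
    finally have split: "(e T)\<^sup>2 * (q T)\<^sup>2 = Re (m T *\<^sub>R ip ?b ?b') - Re (m T *\<^sub>R ip ?b (?b' - (e T)\<^sup>2 *\<^sub>R ?b))" .
    have "- Re (m T *\<^sub>R ip ?b (?b' - (e T)\<^sup>2 *\<^sub>R ?b)) \<le> norm (m T *\<^sub>R ip ?b (?b' - (e T)\<^sup>2 *\<^sub>R ?b))"
      using abs_Re_le_cmod[of "m T *\<^sub>R ip ?b (?b' - (e T)\<^sup>2 *\<^sub>R ?b)"] by linarith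
    also have "\<dots> \<le> m T * (norm ?b * norm (?b' - (e T)\<^sup>2 *\<^sub>R ?b))"
      using m0[of T] norm_ip_le[of ?b "?b' - (e T)\<^sup>2 *\<^sub>R ?b"] by (simp add: mult_left_mono)
    also have "\<dots> = q T * (sqrt (m T) * norm (?b' - (e T)\<^sup>2 *\<^sub>R ?b))"
    proof -
      have "sqrt (m T) * sqrt (m T) = m T" using m0[of T] by simp
      moreover have "q T * (sqrt (m T) * y) = (sqrt (m T) * sqrt (m T)) * (norm ?b * y)" for y
        using True by (simp only: q_def if_True mult_ac)
      ultimately show ?thesis by (simp only:)
    qed
    also have "\<dots> \<le> q T * (K / L * (2 * e T + 4 * h / L) * n T)"
    proof (rule mult_left_mono)
      have "sqrt (m T) * norm (?b' - (e T)\<^sup>2 *\<^sub>R ?b) \<le> 272 * \<gamma> ^ 6 * \<delta> T / diameter T * sqrt (Q T)"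
        using abT[OF T] by blast
      also have "\<dots> \<le> K / L * (2 * e T + 4 * h / L) * sqrt (Q T)"
      proof (rule mult_right_mono)
        \<comment> \<open>The origin of \<open>K\<close>: 1088 is 272 times the 4 of the cutoff
          slope, and quasi-uniformity bounds \<open>h / diameter T\<close> by
          \<open>\<gamma>'\<close>.\<close>
        have "272 * \<gamma> ^ 6 * \<delta> T / diameter T = 1088 * \<gamma> ^ 6 / L * (2 * e T + 4 * h / L) * (h / diameter T)"
          by (simp add: \<delta>_def)
        also have "\<dots> \<le> 1088 * \<gamma> ^ 6 / L * (2 * e T + 4 * h / L) * \<gamma>'"
        proof (rule mult_left_mono)
          show "h / diameter T \<le> \<gamma>'"
            using quasi(2)[OF T] diameter_pos[OF T] by (simp add: h_def pos_divide_le_eq)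
          show "0 \<le> 1088 * \<gamma> ^ 6 / L * (2 * e T + 4 * h / L)" using \<gamma> L h eb[of T] by simp
        qed
        also have "\<dots> = K / L * (2 * e T + 4 * h / L)" by (simp add: K_def)
        finally show "272 * \<gamma> ^ 6 * \<delta> T / diameter T \<le> K / L * (2 * e T + 4 * h / L)" .
      qed (use Q0 in simp)
      finally show "sqrt (m T) * norm (?b' - (e T)\<^sup>2 *\<^sub>R ?b) \<le> K / L * (2 * e T + 4 * h / L) * n T"
        using True by (simp add: n_def)
      show "0 \<le> q T" using m0[of T] by (simp add: q_def)
    qed
    finally have "- Re (m T *\<^sub>R ip ?b (?b' - (e T)\<^sup>2 *\<^sub>R ?b)) \<le> K / L * (2 * e T + 4 * h / L) * q T * n T"
      by (simp only: mult_ac)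
    then show ?thesis unfolding mint[OF T] split by linarith
  qed
  have low: "norm (\<integral>x. indicator T x *\<^sub>R ip (ned (A T) (B T) x) (ned (A' T) (B' T) x) \<partial>lborel) \<le> C2 * (n T)\<^sup>2" if T: "T \<in> \<T>" for T
  proof (cases "act T")
    case False
    then show ?thesis using zero[OF T] by (simp add: ned_zero ip_zero_right n2)
  next
    case True
    interpret t: tetrahedron "vert T" "gr T" "off T" using T by (rule tet)
    show ?thesis using t.integral_ip_le[OF C2, of "A' T" "B' T" "A T" "B T"] abT[OF T] True
      unfolding T_eq[OF T] n2 Q_def m_def by simp
  qed
  have "(\<Sum>T\<in>\<T>. (e T)\<^sup>2 * (q T)\<^sup>2) \<le> (\<Sum>T\<in>\<T>. K / L * (2 * e T + 4 * h / L) * q T * n T) + Re (L2_inner \<omega> GE G\<Psi>)"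
    using sum_mono[OF local] by (simp add: sum.distrib i1)
  \<comment> \<open>Orthogonality trades the curl pairing for \<open>\<kappa>\<close> times a
    pairing without derivatives, of which only the modulus is used.\<close>
  also have "Re (L2_inner \<omega> GE G\<Psi>) \<le> K2 * (\<Sum>T\<in>\<T>. (n T)\<^sup>2)"
  proof -
    have "Re (L2_inner \<omega> GE G\<Psi>) \<le> norm \<kappa> * norm (L2_inner \<omega> E \<Psi>)"
      unfolding galerkin norm_mult[symmetric] by (rule complex_Re_le_cmod)
    also have "\<dots> \<le> norm \<kappa> * (\<Sum>T\<in>\<T>. C2 * (n T)\<^sup>2)"
      unfolding i2 using low by (intro mult_left_mono sum_norm_le) auto
    also have "\<dots> = K2 * (\<Sum>T\<in>\<T>. (n T)\<^sup>2)" by (simp add: K2_def C2_def sum_distrib_left[symmetric])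
    finally show ?thesis .
  qed
  finally have S: "(\<Sum>T\<in>\<T>. (e T)\<^sup>2 * (q T)\<^sup>2) \<le> (\<Sum>T\<in>\<T>. K / L * (2 * e T + 4 * h / L) * q T * n T) + K2 * (\<Sum>T\<in>\<T>. (n T)\<^sup>2)"
    by simp
  \<comment> \<open>Elements meeting the small box have reference value one by the choice of the
    reference point, so the sum over whole elements bounds the energy over the box.\<close>
  have "(L2_norm (cube c R \<inter> \<Omega>) GE)\<^sup>2 \<le> (\<Sum>T\<in>\<T>. (e T)\<^sup>2 * (measure lborel T * (norm (2 *\<^sub>R B T))\<^sup>2))"
  proof (rule energy_upper)
    have sub: "cube c R \<inter> \<Omega> \<subseteq> \<omega>"
      unfolding \<omega>_def cube_def using \<epsilon> R by (auto intro: less_trans)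
    show "cube c R \<inter> \<Omega> \<in> sets lebesgue" using open_cube open_domain by (simp add: borel_open)
    then show "GE \<in> L2_field (cube c R \<inter> \<Omega>)" using L2_field_subset[OF sub _ s\<omega> E2(3)] by simp
    show "AE x in lebesgue. x \<in> T \<inter> (cube c R \<inter> \<Omega>) \<longrightarrow> GE x = 2 *\<^sub>R B T" if "T \<in> \<T>" for T
      using eqGE[OF that] by eventually_elim (use sub in blast)
  qed (use e_one in simp_all)
  \<comment> \<open>Here \<open>q\<close> vanishes on inactive elements, where the factor
    \<open>e T\<close> is zero anyway.\<close>
  also have "\<dots> = (\<Sum>T\<in>\<T>. (e T)\<^sup>2 * (q T)\<^sup>2)"
    using inact(1) by (intro sum.cong refl) (simp add: q2 m_def)
  also have "\<dots> \<le> (4 * K\<^sup>2 + 4 * K + 2 * K2 * D\<^sup>2) / L\<^sup>2 * (h\<^sup>2 * (\<Sum>T\<in>\<T>. (q T)\<^sup>2) + (\<Sum>T\<in>\<T>. (n T)\<^sup>2))"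
    by (rule absorption_inequality[OF S K L h])
  also have "\<dots> \<le> (4 * K\<^sup>2 + 4 * K + 2 * K2 * D\<^sup>2) / L\<^sup>2 * (h\<^sup>2 * (L2_norm \<omega> GE)\<^sup>2 + (L2_norm \<omega> E)\<^sup>2)"
  proof (intro mult_left_mono add_mono)
    have "(\<Sum>T\<in>\<T>. (q T)\<^sup>2) = (\<Sum>T\<in>\<T>. if act T then \<integral>x. indicator T x * (norm (2 *\<^sub>R B T))\<^sup>2 \<partial>lborel else 0)"
      unfolding q2 by (intro sum.cong refl) (simp add: m_def)
    also have "\<dots> \<le> (L2_norm \<omega> GE)\<^sup>2"
      by (rule energy_lower[OF s\<omega> E2(3) continuous_on_const eqGE act_sub])
    finally show "(\<Sum>T\<in>\<T>. (q T)\<^sup>2) \<le> (L2_norm \<omega> GE)\<^sup>2" .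
    have "(\<Sum>T\<in>\<T>. (n T)\<^sup>2) = (\<Sum>T\<in>\<T>. if act T then \<integral>x. indicator T x * (norm (ned (A T) (B T) x))\<^sup>2 \<partial>lborel else 0)"
      unfolding n2 Q_def ..
    also have "\<dots> \<le> (L2_norm \<omega> E)\<^sup>2"
      by (rule energy_lower[OF s\<omega> E2(1) continuous_ned eqE act_sub])
    finally show "(\<Sum>T\<in>\<T>. (n T)\<^sup>2) \<le> (L2_norm \<omega> E)\<^sup>2" .
  qed (use K in simp_all)
  finally show ?thesis unfolding GE_def .
qed

end

section \<open>Meshes of polyhedral domains and the uniform constant\<close>

lemma negligible_polyhedral_frontier:
  assumes "polyhedral \<Omega>" shows "negligible (frontier \<Omega>)"
proof -
  obtain F where F: "finite F" "\<And>P. P \<in> F \<Longrightarrow> polytope P \<and> aff_dim P = 2" "frontier \<Omega> = \<Union>F"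
    using assms by (auto simp: polyhedral_def)
  have "negligible P" if "P \<in> F" for P
  proof -
    have "aff_dim P \<noteq> int DIM(real^3)" using F(2)[OF that] by simp
    then have "interior P = {}" by (rule low_dim_interior)
    moreover have "convex P" using F(2)[OF that] by (simp add: polytope_imp_convex)
    ultimately show ?thesis by (simp add: negligible_convex_interior)
  qed
  then show ?thesis unfolding F(3) using F(1) by (intro negligible_Union)
qed

text \<open>Each simplex supplies its vertex set, and with it gradients and offsets. The covering
  holds for closures by assumption; it passes to open sets away from the boundary of the domain and
  the boundaries of the elements, which are null sets.\<close>

lemma domain_mesh_of_tet_mesh:
  assumes \<Omega>: "bounded \<Omega>" "open \<Omega>" "polyhedral \<Omega>" and mesh: "tet_mesh \<Omega> \<T>"
  shows "\<exists>vert gr off. domain_mesh \<T> vert gr off \<Omega>"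
proof -
  have ex: "\<forall>T\<in>\<T>. \<exists>d. tetrahedron (fst d) (fst (snd d)) (snd (snd d)) \<and> interior (convex hull (fst d)) = T"
  proof
    fix T assume "T \<in> \<T>"
    then obtain S where S: "3 simplex S" "T = interior S" using mesh by (auto simp: tet_mesh_def)
    then obtain P where P: "\<not> affine_dependent P" "int (card P) = 3 + 1" "S = convex hull P" by (auto simp: simplex_def)
    from P(2) have "card P = 4" by simp
    then obtain g \<beta> where "tetrahedron P g \<beta>" using tetrahedron_exists[OF _ P(1)] by blast
    then show "\<exists>d. tetrahedron (fst d) (fst (snd d)) (snd (snd d)) \<and> interior (convex hull (fst d)) = T"
      using S(2) P(3) by (intro exI[of _ "(P, g, \<beta>)"]) simp
  qed
  from bchoice[OF ex] obtain d where d: "\<And>T. T \<in> \<T> \<Longrightarrow> tetrahedron (fst (d T)) (fst (snd (d T))) (snd (snd (d T)))"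
    "\<And>T. T \<in> \<T> \<Longrightarrow> interior (convex hull (fst (d T))) = T" by blast
  define vert where "vert T = fst (d T)" for T
  define gr where "gr T = fst (snd (d T))" for T
  define off where "off T = snd (snd (d T))" for T
  have tet: "tetrahedron (vert T) (gr T) (off T)" if "T \<in> \<T>" for T
    using d(1)[OF that] by (simp add: vert_def gr_def off_def)
  have int: "interior (convex hull vert T) = T" if "T \<in> \<T>" for T
    using d(2)[OF that] by (simp add: vert_def)
  have T_eq: "tetrahedron.T (vert T) (gr T) (off T) = T" if "T \<in> \<T>" for T
    using tetrahedron.interior_convex_hull_eq[OF tet[OF that]] int[OF that] by simp
  have cl: "closure T = convex hull vert T" if "T \<in> \<T>" for T
    using tetrahedron.closure_T[OF tet[OF that]] T_eq[OF that] by simp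
  have tri: "triangulation (closure ` \<T>)" and cov: "\<Union>(closure ` \<T>) = closure \<Omega>"
    using mesh by (simp_all add: tet_mesh_def)
  \<comment> \<open>Finiteness is given for the closed tetrahedra. An open element is the interior
    of its closure, so taking closures is injective and the mesh itself is finite.\<close>
  have inj: "inj_on closure \<T>"
  proof (rule inj_onI)
    fix T T' assume T: "T \<in> \<T>" "T' \<in> \<T>" "closure T = closure T'"
    have "T = interior (closure T)" using int[OF T(1)] cl[OF T(1)] by simp
    also have "\<dots> = T'" using int[OF T(2)] cl[OF T(2)] T(3) by simp
    finally show "T = T'" .
  qed
  have fin: "finite \<T>" using tri finite_image_iff[OF inj] by (simp add: triangulation_def)
  have faces: "convex hull vert T \<inter> convex hull vert T' face_of convex hull vert T" if "T \<in> \<T>" "T' \<in> \<T>" for T T'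
  proof -
    have "closure T \<inter> closure T' face_of closure T" using tri that unfolding triangulation_def by blast
    then show ?thesis by (simp only: cl[OF that(1)] cl[OF that(2)])
  qed
  define N where "N = frontier \<Omega> \<union> (\<Union>T\<in>\<T>. frontier (convex hull vert T))"
  have "negligible N" unfolding N_def
    using fin by (intro negligible_Un negligible_polyhedral_frontier \<Omega> negligible_Union)
      (auto intro: negligible_convex_frontier)
  then have "AE x in lebesgue. x \<notin> N" by (simp add: negligible_iff_null_sets AE_not_in)
  then have cover: "AE x in lebesgue. x \<in> \<Omega> \<longleftrightarrow> x \<in> \<Union>\<T>"
  proof eventually_elim
    case (elim x)
    show ?case
    proof
      assume "x \<in> \<Omega>"
      then have "x \<in> \<Union>(closure ` \<T>)" using cov closure_subset by blast
      then obtain T where T: "T \<in> \<T>" "x \<in> closure T" by blast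
      have "x \<notin> frontier (convex hull vert T)" using elim T(1) by (auto simp: N_def)
      moreover have "x \<in> closure (convex hull vert T)" using T(2) cl[OF T(1)] closure_subset by blast
      ultimately have "x \<in> interior (convex hull vert T)" by (simp add: frontier_def)
      then show "x \<in> \<Union>\<T>" using int[OF T(1)] T(1) by blast
    next
      assume "x \<in> \<Union>\<T>"
      then obtain T where T: "T \<in> \<T>" "x \<in> T" by blast
      then have "x \<in> \<Union>(closure ` \<T>)" using closure_subset by blast
      then have "x \<in> closure \<Omega>" using cov by simp
      moreover have "x \<notin> frontier \<Omega>" using elim by (simp add: N_def)
      ultimately show "x \<in> \<Omega>" using interior_open[OF \<Omega>(2)] by (simp add: frontier_def)
    qed
  qed
  have "domain_mesh \<T> vert gr off \<Omega>"
    by (intro domain_mesh.intro tet_family.intro domain_mesh_axioms.intro fin tet T_eq faces \<Omega> cover)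
  then show ?thesis by blast
qed

theorem lemma8:
  fixes \<Omega> :: "(real^3) set" and \<kappa> :: complex and \<gamma> \<gamma>' :: real
  assumes "bounded \<Omega>" and "simply_connected \<Omega>" and "lipschitz_domain \<Omega>" and "polyhedral \<Omega>"
    and "\<exists>freq \<epsilon>d \<sigma>c :: real. freq \<noteq> 0 \<and> \<epsilon>d > 0 \<and> \<sigma>c \<ge> 0 \<and>
           \<kappa> = complex_of_real (freq\<^sup>2) * (complex_of_real \<epsilon>d + \<i> * complex_of_real (\<sigma>c / freq))"
    and "\<not> curlcurl_eigenvalue \<Omega> \<kappa>"
    and "\<gamma> > 0" and "\<gamma>' > 0"
  shows "\<exists>C>0. \<forall>(\<T> :: (real^3) set set) (\<epsilon> :: real) (R :: real) (c :: real^3) (E :: vfield).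
      tet_mesh \<Omega> \<T> \<longrightarrow> quasi_uniform \<gamma> \<gamma>' \<T> \<longrightarrow>
      0 < \<epsilon> \<longrightarrow> \<epsilon> < 1 \<longrightarrow> 0 < R \<longrightarrow> R < 2 * diameter \<Omega> \<longrightarrow> mesh_size \<T> / R < \<epsilon> / 4 \<longrightarrow>
      E \<in> Hch \<kappa> \<T> \<Omega> (cube c ((1 + \<epsilon>) * R)) \<longrightarrow>
      L2_norm (cube c R \<inter> \<Omega>) (curl (cube c ((1 + \<epsilon>) * R) \<inter> \<Omega>) E)
        \<le> C * ((1 + \<epsilon>) / \<epsilon>) * weighted_norm \<Omega> c (mesh_size \<T>) ((1 + \<epsilon>) * R) E"
proof -
  \<comment> \<open>The constants are fixed before the mesh, the boxes and the field; the domain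
    enters through its diameter, because \<epsilon> R is below \<open>D\<close>.\<close>
  define K where "K = 1088 * \<gamma> ^ 6 * \<gamma>'"
  define K2 where "K2 = norm \<kappa> * (272 * \<gamma> ^ 3)"
  define D where "D = 2 * diameter \<Omega>"
  define M where "M = 4 * K\<^sup>2 + 4 * K + 2 * K2 * D\<^sup>2"
  have K: "K > 0" "K2 \<ge> 0" using assms(7,8) by (simp_all add: K_def K2_def)
  have M: "M > 0" unfolding M_def using K by (intro add_pos_nonneg add_pos_pos) simp_all
  show ?thesis
  proof (intro exI[of _ "sqrt M"] conjI allI impI)
    show "sqrt M > 0" using M by simp
    fix \<T> :: "(real^3) set set" and \<epsilon> R :: real and c :: "real^3" and E :: vfield
    assume mesh: "tet_mesh \<Omega> \<T>" and quasi: "quasi_uniform \<gamma> \<gamma>' \<T>"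
      and \<epsilon>: "0 < \<epsilon>" "\<epsilon> < 1" and R: "0 < R" "R < 2 * diameter \<Omega>" and hR: "mesh_size \<T> / R < \<epsilon> / 4"
      and E: "E \<in> Hch \<kappa> \<T> \<Omega> (cube c ((1 + \<epsilon>) * R))"
    have open\<Omega>: "open \<Omega>" "\<Omega> \<noteq> {}" using assms(3) by (simp_all add: lipschitz_domain_def)
    have ne: "\<T> \<noteq> {}"
    proof
      assume "\<T> = {}"
      then have "closure \<Omega> = {}" using mesh by (simp add: tet_mesh_def)
      then show False using open\<Omega>(2) by simp
    qed
    obtain vert gr off where "domain_mesh \<T> vert gr off \<Omega>"
      using domain_mesh_of_tet_mesh[OF assms(1) open\<Omega>(1) assms(4) mesh] by blast
    then interpret domain_mesh \<T> vert gr off \<Omega> .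
    let ?Q = "cube c ((1 + \<epsilon>) * R)" and ?h = "mesh_size \<T>"
    let ?r = "(1 + \<epsilon>) * R"
    let ?N = "?h\<^sup>2 * (L2_norm (?Q \<inter> \<Omega>) (curl (?Q \<inter> \<Omega>) E))\<^sup>2 + (L2_norm (?Q \<inter> \<Omega>) E)\<^sup>2"
    have "(L2_norm (cube c R \<inter> \<Omega>) (curl (?Q \<inter> \<Omega>) E))\<^sup>2 \<le> M / (\<epsilon> * R)\<^sup>2 * ?N"
      unfolding M_def K_def K2_def D_def
      by (rule discrete_caccioppoli) (use quasi assms(7,8) \<epsilon> R hR E ne in \<open>simp_all add: quasi_uniform_def\<close>)
    also have "\<dots> = (sqrt M * ((1 + \<epsilon>) / \<epsilon>) * weighted_norm \<Omega> c ?h ?r E)\<^sup>2"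
    proof -
      have "(weighted_norm \<Omega> c ?h ?r E)\<^sup>2 = ?N / ?r\<^sup>2"
        by (simp add: weighted_norm_def add_divide_distrib)
      moreover have "(sqrt M * a * u)\<^sup>2 = M * a\<^sup>2 * u\<^sup>2" for a u
        using M by (simp add: power_mult_distrib)
      ultimately have "(sqrt M * ((1 + \<epsilon>) / \<epsilon>) * weighted_norm \<Omega> c ?h ?r E)\<^sup>2 = M * ((1 + \<epsilon>) / \<epsilon>)\<^sup>2 * (?N / ?r\<^sup>2)"
        by (simp only:)
      also have "\<dots> = M * (((1 + \<epsilon>) / \<epsilon>)\<^sup>2 / ?r\<^sup>2) * ?N" by simp
      \<comment> \<open>The factor of the statement converts the scale \<epsilon> R of the cutoff
        into the side length of the larger box, by which the weighted norm is normalised.\<close>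
      also have "((1 + \<epsilon>) / \<epsilon>)\<^sup>2 / ?r\<^sup>2 = 1 / (\<epsilon> * R)\<^sup>2"
        using \<epsilon> R by (simp add: power_divide power_mult_distrib)
      finally show ?thesis by simp
    qed
    finally show "L2_norm (cube c R \<inter> \<Omega>) (curl (?Q \<inter> \<Omega>) E) \<le> sqrt M * ((1 + \<epsilon>) / \<epsilon>) * weighted_norm \<Omega> c ?h ?r E"
    proof (rule power2_le_imp_le)
      show "0 \<le> sqrt M * ((1 + \<epsilon>) / \<epsilon>) * weighted_norm \<Omega> c ?h ?r E"
        using M \<epsilon> by (simp add: weighted_norm_def)
    qed
  qed
qed

end
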